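(* Let $\mathscr{A}$ be a partial bialgebra with total algebra $A$, total comultiplication $\Delta$ and counit $\epsilon$. Define linear maps $A\otimes A\to A\otimes A$ by $$T_1(a\otimes b)=\Delta(a)(1\otimes b),\qquad T_2(a\otimes b)=(a\otimes1)\Delta(b),$$ $$G_1(a\otimes b)=\sum_p a\rho_p\otimes\rho_pb,\quad E_1(a\otimes b)=\sum_p\rho_pa\otimes\lambda_pb,\quad G_2(a\otimes b)=\sum_pa\lambda_p\otimes\lambda_pb,\quad E_2(a\otimes b)=\sum_pa\rho_p\otimes b\lambda_p .$$ Then the following conditions are equivalent: (1) $\mathscr{A}$ is a partial Hopf algebra. (2) There exist linear maps $R_1,R_2:A\otimes A\to A\otimes A$ such that for $i=1,2$: $T_iR_i=E_i$, $R_iT_i=G_i$, $T_iR_iT_i=T_i$ and $R_iT_iR_i=R_i$. (3) $(A,\Delta,\epsilon)$ is a weak multiplier Hopf algebra in the sense of Van Daele and Wang. If these conditions hold, then the total antipode of $\mathscr{A}$ coincides with the antipode of the weak multiplier Hopf algebra $(A,\Delta,\epsilon)$.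
   Context: Let $I$ be a set. An assignment $(r,s)\mapsto x_{rs}$ is rcf if for each fixed $r$ only finitely many $x_{rs}$ are nonzero, and likewise for each fixed $s$. PARTIAL BIALGEBRAS. An $I$-partial bialgebra $\mathscr{A}$ (object set $I$) consists of complex vector spaces $A^{kl}_{mn}$ ($k,l,m,n\in I$); associative multiplications $A^{kl}_{mn}\otimes A^{lp}_{nq}\to A^{kp}_{mq}$ with unit elements $\mathbf{1}^k_m\in A^{kk}_{mm}$ (possibly zero), so $\mathbf 1^k_m a=a=a\mathbf 1^l_n$ for $a\in A^{kl}_{mn}$; comultiplications $\Delta_{rs}:A^{kl}_{mn}\to A^{kl}_{rs}\otimes A^{rs}_{mn}$ with $(\Delta_{pq}\otimes\mathrm{id})\Delta_{rs}=(\mathrm{id}\otimes\Delta_{rs})\Delta_{pq}$; and counits $\epsilon:A^{kl}_{kl}\to\mathbb{C}$, extended by $0$ to $A^{kl}_{mn}$ with $(k,l)\ne(m,n)$, with $(\epsilon\otimes\mathrm{id})\Delta_{kl}(a)=a=(\mathrm{id}\otimes\epsilon)\Delta_{mn}(a)$ for $a\in A^{kl}_{mn}$; such that: (1) $\Delta_{l,l'}(\mathbf 1^k_m)=\delta_{l,l'}\mathbf 1^k_l\otimes\mathbf 1^l_m$; (2) $\epsilon(ab)=\epsilon(a)\epsilon(b)$ for $a\in A^{kl}_{mn},b\in A^{lp}_{nq}$; (3) $\epsilon(\mathbf 1^k_k)=1$; (4) for each $a\in A^{kl}_{mn}$, $(r,s)\mapsto\Delta_{rs}(a)$ is rcf;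 (5) $\Delta_{rs}(ab)=\sum_t\Delta_{rt}(a)\Delta_{ts}(b)$ for composable $a,b$. TOTAL OBJECTS. The total algebra is $A=\bigoplus A^{kl}_{mn}$ (non-composable products are $0$), and $\epsilon:A\to\mathbb C$ the linear extension. $M(\cdot)$ denotes the multiplier algebra. In $M(A)$ put $\lambda_k=\sum_l\mathbf 1^k_l$ and $\rho_l=\sum_k\mathbf 1^k_l$ (strictly convergent sums). The total comultiplication is the homomorphism $\Delta:A\to M(A\otimes A)$ such that $\Delta_{rs}(a)=(1\otimes\lambda_r)\Delta(a)(1\otimes\lambda_s)=(\rho_r\otimes1)\Delta(a)(\rho_s\otimes1)$ for all $r,s$ and homogeneous $a$. $T_1,T_2$ do take values in $A\otimes A$. PARTIAL HOPF ALGEBRAS. An antipode for $\mathscr A$ consists of linear maps $S:A^{kl}_{mn}\to A^{nm}_{lk}$ such that, with $M_A$ the multiplication, for all $r$ and $a\in A^{kl}_{ml}$: $\sum_s M_A(\mathrm{id}\otimes S)\Delta_{rs}(a)=\delta_{k,m}\epsilon(a)\mathbf 1^k_r$, and for all $s$ and $a\in A^{kl}_{kn}$: $\sum_r M_A(S\otimes\mathrm{id})\Delta_{rs}(a)=\delta_{l,n}\epsilon(a)\mathbf 1^s_n$. $\mathscr{A}$ is a partial Hopf algebra if it admits an antipode; its linear extension $S:A\to A$ is the total antipode. WEAK MULTIPLIER HOPF ALGEBRAS (Van Daele–Wang). Let $A$ be an idempotent algebra with non-degenerate product, and $\Delta:A\to M(A\otimes A)$ a coproduct, i.e. a homomorphism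 with $\Delta(a)(1\otimes b),(a\otimes1)\Delta(b)\in A\otimes A$ that is coassociative: $(a\otimes1\otimes1)(\Delta\otimes\mathrm{id})(\Delta(b)(1\otimes c))=(\mathrm{id}\otimes\Delta)((a\otimes1)\Delta(b))(1\otimes1\otimes c)$. Assume $\Delta$ is full (if $V,W\subseteq A$ are subspaces with $\Delta(A)(1\otimes A)\subseteq V\otimes A$ and $(A\otimes1)\Delta(A)\subseteq A\otimes W$, then $V=W=A$) and that there is a counit $\epsilon$: $(\epsilon\otimes\mathrm{id})(\Delta(a)(1\otimes b))=ab=(\mathrm{id}\otimes\epsilon)((a\otimes1)\Delta(b))$. Then $(A,\Delta)$ is a weak multiplier Hopf algebra if there is an idempotent $E\in M(A\otimes A)$ with $T_1(A\otimes A)=E(A\otimes A)$ and $T_2(A\otimes A)=(A\otimes A)E$, satisfying $(\Delta\otimes\mathrm{id})(E)=(E\otimes1)(1\otimes E)=(1\otimes E)(E\otimes1)=(\mathrm{id}\otimes\Delta)(E)$ (where $\Delta$ is extended to multipliers with $\Delta(1)=E$), and such that $\ker T_i=(1-G_i)(A\otimes A)$ for $i=1,2$, where $G_1,G_2:A\otimes A\to A\otimes A$ are the unique linear idempotents with $(G_1\otimes\mathrm{id})(\Delta_{13}(a)(1\otimes b\otimes c))=\Delta_{13}(a)(1\otimes E)(1\otimes b\otimes c)$ and $(\mathrm{id}\otimes G_2)((a\otimes b\otimes1)\Delta_{13}(c))=(a\otimes b\otimes1)(E\otimes1)\Delta_{13}(c)$. The antipode is then the unique linear map $S:A\to M(A)$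 such that the maps $R_1(a\otimes b)=\sum a_{(1)}\otimes S(a_{(2)})b$ and $R_2(a\otimes b)=\sum aS(b_{(1)})\otimes b_{(2)}$ are the generalized inverses of $T_1,T_2$ with $T_1R_1=E\,\cdot\,$, $T_2R_2=\,\cdot\,E$ and $R_iT_i=G_i$. *)

theory Defs
  imports "HOL-Analysis.Analysis" "HOL-Library.Poly_Mapping"
begin

section \<open>Complex vector spaces and complex algebras\<close>

class complex_vector = ab_group_add +
  fixes scaleC :: "complex \<Rightarrow> 'a \<Rightarrow> 'a"  (infixr "*\<^sub>C" 75)
  assumes scaleC_add_right: "c *\<^sub>C (x + y) = c *\<^sub>C x + c *\<^sub>C y"
    and scaleC_add_left: "(c + d) *\<^sub>C x = c *\<^sub>C x + d *\<^sub>C x"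
    and scaleC_scaleC: "c *\<^sub>C d *\<^sub>C x = (c * d) *\<^sub>C x"
    and scaleC_one: "1 *\<^sub>C x = x"

global_interpretation complex_vector: vector_space "scaleC :: complex \<Rightarrow> 'a \<Rightarrow> 'a::complex_vector"
  by unfold_locales (simp_all add: scaleC_add_right scaleC_add_left scaleC_scaleC scaleC_one)

abbreviation csubspace :: "'a::complex_vector set \<Rightarrow> bool" where
  "csubspace \<equiv> module.subspace scaleC"

abbreviation cspan :: "'a::complex_vector set \<Rightarrow> 'a set" where
  "cspan \<equiv> module.span scaleC"

abbreviation clinear :: "('a::complex_vector \<Rightarrow> 'b::complex_vector) \<Rightarrow> bool" where
  "clinear \<equiv> Vector_Spaces.linear scaleC scaleC"

definition cbilinear :: "('a::complex_vector \<Rightarrow> 'b::complex_vector \<Rightarrow> 'c::complex_vector) \<Rightarrow> bool" where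
  "cbilinear B \<longleftrightarrow> (\<forall>a. clinear (B a)) \<and> (\<forall>b. clinear (\<lambda>a. B a b))"

text \<open>Complex associative algebras, not necessarily unital.\<close>

class complex_algebra = complex_vector + ring +
  assumes mult_scaleC_left: "(c *\<^sub>C x) * y = c *\<^sub>C (x * y)"
    and mult_scaleC_right: "x * (c *\<^sub>C y) = c *\<^sub>C (x * y)"

instantiation complex :: complex_algebra
begin
definition scaleC_complex :: "complex \<Rightarrow> complex \<Rightarrow> complex" where
  "scaleC_complex c x = c * x"
instance by standard (simp_all add: scaleC_complex_def algebra_simps)
end

instantiation poly_mapping :: (type, complex_vector) complex_vector
begin
lift_definition scaleC_poly_mapping :: "complex \<Rightarrow> ('a \<Rightarrow>\<^sub>0 'b) \<Rightarrow> ('a \<Rightarrow>\<^sub>0 'b)"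
  is "\<lambda>c f x. c *\<^sub>C f x"
  by (rule finite_subset[rotated]) auto
instance
  by standard (transfer; simp add: fun_eq_iff scaleC_add_right scaleC_add_left scaleC_scaleC scaleC_one)+
end

lemma clinearI:
  assumes "\<And>x y. f (x + y) = f x + f y" "\<And>c x. f (c *\<^sub>C x) = c *\<^sub>C f x"
  shows "clinear f"
  by (simp add: Vector_Spaces.linear_def module_hom_def module_hom_axioms_def assms
      complex_vector.vector_space_axioms complex_vector.module_axioms)

lemma clinear_add: "clinear f \<Longrightarrow> f (x + y) = f x + f y"
  and clinear_scale: "clinear f \<Longrightarrow> f (c *\<^sub>C x) = c *\<^sub>C f x"
  and clinear_0: "clinear f \<Longrightarrow> f 0 = 0"
  and clinear_diff: "clinear f \<Longrightarrow> f (x - y) = f x - f y"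
  by (auto simp: Vector_Spaces.linear_def module_hom.add module_hom.scale module_hom.zero module_hom.diff)

lemma clinear_compose: "clinear f \<Longrightarrow> clinear g \<Longrightarrow> clinear (\<lambda>x. g (f x))"
  by (rule clinearI) (simp_all add: clinear_add clinear_scale)

lemma clinear_id: "clinear (\<lambda>x. x)"
  by (rule clinearI) simp_all

lemma cbilinearI:
  assumes "\<And>a. clinear (B a)" "\<And>b. clinear (\<lambda>a. B a b)"
  shows "cbilinear B"
  using assms by (simp add: cbilinear_def)

section \<open>The algebraic tensor product\<close>

text \<open>The free complex vector space on pairs, modulo the bilinearity relations.\<close>

inductive_set tensor_relations :: "(('a::complex_vector \<times> 'b::complex_vector) \<Rightarrow>\<^sub>0 complex) set" where
  add_left: "Poly_Mapping.single (a + a', b) 1 - (Poly_Mapping.single (a, b) 1 + Poly_Mapping.single (a', b) 1)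
    \<in> tensor_relations"
| add_right: "Poly_Mapping.single (a, b + b') 1 - (Poly_Mapping.single (a, b) 1 + Poly_Mapping.single (a, b') 1)
    \<in> tensor_relations"
| scale_left: "Poly_Mapping.single (c *\<^sub>C a, b) 1 - c *\<^sub>C Poly_Mapping.single (a, b) 1 \<in> tensor_relations"
| scale_right: "Poly_Mapping.single (a, c *\<^sub>C b) 1 - c *\<^sub>C Poly_Mapping.single (a, b) 1 \<in> tensor_relations"

definition tensor_equiv ::
  "(('a::complex_vector \<times> 'b::complex_vector) \<Rightarrow>\<^sub>0 complex) \<Rightarrow> ('a \<times> 'b \<Rightarrow>\<^sub>0 complex) \<Rightarrow> bool" where
  "tensor_equiv x y \<longleftrightarrow> x - y \<in> cspan tensor_relations"

lemma equivp_tensor_equiv: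
  "equivp (tensor_equiv :: (('a::complex_vector \<times> 'b::complex_vector) \<Rightarrow>\<^sub>0 complex) \<Rightarrow> _)"
proof (rule equivpI)
  show "reflp (tensor_equiv :: ('a \<times> 'b \<Rightarrow>\<^sub>0 complex) \<Rightarrow> _)"
    by (rule reflpI) (simp add: tensor_equiv_def complex_vector.span_zero)
  show "symp (tensor_equiv :: ('a \<times> 'b \<Rightarrow>\<^sub>0 complex) \<Rightarrow> _)"
  proof (rule sympI)
    fix x y :: "('a \<times> 'b) \<Rightarrow>\<^sub>0 complex"
    assume "tensor_equiv x y"
    then have "- (x - y) \<in> cspan tensor_relations"
      unfolding tensor_equiv_def by (rule complex_vector.span_neg)
    then show "tensor_equiv y x" by (simp add: tensor_equiv_def)
  qed
  show "transp (tensor_equiv :: ('a \<times> 'b \<Rightarrow>\<^sub>0 complex) \<Rightarrow> _)"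
  proof (rule transpI)
    fix x y z :: "('a \<times> 'b) \<Rightarrow>\<^sub>0 complex"
    assume "tensor_equiv x y" "tensor_equiv y z"
    then have "(x - y) + (y - z) \<in> cspan tensor_relations"
      unfolding tensor_equiv_def by (rule complex_vector.span_add)
    then show "tensor_equiv x z" by (simp add: tensor_equiv_def)
  qed
qed

quotient_type (overloaded) ('a, 'b) tensor (infixl "\<otimes>" 20) =
  "('a::complex_vector \<times> 'b::complex_vector) \<Rightarrow>\<^sub>0 complex" / tensor_equiv
  by (rule equivp_tensor_equiv)

lift_definition pure_tensor :: "'a::complex_vector \<Rightarrow> 'b::complex_vector \<Rightarrow> 'a \<otimes> 'b"  (infixl "\<otimes>" 68)
  is "\<lambda>a b. Poly_Mapping.single (a, b) 1" .

instantiation tensor :: (complex_vector, complex_vector) complex_vector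
begin

lift_definition zero_tensor :: "'a \<otimes> 'b" is 0 .

lift_definition plus_tensor :: "'a \<otimes> 'b \<Rightarrow> 'a \<otimes> 'b \<Rightarrow> 'a \<otimes> 'b" is "(+)"
proof -
  fix x y u v :: "('a \<times> 'b) \<Rightarrow>\<^sub>0 complex"
  assume "tensor_equiv x y" "tensor_equiv u v"
  then have "(x - y) + (u - v) \<in> cspan tensor_relations"
    unfolding tensor_equiv_def by (rule complex_vector.span_add)
  then show "tensor_equiv (x + u) (y + v)" by (simp add: tensor_equiv_def algebra_simps)
qed

lift_definition minus_tensor :: "'a \<otimes> 'b \<Rightarrow> 'a \<otimes> 'b \<Rightarrow> 'a \<otimes> 'b" is "(-)"
proof -
  fix x y u v :: "('a \<times> 'b) \<Rightarrow>\<^sub>0 complex"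
  assume "tensor_equiv x y" "tensor_equiv u v"
  then have "(x - y) - (u - v) \<in> cspan tensor_relations"
    unfolding tensor_equiv_def by (rule complex_vector.span_diff)
  then show "tensor_equiv (x - u) (y - v)" by (simp add: tensor_equiv_def algebra_simps)
qed

lift_definition uminus_tensor :: "'a \<otimes> 'b \<Rightarrow> 'a \<otimes> 'b" is uminus
proof -
  fix x y :: "('a \<times> 'b) \<Rightarrow>\<^sub>0 complex"
  assume "tensor_equiv x y"
  then have "- (x - y) \<in> cspan tensor_relations"
    unfolding tensor_equiv_def by (rule complex_vector.span_neg)
  then show "tensor_equiv (- x) (- y)" by (simp add: tensor_equiv_def)
qed

lift_definition scaleC_tensor :: "complex \<Rightarrow> 'a \<otimes> 'b \<Rightarrow> 'a \<otimes> 'b" is scaleC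
proof -
  fix c :: complex and x y :: "('a \<times> 'b) \<Rightarrow>\<^sub>0 complex"
  assume "tensor_equiv x y"
  then have "c *\<^sub>C (x - y) \<in> cspan tensor_relations"
    unfolding tensor_equiv_def by (rule complex_vector.span_scale)
  then show "tensor_equiv (c *\<^sub>C x) (c *\<^sub>C y)"
    by (simp add: tensor_equiv_def complex_vector.scale_right_diff_distrib)
qed

instance
  by standard
    (transfer; simp add: equivp_reflp[OF equivp_tensor_equiv] algebra_simps scaleC_add_right scaleC_add_left
       scaleC_scaleC scaleC_one)+

end

lemma tensor_equiv_base: "x - y \<in> tensor_relations \<Longrightarrow> tensor_equiv x y"
  unfolding tensor_equiv_def by (rule complex_vector.span_base)

lemma tensor_add_left: "(a + a') \<otimes> b = a \<otimes> b + a' \<otimes> b"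
  by transfer (rule tensor_equiv_base, rule tensor_relations.add_left)

lemma tensor_add_right: "a \<otimes> (b + b') = a \<otimes> b + a \<otimes> b'"
  by transfer (rule tensor_equiv_base, rule tensor_relations.add_right)

lemma tensor_scale_left: "(c *\<^sub>C a) \<otimes> b = c *\<^sub>C (a \<otimes> b)"
  by transfer (rule tensor_equiv_base, rule tensor_relations.scale_left)

lemma tensor_scale_right: "a \<otimes> (c *\<^sub>C b) = c *\<^sub>C (a \<otimes> b)"
  by transfer (rule tensor_equiv_base, rule tensor_relations.scale_right)

lemma cbilinear_pure_tensor: "cbilinear (\<otimes>)"
  by (intro cbilinearI clinearI) (simp_all add: tensor_add_left tensor_add_right tensor_scale_left tensor_scale_right)

lemma tensor_induct [case_names pure add]:
  fixes x :: "'a::complex_vector \<otimes> 'b::complex_vector"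
  assumes pure: "\<And>c a b. P (c *\<^sub>C (a \<otimes> b))" and add: "\<And>x y. P x \<Longrightarrow> P y \<Longrightarrow> P (x + y)"
  shows "P x"
proof -
  have *: "P (abs_tensor f)" if "finite K" "Poly_Mapping.keys f \<subseteq> K" for K and f :: "('a \<times> 'b) \<Rightarrow>\<^sub>0 complex"
    using that
  proof (induction K arbitrary: f rule: finite_induct)
    case empty
    then have "f = 0" by simp
    with pure[of 0 0 0] show ?case by (simp add: zero_tensor_def)
  next
    case (insert k F)
    obtain a b where k: "k = (a, b)" by fastforce
    define g where "g = f - Poly_Mapping.single k (Poly_Mapping.lookup f k)"
    have look: "Poly_Mapping.lookup g i = (if i = k then 0 else Poly_Mapping.lookup f i)" for i
      by (simp add: g_def lookup_minus lookup_single when_def)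
    have "Poly_Mapping.keys g \<subseteq> F"
    proof
      fix i assume "i \<in> Poly_Mapping.keys g"
      then have "Poly_Mapping.lookup g i \<noteq> 0" by (simp add: in_keys_iff)
      then have "i \<noteq> k" "i \<in> Poly_Mapping.keys f" by (auto simp: look in_keys_iff split: if_splits)
      with insert.prems show "i \<in> F" by auto
    qed
    then have Pg: "P (abs_tensor g)" by (rule insert.IH)
    have "Poly_Mapping.single k (Poly_Mapping.lookup f k) = Poly_Mapping.lookup f k *\<^sub>C Poly_Mapping.single (a, b) 1"
      unfolding k by (rule poly_mapping_eqI)
        (simp add: scaleC_poly_mapping.rep_eq lookup_single when_def scaleC_complex_def)
    then have "abs_tensor (Poly_Mapping.single k (Poly_Mapping.lookup f k)) = Poly_Mapping.lookup f k *\<^sub>C (a \<otimes> b)"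
      by (simp add: scaleC_tensor.abs_eq pure_tensor.abs_eq)
    then have "P (abs_tensor (Poly_Mapping.single k (Poly_Mapping.lookup f k)))" using pure by simp
    from add[OF this Pg] show ?case by (simp add: plus_tensor.abs_eq g_def)
  qed
  show ?thesis by (induction x rule: tensor.abs_induct) (rule *[OF finite_keys order_refl])
qed

lemma clinear_tensor_eqI:
  assumes "clinear F" "clinear G" "\<And>a b. F (a \<otimes> b) = G (a \<otimes> b)"
  shows "F x = G x"
  by (induction x rule: tensor_induct) (simp_all add: assms clinear_add clinear_scale)

text \<open>The linear map \<open>A \<otimes> B \<rightarrow> C\<close> induced by a bilinear map \<open>A \<times> B \<rightarrow> C\<close>.\<close>

definition tlift :: "('a::complex_vector \<Rightarrow> 'b::complex_vector \<Rightarrow> 'c::complex_vector) \<Rightarrow> 'a \<otimes> 'b \<Rightarrow> 'c" where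
  "tlift B = (THE F. clinear F \<and> (\<forall>a b. F (a \<otimes> b) = B a b))"

lemma tensor_universal:
  fixes B :: "'a::complex_vector \<Rightarrow> 'b::complex_vector \<Rightarrow> 'c::complex_vector"
  assumes B: "cbilinear B"
  shows "\<exists>!F. clinear F \<and> (\<forall>a b. F (a \<otimes> b) = B a b)"
proof -
  define F0 :: "('a \<times> 'b \<Rightarrow>\<^sub>0 complex) \<Rightarrow> 'c"
    where "F0 f = (\<Sum>k\<in>Poly_Mapping.keys f. Poly_Mapping.lookup f k *\<^sub>C B (fst k) (snd k))" for f
  have F0_sup: "F0 f = (\<Sum>k\<in>K. Poly_Mapping.lookup f k *\<^sub>C B (fst k) (snd k))" if "finite K" "Poly_Mapping.keys f \<subseteq> K" for f K
    unfolding F0_def using that by (intro sum.mono_neutral_left) (auto simp: not_in_keys_iff_lookup_eq_zero)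
  have F0_add: "F0 (f + g) = F0 f + F0 g" for f g
    using F0_sup[of "Poly_Mapping.keys f \<union> Poly_Mapping.keys g" "f + g"] F0_sup[of "Poly_Mapping.keys f \<union> Poly_Mapping.keys g" f] F0_sup[of "Poly_Mapping.keys f \<union> Poly_Mapping.keys g" g]
      keys_add[of f g]
    by (simp add: lookup_add scaleC_add_left sum.distrib)
  have look: "Poly_Mapping.lookup (c *\<^sub>C f) k = c * Poly_Mapping.lookup f k" for c k and f :: "'a \<times> 'b \<Rightarrow>\<^sub>0 complex"
    by transfer (simp add: scaleC_complex_def)
  have F0_scale: "F0 (c *\<^sub>C f) = c *\<^sub>C F0 f" for c f
  proof -
    have "Poly_Mapping.keys (c *\<^sub>C f) \<subseteq> Poly_Mapping.keys f" by (auto simp: look simp flip: lookup_not_eq_zero_eq_in_keys)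
    then show ?thesis
      using F0_sup[of "Poly_Mapping.keys f" "c *\<^sub>C f"]
      by (simp add: F0_def look scaleC_scaleC complex_vector.scale_sum_right)
  qed
  have linF0: "clinear F0" by (rule clinearI) (rule F0_add, rule F0_scale)
  have F0_single: "F0 (Poly_Mapping.single (a, b) 1) = B a b" for a b
    by (simp add: F0_def scaleC_one)
  have Bl: "clinear (B a)" and Br: "clinear (\<lambda>a. B a b)" for a b
    using B by (auto simp: cbilinear_def)
  have rel: "F0 r = 0" if "r \<in> cspan tensor_relations" for r
    using that
  proof (induction rule: complex_vector.span_induct)
    case base
    then show ?case
      using linF0 by (intro complex_vector.subspaceI)
        (auto simp: clinear_0 clinear_add clinear_scale)
  next
    case (step r)
    then show ?case
      by (auto elim!: tensor_relations.cases simp: clinear_diff[OF linF0] F0_add F0_scale F0_single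
          clinear_add[OF Bl] clinear_add[OF Br] clinear_scale[OF Bl] clinear_scale[OF Br])
  qed
  define F where "F x = F0 (rep_tensor x)" for x
  have F_abs: "F (abs_tensor f) = F0 f" for f
  proof -
    have "tensor_equiv (rep_tensor (abs_tensor f)) f"
      by (rule Quotient3_rep_abs[OF Quotient3_tensor]) (rule equivp_reflp[OF equivp_tensor_equiv])
    then have "F0 (rep_tensor (abs_tensor f) - f) = 0"
      by (intro rel) (simp add: tensor_equiv_def)
    then show ?thesis by (simp add: F_def clinear_diff[OF linF0])
  qed
  have "clinear F"
  proof (rule clinearI)
    show "F (x + y) = F x + F y" for x y
      by (induction x rule: tensor.abs_induct, induction y rule: tensor.abs_induct)
        (simp add: plus_tensor.abs_eq F_abs F0_add)
    show "F (c *\<^sub>C x) = c *\<^sub>C F x" for c x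
      by (induction x rule: tensor.abs_induct) (simp add: scaleC_tensor.abs_eq F_abs F0_scale)
  qed
  moreover have "F (a \<otimes> b) = B a b" for a b
    by (simp add: pure_tensor.abs_eq F_abs F0_single)
  ultimately have F: "clinear F \<and> (\<forall>a b. F (a \<otimes> b) = B a b)" by simp
  show ?thesis
  proof (rule ex1I[of _ F])
    fix G assume G: "clinear G \<and> (\<forall>a b. G (a \<otimes> b) = B a b)"
    have "G x = F x" for x
      by (rule clinear_tensor_eqI) (use F G in simp_all)
    then show "G = F" by (rule ext)
  qed (rule F)
qed

lemma tlift:
  assumes "cbilinear B"
  shows clinear_tlift: "clinear (tlift B)" and tlift_pure: "tlift B (a \<otimes> b) = B a b"
  using theI'[OF tensor_universal[OF assms]] by (auto simp: tlift_def)

definition tmap :: "('a::complex_vector \<Rightarrow> 'c::complex_vector) \<Rightarrow> ('b::complex_vector \<Rightarrow> 'd::complex_vector) \<Rightarrow>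
    'a \<otimes> 'b \<Rightarrow> 'c \<otimes> 'd" where
  "tmap f g = tlift (\<lambda>a b. f a \<otimes> g b)"

lemma cbilinear_tmap: "clinear f \<Longrightarrow> clinear g \<Longrightarrow> cbilinear (\<lambda>a b. f a \<otimes> g b)"
  by (intro cbilinearI clinearI)
    (simp_all add: clinear_add clinear_scale tensor_add_left tensor_add_right tensor_scale_left tensor_scale_right)

lemma
  assumes "clinear f" "clinear g"
  shows clinear_tmap: "clinear (tmap f g)" and tmap_pure: "tmap f g (a \<otimes> b) = f a \<otimes> g b"
  unfolding tmap_def using tlift[OF cbilinear_tmap[OF assms]] by auto

text \<open>For subspaces \<open>V\<close> and \<open>W\<close>, the space \<open>V \<otimes> W\<close> as a subspace of the tensor product of the
  ambient spaces (over a field, the canonical map from the tensor product of subspaces is injective).\<close>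

definition tensor_subspace :: "'a::complex_vector set \<Rightarrow> 'b::complex_vector set \<Rightarrow> ('a \<otimes> 'b) set" where
  "tensor_subspace V W = cspan {v \<otimes> w | v w. v \<in> V \<and> w \<in> W}"

text \<open>\<open>\<otimes>\<close> on types associates to the left, so triple tensor products are \<open>(A \<otimes> B) \<otimes> C\<close>;
  \<open>tassoc\<close> is the canonical map from \<open>A \<otimes> (B \<otimes> C)\<close> and \<open>tswap23\<close> exchanges the last two legs.\<close>

definition tassoc :: "'a::complex_vector \<otimes> ('b::complex_vector \<otimes> 'c::complex_vector) \<Rightarrow> 'a \<otimes> 'b \<otimes> 'c" where
  "tassoc = tlift (\<lambda>a. tlift (\<lambda>b c. a \<otimes> b \<otimes> c))"

definition tswap23 :: "'a::complex_vector \<otimes> 'b::complex_vector \<otimes> 'c::complex_vector \<Rightarrow> 'a \<otimes> 'c \<otimes> 'b" where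
  "tswap23 = tlift (\<lambda>x c. tlift (\<lambda>a b. a \<otimes> c \<otimes> b) x)"

lemma clinear_plus: "clinear f \<Longrightarrow> clinear g \<Longrightarrow> clinear (\<lambda>x. f x + g x)"
  by (rule clinearI) (simp_all add: clinear_add clinear_scale scaleC_add_right)

lemma clinear_scaleC: "clinear f \<Longrightarrow> clinear (\<lambda>x. c *\<^sub>C f x)"
  by (rule clinearI) (simp_all add: clinear_add clinear_scale scaleC_add_right scaleC_scaleC mult.commute)

lemma clinear_tlift_param:
  assumes B: "\<And>z. cbilinear (B z)" and lin: "\<And>a b. clinear (\<lambda>z. B z a b)"
  shows "clinear (\<lambda>z. tlift (B z) x)"
proof (rule clinearI)
  show "tlift (B (y + z)) x = tlift (B y) x + tlift (B z) x" for y z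
    by (rule clinear_tensor_eqI[where G = "\<lambda>x. tlift (B y) x + tlift (B z) x"])
      (rule clinear_tlift[OF B], intro clinear_plus clinear_tlift B, simp only: tlift_pure[OF B], rule clinear_add[OF lin])
  show "tlift (B (c *\<^sub>C z)) x = c *\<^sub>C tlift (B z) x" for c z
    by (rule clinear_tensor_eqI[where G = "\<lambda>x. c *\<^sub>C tlift (B z) x"])
      (rule clinear_tlift[OF B], intro clinear_scaleC clinear_tlift B, simp only: tlift_pure[OF B], rule clinear_scale[OF lin])
qed

lemmas tensor_bilin = tensor_add_left tensor_add_right tensor_scale_left tensor_scale_right

lemma
  shows clinear_tassoc: "clinear (tassoc :: 'a::complex_vector \<otimes> ('b::complex_vector \<otimes> 'c::complex_vector) \<Rightarrow> _)"
    and tassoc_pure: "tassoc (a \<otimes> (b \<otimes> c)) = a \<otimes> b \<otimes> c"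
proof -
  have 1: "cbilinear (\<lambda>(b::'y::complex_vector) (c::'z::complex_vector). (a::'x::complex_vector) \<otimes> b \<otimes> c)" for a
    by (intro cbilinearI clinearI) (simp_all add: tensor_bilin)
  have 2: "cbilinear (\<lambda>a::'x::complex_vector. tlift (\<lambda>(b::'y::complex_vector) (c::'z::complex_vector). a \<otimes> b \<otimes> c))"
    by (intro cbilinearI clinear_tlift clinear_tlift_param 1) (auto intro!: clinearI simp: tensor_bilin)
  show "clinear (tassoc :: 'a \<otimes> ('b \<otimes> 'c) \<Rightarrow> _)" "tassoc (a \<otimes> (b \<otimes> c)) = a \<otimes> b \<otimes> c"
    unfolding tassoc_def by (simp_all add: clinear_tlift tlift_pure 2 1)
qed

lemma cbilinear_tswap23:
  "cbilinear (\<lambda>(x::'a::complex_vector \<otimes> 'b::complex_vector) (c::'c::complex_vector). tlift (\<lambda>a b. a \<otimes> c \<otimes> b) x)"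
  "cbilinear (\<lambda>(a::'a) (b::'b). a \<otimes> (c::'c) \<otimes> b)"
proof -
  show 1: "cbilinear (\<lambda>(a::'a) (b::'b). a \<otimes> (c::'c) \<otimes> b)" for c
    by (intro cbilinearI clinearI) (simp_all add: tensor_bilin)
  show "cbilinear (\<lambda>(x::'a \<otimes> 'b) (c::'c). tlift (\<lambda>a b. a \<otimes> c \<otimes> b) x)"
    by (intro cbilinearI clinear_tlift clinear_tlift_param 1) (auto intro!: clinearI simp: tensor_bilin)
qed

lemma clinear_tswap23: "clinear tswap23"
  and tswap23_pure: "tswap23 (a \<otimes> b \<otimes> c) = a \<otimes> c \<otimes> b"
  unfolding tswap23_def by (simp_all add: clinear_tlift tlift_pure cbilinear_tswap23)

instantiation tensor :: (complex_algebra, complex_algebra) complex_algebra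
begin

definition times_tensor :: "'a \<otimes> 'b \<Rightarrow> 'a \<otimes> 'b \<Rightarrow> 'a \<otimes> 'b" where
  "x * y = tlift (\<lambda>a b. tlift (\<lambda>c d. (a * c) \<otimes> (b * d)) y) x"

lemma cbilinear_times_tensor:
  "cbilinear (\<lambda>(c::'a) (d::'b). (a * c) \<otimes> (b * d))"
  "cbilinear (\<lambda>(a::'a) (b::'b). tlift (\<lambda>c d. (a * c) \<otimes> (b * d)) y)"
proof -
  show 1: "cbilinear (\<lambda>(c::'a) (d::'b). (a * c) \<otimes> (b * d))" for a b
    by (intro cbilinearI clinearI) (simp_all add: tensor_bilin distrib_left mult_scaleC_right)
  show "cbilinear (\<lambda>(a::'a) (b::'b). tlift (\<lambda>c d. (a * c) \<otimes> (b * d)) y)"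
    by (intro cbilinearI clinear_tlift_param 1; rule clinearI)
      (simp_all add: tensor_bilin distrib_right mult_scaleC_left)
qed

lemma clinear_times_tensor: "clinear (\<lambda>x :: 'a \<otimes> 'b. x * y)" "clinear (\<lambda>y. x * y :: 'a \<otimes> 'b)"
proof -
  show "clinear (\<lambda>x :: 'a \<otimes> 'b. x * y)"
    unfolding times_tensor_def by (intro clinear_tlift cbilinear_times_tensor)
  show "clinear (\<lambda>y. x * y :: 'a \<otimes> 'b)"
    unfolding times_tensor_def
    by (intro clinear_tlift_param clinear_tlift cbilinear_times_tensor)
qed

lemma times_pure: "(a \<otimes> b) * (c \<otimes> d :: 'a \<otimes> 'b) = (a * c) \<otimes> (b * d)"
  unfolding times_tensor_def
  by (subst tlift_pure, rule cbilinear_times_tensor, rule tlift_pure, rule cbilinear_times_tensor)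

instance
proof
  fix x y z :: "'a \<otimes> 'b" and c :: complex
  note [simp] = clinear_add[OF clinear_times_tensor(1)] clinear_add[OF clinear_times_tensor(2)]
    clinear_scale[OF clinear_times_tensor(1)] clinear_scale[OF clinear_times_tensor(2)]
  show "(x + y) * z = x * z + y * z" "x * (y + z) = x * y + x * z"
    "(c *\<^sub>C x) * y = c *\<^sub>C (x * y)" "x * (c *\<^sub>C y) = c *\<^sub>C (x * y)"
    by simp_all
  have 1: "(a1 \<otimes> b1) * (a2 \<otimes> b2) * z = (a1 \<otimes> b1) * ((a2 \<otimes> b2) * z)" for a1 a2 :: 'a and b1 b2 :: 'b
    by (induction z rule: tensor_induct) (simp_all only: clinear_scale[OF clinear_times_tensor(2)]
        clinear_add[OF clinear_times_tensor(2)] times_pure mult.assoc)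
  have 2: "(a1 \<otimes> b1) * y * z = (a1 \<otimes> b1) * (y * z)" for a1 :: 'a and b1 :: 'b
    by (induction y rule: tensor_induct) (use 1 in simp_all)
  show "x * y * z = x * (y * z)"
    by (induction x rule: tensor_induct) (use 2 in simp_all)
qed

end

section \<open>Multipliers\<close>

text \<open>The multiplier algebra \<open>M(A)\<close>: pairs of left and right multiplication maps (double centralizers).\<close>

typedef (overloaded) 'a multiplier =
  "{(L :: 'a::complex_algebra \<Rightarrow> 'a, R :: 'a \<Rightarrow> 'a). clinear L \<and> clinear R \<and>
     (\<forall>a b. L (a * b) = L a * b) \<and> (\<forall>a b. R (a * b) = a * R b) \<and> (\<forall>a b. a * L b = R a * b)}"
  morphisms rep_multiplier abs_multiplier
  by (rule exI[of _ "(\<lambda>x. x, \<lambda>x. x)"]) (simp add: clinear_id)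

definition lact :: "'a::complex_algebra multiplier \<Rightarrow> 'a \<Rightarrow> 'a"  (infixr "\<rhd>" 69) where
  "m \<rhd> a = fst (rep_multiplier m) a"

definition ract :: "'a::complex_algebra \<Rightarrow> 'a multiplier \<Rightarrow> 'a"  (infixl "\<lhd>" 69) where
  "a \<lhd> m = snd (rep_multiplier m) a"

lemma lact_ract:
  shows clinear_lact: "clinear ((\<rhd>) m)" and clinear_ract: "clinear (\<lambda>a. a \<lhd> m)"
    and lact_mult: "m \<rhd> (a * b) = (m \<rhd> a) * b" and ract_mult: "(a * b) \<lhd> m = a * (b \<lhd> m)"
    and mult_lact: "a * (m \<rhd> b) = (a \<lhd> m) * b"
  using rep_multiplier[of m] by (auto simp: lact_def[abs_def] ract_def[abs_def] case_prod_beta)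

lemma multiplier_eqI:
  "(\<And>a. m \<rhd> a = n \<rhd> a) \<Longrightarrow> (\<And>a. a \<lhd> m = a \<lhd> n) \<Longrightarrow> m = n"
  by (metis lact_def ract_def ext prod_eqI rep_multiplier_inject)

lemma act_abs_multiplier:
  assumes "clinear L" "clinear R" "\<And>a b. L (a * b) = L a * b" "\<And>a b. R (a * b) = a * R b"
    "\<And>a b. a * L b = R a * b"
  shows "abs_multiplier (L, R) \<rhd> a = L a" "a \<lhd> abs_multiplier (L, R) = R a"
  using assms by (simp_all add: lact_def ract_def abs_multiplier_inverse)

instantiation multiplier :: (complex_algebra) "{complex_algebra, monoid_mult}"
begin

definition "0 = abs_multiplier (\<lambda>a :: 'a. 0, \<lambda>a. 0)"
definition "1 = abs_multiplier (\<lambda>a :: 'a. a, \<lambda>a. a)"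
definition "m + n = abs_multiplier (\<lambda>a :: 'a. (m \<rhd> a) + (n \<rhd> a), \<lambda>a. (a \<lhd> m) + (a \<lhd> n))"
definition "- m = abs_multiplier (\<lambda>a :: 'a. - (m \<rhd> a), \<lambda>a. - (a \<lhd> m))"
definition "m - n = abs_multiplier (\<lambda>a :: 'a. (m \<rhd> a) - (n \<rhd> a), \<lambda>a. (a \<lhd> m) - (a \<lhd> n))"
definition "c *\<^sub>C m = abs_multiplier (\<lambda>a :: 'a. c *\<^sub>C (m \<rhd> a), \<lambda>a. c *\<^sub>C (a \<lhd> m))"
definition "m * n = abs_multiplier (\<lambda>a :: 'a. m \<rhd> (n \<rhd> a), \<lambda>a. (a \<lhd> m) \<lhd> n)"

lemma multiplier_act:
  fixes m n :: "'a multiplier"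
  shows "0 \<rhd> a = (0 :: 'a)" "a \<lhd> 0 = (0 :: 'a)" "1 \<rhd> a = (a :: 'a)" "a \<lhd> 1 = (a :: 'a)"
    "(m + n) \<rhd> a = (m \<rhd> a) + (n \<rhd> a)" "a \<lhd> (m + n) = (a \<lhd> m) + (a \<lhd> n)"
    "(- m) \<rhd> a = - (m \<rhd> a)" "a \<lhd> (- m) = - (a \<lhd> m)"
    "(m - n) \<rhd> a = (m \<rhd> a) - (n \<rhd> a)" "a \<lhd> (m - n) = (a \<lhd> m) - (a \<lhd> n)"
    "(c *\<^sub>C m) \<rhd> a = c *\<^sub>C (m \<rhd> a)" "a \<lhd> (c *\<^sub>C m) = c *\<^sub>C (a \<lhd> m)"
    "(m * n) \<rhd> a = m \<rhd> (n \<rhd> a)" "a \<lhd> (m * n) = (a \<lhd> m) \<lhd> n"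
proof -
  note lin = clinear_add[OF clinear_lact] clinear_add[OF clinear_ract]
    clinear_scale[OF clinear_lact] clinear_scale[OF clinear_ract]
  note simps = lin clinearI lact_mult ract_mult mult_lact scaleC_add_right scaleC_scaleC
    distrib_left distrib_right left_diff_distrib right_diff_distrib mult_scaleC_left mult_scaleC_right
    complex_vector.scale_right_diff_distrib complex_vector.scale_minus_right mult.commute[of _ c]
  show "0 \<rhd> a = (0 :: 'a)" "a \<lhd> 0 = (0 :: 'a)" "1 \<rhd> a = (a :: 'a)" "a \<lhd> 1 = (a :: 'a)"
    "(m + n) \<rhd> a = (m \<rhd> a) + (n \<rhd> a)" "a \<lhd> (m + n) = (a \<lhd> m) + (a \<lhd> n)"
    "(- m) \<rhd> a = - (m \<rhd> a)" "a \<lhd> (- m) = - (a \<lhd> m)"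
    "(m - n) \<rhd> a = (m \<rhd> a) - (n \<rhd> a)" "a \<lhd> (m - n) = (a \<lhd> m) - (a \<lhd> n)"
    "(m * n) \<rhd> a = m \<rhd> (n \<rhd> a)" "a \<lhd> (m * n) = (a \<lhd> m) \<lhd> n"
    unfolding zero_multiplier_def one_multiplier_def plus_multiplier_def uminus_multiplier_def
      minus_multiplier_def times_multiplier_def
    by (subst act_abs_multiplier, auto intro!: clinearI simp: simps)+
  have "clinear (\<lambda>a. c *\<^sub>C (m \<rhd> a))" "clinear (\<lambda>a. c *\<^sub>C (a \<lhd> m))"
    by (intro clinear_scaleC clinear_lact clinear_ract)+
  then show "(c *\<^sub>C m) \<rhd> a = c *\<^sub>C (m \<rhd> a)" "a \<lhd> (c *\<^sub>C m) = c *\<^sub>C (a \<lhd> m)"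
    unfolding scaleC_multiplier_def
    by (subst act_abs_multiplier, auto simp: lact_mult ract_mult mult_lact mult_scaleC_left mult_scaleC_right)+
qed

instance
  by standard
    (auto intro!: multiplier_eqI simp: multiplier_act scaleC_add_right scaleC_add_left scaleC_scaleC scaleC_one
      clinear_add[OF clinear_lact] clinear_add[OF clinear_ract]
      clinear_scale[OF clinear_lact] clinear_scale[OF clinear_ract])

end

definition mult_of :: "'a::complex_algebra \<Rightarrow> 'a multiplier"  ("\<iota>") where
  "\<iota> a = abs_multiplier (\<lambda>x. a * x, \<lambda>x. x * a)"

lemma mult_of_act: "\<iota> a \<rhd> x = a * x" "x \<lhd> \<iota> a = x * a"
  unfolding mult_of_def
  by (subst act_abs_multiplier, auto intro!: clinearI simp: distrib_left distrib_right mult_scaleC_left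
      mult_scaleC_right mult.assoc)+

text \<open>The canonical embedding \<open>M(A) \<otimes> M(B) \<rightarrow> M(A \<otimes> B)\<close> on pure tensors.\<close>

definition mtensor :: "'a::complex_algebra multiplier \<Rightarrow> 'b::complex_algebra multiplier \<Rightarrow> ('a \<otimes> 'b) multiplier"
    (infixl "\<otimes>\<^sub>M" 68) where
  "m \<otimes>\<^sub>M n = abs_multiplier (tmap ((\<rhd>) m) ((\<rhd>) n), tmap (\<lambda>a. a \<lhd> m) (\<lambda>b. b \<lhd> n))"

lemma mtensor_act:
  "(m \<otimes>\<^sub>M n) \<rhd> x = tmap ((\<rhd>) m) ((\<rhd>) n) x"
  "x \<lhd> (m \<otimes>\<^sub>M n) = tmap (\<lambda>a. a \<lhd> m) (\<lambda>b. b \<lhd> n) x"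
proof -
  let ?L = "tmap ((\<rhd>) m) ((\<rhd>) n)" and ?R = "tmap (\<lambda>a. a \<lhd> m) (\<lambda>b. b \<lhd> n)"
  have L: "clinear ?L" and R: "clinear ?R"
    by (intro clinear_tmap clinear_lact clinear_ract)+
  note [simp] = tmap_pure[OF clinear_lact clinear_lact] tmap_pure[OF clinear_ract clinear_ract]
    clinear_add[OF L] clinear_add[OF R] clinear_scale[OF L] clinear_scale[OF R]
    mult_scaleC_left mult_scaleC_right distrib_left distrib_right
    times_pure lact_mult ract_mult mult_lact
  have 1: "?L ((a \<otimes> b) * y) = ?L (a \<otimes> b) * y" "?R (y * (a \<otimes> b)) = y * ?R (a \<otimes> b)"
    "(a \<otimes> b) * ?L y = ?R (a \<otimes> b) * y" for a b y
    by (induction y rule: tensor_induct) simp_all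
  have "?L (x * y) = ?L x * y" "?R (y * x) = y * ?R x" "x * ?L y = ?R x * y" for x y
    by (induction x rule: tensor_induct) (use 1 in simp_all)
  then show "(m \<otimes>\<^sub>M n) \<rhd> x = ?L x" "x \<lhd> (m \<otimes>\<^sub>M n) = ?R x"
    unfolding mtensor_def by (simp_all add: act_abs_multiplier L R)
qed

text \<open>Transport of multipliers along an algebra isomorphism.\<close>

definition mtransport :: "('a::complex_algebra \<Rightarrow> 'b::complex_algebra) \<Rightarrow> 'a multiplier \<Rightarrow> 'b multiplier" where
  "mtransport f m = abs_multiplier (\<lambda>x. f (m \<rhd> inv f x), \<lambda>x. f (inv f x \<lhd> m))"

lemma mtransport_act:
  assumes "clinear f" "bij f" "\<And>x y. f (x * y) = f x * f y"
  shows "mtransport f m \<rhd> f x = f (m \<rhd> x)" "f x \<lhd> mtransport f m = f (x \<lhd> m)"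
proof -
  have i: "f (inv f x) = x" "inv f (f y) = y" for x y
    using assms(2) by (simp_all add: bij_is_surj surj_f_inv_f bij_is_inj)
  have im: "inv f (x * y) = inv f x * inv f y" for x y
  proof -
    have "inv f (x * y) = inv f (f (inv f x * inv f y))" by (simp only: assms(3) i(1))
    then show ?thesis by (simp only: i(2))
  qed
  have il: "clinear (inv f)"
  proof (rule clinearI)
    fix x y c
    have "inv f (x + y) = inv f (f (inv f x + inv f y))" by (simp only: clinear_add[OF assms(1)] i(1))
    then show "inv f (x + y) = inv f x + inv f y" by (simp only: i(2))
    have "inv f (c *\<^sub>C x) = inv f (f (c *\<^sub>C inv f x))" by (simp only: clinear_scale[OF assms(1)] i(1))
    then show "inv f (c *\<^sub>C x) = c *\<^sub>C inv f x" by (simp only: i(2))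
  qed
  have L: "clinear (\<lambda>x. f (m \<rhd> inv f x))"
    by (intro clinear_compose[OF clinear_compose[OF il clinear_lact] assms(1)])
  have R: "clinear (\<lambda>x. f (inv f x \<lhd> m))"
    by (intro clinear_compose[OF clinear_compose[OF il clinear_ract] assms(1)])
  have 1: "f (m \<rhd> inv f (a * b)) = f (m \<rhd> inv f a) * b" for a b
    by (simp only: im lact_mult assms(3) i)
  have 2: "f (inv f (a * b) \<lhd> m) = a * f (inv f b \<lhd> m)" for a b
    by (simp only: im ract_mult assms(3) i)
  have 3: "a * f (m \<rhd> inv f b) = f (inv f a \<lhd> m) * b" for a b
  proof -
    have "a * f (m \<rhd> inv f b) = f (inv f a * (m \<rhd> inv f b))" by (simp only: assms(3) i)
    also have "\<dots> = f ((inv f a \<lhd> m) * inv f b)" by (simp only: mult_lact)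
    also have "\<dots> = f (inv f a \<lhd> m) * b" by (simp only: assms(3) i)
    finally show ?thesis .
  qed
  have "mtransport f m \<rhd> x = f (m \<rhd> inv f x)" "x \<lhd> mtransport f m = f (inv f x \<lhd> m)" for x
    unfolding mtransport_def by (rule act_abs_multiplier[OF L R 1 2 3])+
  then show "mtransport f m \<rhd> f x = f (m \<rhd> x)" "f x \<lhd> mtransport f m = f (x \<lhd> m)"
    by (simp_all only: i(2))
qed

lemma mtransport_tassoc:
  fixes m :: "('a::complex_algebra \<otimes> ('b::complex_algebra \<otimes> 'c::complex_algebra)) multiplier"
  shows "mtransport tassoc m \<rhd> tassoc x = tassoc (m \<rhd> x)" "tassoc x \<lhd> mtransport tassoc m = tassoc (x \<lhd> m)"
proof -
  define g :: "'a \<otimes> 'b \<otimes> 'c \<Rightarrow> 'a \<otimes> ('b \<otimes> 'c)"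
    where "g = tlift (\<lambda>x c. tlift (\<lambda>a b. a \<otimes> (b \<otimes> c)) x)"
  have 1: "cbilinear (\<lambda>(a::'a) (b::'b). a \<otimes> (b \<otimes> (c::'c)))" for c
    by (intro cbilinearI clinearI) (simp_all add: tensor_bilin)
  have 2: "cbilinear (\<lambda>(x::'a \<otimes> 'b) (c::'c). tlift (\<lambda>a b. a \<otimes> (b \<otimes> c)) x)"
    by (intro cbilinearI clinear_tlift clinear_tlift_param 1) (auto intro!: clinearI simp: tensor_bilin)
  have g_pure: "g (a \<otimes> b \<otimes> c) = a \<otimes> (b \<otimes> c)" for a b c
    unfolding g_def by (simp add: tlift_pure 1 2)
  have g_lin: "clinear g"
    unfolding g_def by (intro clinear_tlift 2)
  note [simp] = g_pure tassoc_pure clinear_add[OF g_lin] clinear_scale[OF g_lin] clinear_add[OF clinear_tassoc]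
    clinear_scale[OF clinear_tassoc] tensor_bilin times_pure mult_scaleC_left mult_scaleC_right
    distrib_left distrib_right
  have gt: "g (tassoc (a \<otimes> y)) = a \<otimes> y" for a :: 'a and y :: "'b \<otimes> 'c"
    by (induction y rule: tensor_induct) simp_all
  have "g (tassoc x) = x" for x
    by (induction x rule: tensor_induct) (simp_all add: gt)
  moreover have tg: "tassoc (g (y \<otimes> c)) = y \<otimes> c" for c :: 'c and y :: "'a \<otimes> 'b"
    by (induction y rule: tensor_induct) simp_all
  have "tassoc (g x) = x" for x
    by (induction x rule: tensor_induct) (simp_all add: tg)
  ultimately have "bij (tassoc :: 'a \<otimes> ('b \<otimes> 'c) \<Rightarrow> _)"
    by (metis bij_iff)
  moreover have m1: "tassoc ((a \<otimes> (b \<otimes> c)) * (a' \<otimes> y)) = tassoc (a \<otimes> (b \<otimes> c)) * tassoc (a' \<otimes> y)"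
    for a a' :: 'a and b :: 'b and c :: 'c and y
    by (induction y rule: tensor_induct) simp_all
  have m2: "tassoc ((a \<otimes> z) * (a' \<otimes> y)) = tassoc (a \<otimes> z) * tassoc (a' \<otimes> y)"
    for a a' :: 'a and z y :: "'b \<otimes> 'c"
    by (induction z rule: tensor_induct) (use m1 in simp_all)
  have m3: "tassoc ((a \<otimes> z) * y) = tassoc (a \<otimes> z) * tassoc y"
    for a :: 'a and z :: "'b \<otimes> 'c" and y
    by (induction y rule: tensor_induct) (use m2 in simp_all)
  have "tassoc (x * y) = tassoc x * tassoc y" for x y :: "'a \<otimes> ('b \<otimes> 'c)"
    by (induction x rule: tensor_induct) (use m3 in simp_all)
  ultimately show "mtransport tassoc m \<rhd> tassoc x = tassoc (m \<rhd> x)"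
    "tassoc x \<lhd> mtransport tassoc m = tassoc (x \<lhd> m)"
    by (simp_all add: mtransport_act clinear_tassoc)
qed

lemma tswap23_tswap23:
  fixes x :: "'a::complex_vector \<otimes> 'b::complex_vector \<otimes> 'c::complex_vector"
  shows "tswap23 (tswap23 x) = x"
proof -
  have "tswap23 (tswap23 (y \<otimes> c)) = y \<otimes> c" for y :: "'a \<otimes> 'b" and c :: 'c
    by (induction y rule: tensor_induct)
      (simp_all add: tswap23_pure tensor_bilin clinear_add[OF clinear_tswap23] clinear_scale[OF clinear_tswap23])
  then show ?thesis
    by (induction x rule: tensor_induct)
      (simp_all add: clinear_add[OF clinear_tswap23] clinear_scale[OF clinear_tswap23])
qed

lemma mtransport_tswap23:
  fixes m :: "('a::complex_algebra \<otimes> 'b::complex_algebra \<otimes> 'c::complex_algebra) multiplier"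
  shows "mtransport tswap23 m \<rhd> tswap23 x = tswap23 (m \<rhd> x)"
  "tswap23 x \<lhd> mtransport tswap23 m = tswap23 (x \<lhd> m)"
proof -
  note [simp] = tswap23_pure clinear_add[OF clinear_tswap23] clinear_scale[OF clinear_tswap23]
    tensor_bilin times_pure mult_scaleC_left mult_scaleC_right distrib_left distrib_right
  have "bij (tswap23 :: 'a \<otimes> 'b \<otimes> 'c \<Rightarrow> _)"
    by (metis bij_iff tswap23_tswap23)
  moreover have m1: "tswap23 ((a \<otimes> b \<otimes> c) * (y \<otimes> c')) = tswap23 (a \<otimes> b \<otimes> c) * tswap23 (y \<otimes> c')"
    for a :: 'a and b :: 'b and c c' :: 'c and y
    by (induction y rule: tensor_induct) simp_all
  have m2: "tswap23 ((z \<otimes> c) * (y \<otimes> c')) = tswap23 (z \<otimes> c) * tswap23 (y \<otimes> c')"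
    for z y :: "'a \<otimes> 'b" and c c' :: 'c
    by (induction z rule: tensor_induct) (use m1 in simp_all)
  have m3: "tswap23 ((z \<otimes> c) * y) = tswap23 (z \<otimes> c) * tswap23 y" for z :: "'a \<otimes> 'b" and c :: 'c and y
    by (induction y rule: tensor_induct) (use m2 in simp_all)
  have "tswap23 (x * y) = tswap23 x * tswap23 y" for x y :: "'a \<otimes> 'b \<otimes> 'c"
    by (induction x rule: tensor_induct) (use m3 in simp_all)
  ultimately show "mtransport tswap23 m \<rhd> tswap23 x = tswap23 (m \<rhd> x)"
    "tswap23 x \<lhd> mtransport tswap23 m = tswap23 (x \<lhd> m)"
    by (simp_all add: mtransport_act clinear_tswap23)
qed

text \<open>A family of multipliers converges strictly to \<open>m\<close> if, for every \<open>a\<close>, the partial sums of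
  \<open>f i \<rhd> a\<close> and \<open>a \<lhd> f i\<close> are eventually equal to \<open>m \<rhd> a\<close> and \<open>a \<lhd> m\<close>; thus only finitely
  many terms are nonzero.\<close>

definition has_strict_sum :: "('i \<Rightarrow> 'a::complex_algebra multiplier) \<Rightarrow> 'i set \<Rightarrow> 'a multiplier \<Rightarrow> bool" where
  "has_strict_sum f I m \<longleftrightarrow>
     (\<forall>a. finite {i \<in> I. f i \<rhd> a \<noteq> 0} \<and> finite {i \<in> I. a \<lhd> f i \<noteq> 0} \<and>
       m \<rhd> a = supp_sum (\<lambda>i. f i \<rhd> a) I \<and> a \<lhd> m = supp_sum (\<lambda>i. a \<lhd> f i) I)"

definition strict_sum :: "('i \<Rightarrow> 'a::complex_algebra multiplier) \<Rightarrow> 'i set \<Rightarrow> 'a multiplier" where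
  "strict_sum f I = (THE m. has_strict_sum f I m)"

text \<open>The three embeddings \<open>M(A \<otimes> A) \<rightarrow> M(A \<otimes> A \<otimes> A)\<close>.\<close>

definition leg12 :: "('a::complex_algebra \<otimes> 'a) multiplier \<Rightarrow> ('a \<otimes> 'a \<otimes> 'a) multiplier" where
  "leg12 m = m \<otimes>\<^sub>M 1"

definition leg23 :: "('a::complex_algebra \<otimes> 'a) multiplier \<Rightarrow> ('a \<otimes> 'a \<otimes> 'a) multiplier" where
  "leg23 m = mtransport tassoc (1 \<otimes>\<^sub>M m)"

definition leg13 :: "('a::complex_algebra \<otimes> 'a) multiplier \<Rightarrow> ('a \<otimes> 'a \<otimes> 'a) multiplier" where
  "leg13 m = mtransport tswap23 (m \<otimes>\<^sub>M 1)"

section \<open>Partial bialgebras and partial Hopf algebras\<close>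

definition internal_direct_sum :: "'j set \<Rightarrow> ('j \<Rightarrow> 'a::complex_vector set) \<Rightarrow> bool" where
  "internal_direct_sum J V \<longleftrightarrow>
     (\<forall>j\<in>J. csubspace (V j)) \<and> cspan (\<Union>j\<in>J. V j) = UNIV \<and>
     (\<forall>F v. finite F \<and> F \<subseteq> J \<and> (\<forall>j\<in>F. v j \<in> V j) \<and> (\<Sum>j\<in>F. v j) = 0 \<longrightarrow> (\<forall>j\<in>F. v j = 0))"

definition rcf :: "'i set \<Rightarrow> ('i \<Rightarrow> 'i \<Rightarrow> 'b::zero) \<Rightarrow> bool" where
  "rcf I x \<longleftrightarrow> (\<forall>r\<in>I. finite {s \<in> I. x r s \<noteq> 0}) \<and> (\<forall>s\<in>I. finite {r \<in> I. x r s \<noteq> 0})"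

text \<open>The type \<^typ>\<open>'a\<close> is the total algebra and \<open>A k l m n\<close> is the summand with upper indices
  \<open>k, l\<close> and lower indices \<open>m, n\<close>; every family of complex vector spaces arises, up to isomorphism,
  as the summands of its direct sum. A family of linear maps on the summands is the same as a linear map
  on \<^typ>\<open>'a\<close>, so the multiplications (with non-composable products \<open>0\<close>) are packaged in the product of
  \<^typ>\<open>'a\<close>, and the comultiplications \<open>\<Delta> r s\<close> and the counit \<open>\<epsilon>\<close> are linear on all of \<^typ>\<open>'a\<close>.\<close>

locale partial_bialgebra =
  fixes I :: "'i set"
    and A :: "'i \<Rightarrow> 'i \<Rightarrow> 'i \<Rightarrow> 'i \<Rightarrow> 'a::complex_algebra set"
    and u :: "'i \<Rightarrow> 'i \<Rightarrow> 'a"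
    and \<Delta> :: "'i \<Rightarrow> 'i \<Rightarrow> 'a \<Rightarrow> 'a \<otimes> 'a"
    and \<epsilon> :: "'a \<Rightarrow> complex"
  assumes direct_sum: "internal_direct_sum (I \<times> I \<times> I \<times> I) (\<lambda>(k, l, m, n). A k l m n)"
    and mult_closed: "\<lbrakk>k \<in> I; l \<in> I; m \<in> I; n \<in> I; p \<in> I; q \<in> I; a \<in> A k l m n; b \<in> A l p n q\<rbrakk>
      \<Longrightarrow> a * b \<in> A k p m q"
    and mult_noncomposable: "\<lbrakk>k \<in> I; l \<in> I; m \<in> I; n \<in> I; l' \<in> I; p \<in> I; n' \<in> I; q \<in> I;
        a \<in> A k l m n; b \<in> A l' p n' q; (l, n) \<noteq> (l', n')\<rbrakk> \<Longrightarrow> a * b = 0"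
    and unit_closed: "\<lbrakk>k \<in> I; m \<in> I\<rbrakk> \<Longrightarrow> u k m \<in> A k k m m"
    and unit_left: "\<lbrakk>k \<in> I; l \<in> I; m \<in> I; n \<in> I; a \<in> A k l m n\<rbrakk> \<Longrightarrow> u k m * a = a"
    and unit_right: "\<lbrakk>k \<in> I; l \<in> I; m \<in> I; n \<in> I; a \<in> A k l m n\<rbrakk> \<Longrightarrow> a * u l n = a"
    and comult_linear: "\<lbrakk>r \<in> I; s \<in> I\<rbrakk> \<Longrightarrow> clinear (\<Delta> r s)"
    and comult_closed: "\<lbrakk>k \<in> I; l \<in> I; m \<in> I; n \<in> I; r \<in> I; s \<in> I; a \<in> A k l m n\<rbrakk>
      \<Longrightarrow> \<Delta> r s a \<in> tensor_subspace (A k l r s) (A r s m n)"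
    and coassoc: "\<lbrakk>k \<in> I; l \<in> I; m \<in> I; n \<in> I; p \<in> I; q \<in> I; r \<in> I; s \<in> I; a \<in> A k l m n\<rbrakk>
      \<Longrightarrow> tmap (\<Delta> p q) (\<lambda>x. x) (\<Delta> r s a) = tassoc (tmap (\<lambda>x. x) (\<Delta> r s) (\<Delta> p q a))"
    and counit_linear: "clinear \<epsilon>"
    and counit_zero: "\<lbrakk>k \<in> I; l \<in> I; m \<in> I; n \<in> I; a \<in> A k l m n; (k, l) \<noteq> (m, n)\<rbrakk> \<Longrightarrow> \<epsilon> a = 0"
    and counit_left: "\<lbrakk>k \<in> I; l \<in> I; m \<in> I; n \<in> I; a \<in> A k l m n\<rbrakk>
      \<Longrightarrow> tlift (\<lambda>x y. \<epsilon> x *\<^sub>C y) (\<Delta> k l a) = a"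
    and counit_right: "\<lbrakk>k \<in> I; l \<in> I; m \<in> I; n \<in> I; a \<in> A k l m n\<rbrakk>
      \<Longrightarrow> tlift (\<lambda>x y. \<epsilon> y *\<^sub>C x) (\<Delta> m n a) = a"
    and comult_unit: "\<lbrakk>k \<in> I; m \<in> I; l \<in> I; l' \<in> I\<rbrakk>
      \<Longrightarrow> \<Delta> l l' (u k m) = (if l = l' then u k l \<otimes> u l m else 0)"
    and counit_mult: "\<lbrakk>k \<in> I; l \<in> I; m \<in> I; n \<in> I; p \<in> I; q \<in> I; a \<in> A k l m n; b \<in> A l p n q\<rbrakk>
      \<Longrightarrow> \<epsilon> (a * b) = \<epsilon> a * \<epsilon> b"
    and counit_unit: "k \<in> I \<Longrightarrow> \<epsilon> (u k k) = 1"
    and comult_rcf: "\<lbrakk>k \<in> I; l \<in> I; m \<in> I; n \<in> I; a \<in> A k l m n\<rbrakk> \<Longrightarrow> rcf I (\<lambda>r s. \<Delta> r s a)"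
    and comult_mult: "\<lbrakk>k \<in> I; l \<in> I; m \<in> I; n \<in> I; p \<in> I; q \<in> I; r \<in> I; s \<in> I;
        a \<in> A k l m n; b \<in> A l p n q\<rbrakk>
      \<Longrightarrow> \<Delta> r s (a * b) = supp_sum (\<lambda>t. \<Delta> r t a * \<Delta> t s b) I"

text \<open>As above, \<open>S\<close> is the linear map on the total algebra given by the family of maps on the summands,
  that is, the total antipode.\<close>

definition partial_antipode :: "'i set \<Rightarrow> ('i \<Rightarrow> 'i \<Rightarrow> 'i \<Rightarrow> 'i \<Rightarrow> 'a::complex_algebra set) \<Rightarrow> ('i \<Rightarrow> 'i \<Rightarrow> 'a) \<Rightarrow>
    ('i \<Rightarrow> 'i \<Rightarrow> 'a \<Rightarrow> 'a \<otimes> 'a) \<Rightarrow> ('a \<Rightarrow> complex) \<Rightarrow> ('a \<Rightarrow> 'a) \<Rightarrow> bool" where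
  "partial_antipode I A u \<Delta> \<epsilon> S \<longleftrightarrow>
     clinear S \<and>
     (\<forall>k\<in>I. \<forall>l\<in>I. \<forall>m\<in>I. \<forall>n\<in>I. S ` A k l m n \<subseteq> A n m l k) \<and>
     (\<forall>k\<in>I. \<forall>l\<in>I. \<forall>m\<in>I. \<forall>r\<in>I. \<forall>a\<in>A k l m l.
        supp_sum (\<lambda>s. tlift (\<lambda>x y. x * S y) (\<Delta> r s a)) I = (if k = m then \<epsilon> a *\<^sub>C u k r else 0)) \<and>
     (\<forall>k\<in>I. \<forall>l\<in>I. \<forall>n\<in>I. \<forall>s\<in>I. \<forall>a\<in>A k l k n.
        supp_sum (\<lambda>r. tlift (\<lambda>x y. S x * y) (\<Delta> r s a)) I = (if l = n then \<epsilon> a *\<^sub>C u s n else 0))"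

definition partial_hopf_algebra :: "'i set \<Rightarrow> ('i \<Rightarrow> 'i \<Rightarrow> 'i \<Rightarrow> 'i \<Rightarrow> 'a::complex_algebra set) \<Rightarrow> ('i \<Rightarrow> 'i \<Rightarrow> 'a) \<Rightarrow>
    ('i \<Rightarrow> 'i \<Rightarrow> 'a \<Rightarrow> 'a \<otimes> 'a) \<Rightarrow> ('a \<Rightarrow> complex) \<Rightarrow> bool" where
  "partial_hopf_algebra I A u \<Delta> \<epsilon> \<longleftrightarrow> partial_bialgebra I A u \<Delta> \<epsilon> \<and> (\<exists>S. partial_antipode I A u \<Delta> \<epsilon> S)"

definition lambda_mult :: "'i set \<Rightarrow> ('i \<Rightarrow> 'i \<Rightarrow> 'a::complex_algebra) \<Rightarrow> 'i \<Rightarrow> 'a multiplier" where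
  "lambda_mult I u k = strict_sum (\<lambda>l. \<iota> (u k l)) I"

definition rho_mult :: "'i set \<Rightarrow> ('i \<Rightarrow> 'i \<Rightarrow> 'a::complex_algebra) \<Rightarrow> 'i \<Rightarrow> 'a multiplier" where
  "rho_mult I u l = strict_sum (\<lambda>k. \<iota> (u k l)) I"

definition total_comult :: "'i set \<Rightarrow> ('i \<Rightarrow> 'i \<Rightarrow> 'i \<Rightarrow> 'i \<Rightarrow> 'a::complex_algebra set) \<Rightarrow> ('i \<Rightarrow> 'i \<Rightarrow> 'a) \<Rightarrow>
    ('i \<Rightarrow> 'i \<Rightarrow> 'a \<Rightarrow> 'a \<otimes> 'a) \<Rightarrow> 'a \<Rightarrow> ('a \<otimes> 'a) multiplier" where
  "total_comult I A u \<Delta> = (THE D. clinear D \<and> (\<forall>a b. D (a * b) = D a * D b) \<and>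
     (\<forall>k\<in>I. \<forall>l\<in>I. \<forall>m\<in>I. \<forall>n\<in>I. \<forall>a\<in>A k l m n. \<forall>r\<in>I. \<forall>s\<in>I.
        \<iota> (\<Delta> r s a) = (1 \<otimes>\<^sub>M lambda_mult I u r) * D a * (1 \<otimes>\<^sub>M lambda_mult I u s) \<and>
        \<iota> (\<Delta> r s a) = (rho_mult I u r \<otimes>\<^sub>M 1) * D a * (rho_mult I u s \<otimes>\<^sub>M 1)))"

definition partial_G1 :: "'i set \<Rightarrow> ('i \<Rightarrow> 'i \<Rightarrow> 'a::complex_algebra) \<Rightarrow> 'a \<otimes> 'a \<Rightarrow> 'a \<otimes> 'a" where
  "partial_G1 I u = tlift (\<lambda>a b. supp_sum (\<lambda>p. (a \<lhd> rho_mult I u p) \<otimes> (rho_mult I u p \<rhd> b)) I)"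

definition partial_E1 :: "'i set \<Rightarrow> ('i \<Rightarrow> 'i \<Rightarrow> 'a::complex_algebra) \<Rightarrow> 'a \<otimes> 'a \<Rightarrow> 'a \<otimes> 'a" where
  "partial_E1 I u = tlift (\<lambda>a b. supp_sum (\<lambda>p. (rho_mult I u p \<rhd> a) \<otimes> (lambda_mult I u p \<rhd> b)) I)"

definition partial_G2 :: "'i set \<Rightarrow> ('i \<Rightarrow> 'i \<Rightarrow> 'a::complex_algebra) \<Rightarrow> 'a \<otimes> 'a \<Rightarrow> 'a \<otimes> 'a" where
  "partial_G2 I u = tlift (\<lambda>a b. supp_sum (\<lambda>p. (a \<lhd> lambda_mult I u p) \<otimes> (lambda_mult I u p \<rhd> b)) I)"

definition partial_E2 :: "'i set \<Rightarrow> ('i \<Rightarrow> 'i \<Rightarrow> 'a::complex_algebra) \<Rightarrow> 'a \<otimes> 'a \<Rightarrow> 'a \<otimes> 'a" where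
  "partial_E2 I u = tlift (\<lambda>a b. supp_sum (\<lambda>p. (a \<lhd> rho_mult I u p) \<otimes> (b \<lhd> lambda_mult I u p)) I)"

section \<open>Weak multiplier Hopf algebras\<close>

text \<open>The canonical maps, defined when \<open>D a * (1 \<otimes>\<^sub>M \<iota> b)\<close> and \<open>(\<iota> a \<otimes>\<^sub>M 1) * D b\<close> lie in \<open>A \<otimes> A\<close>.\<close>

definition T1 :: "('a::complex_algebra \<Rightarrow> ('a \<otimes> 'a) multiplier) \<Rightarrow> 'a \<otimes> 'a \<Rightarrow> 'a \<otimes> 'a" where
  "T1 D = tlift (\<lambda>a b. inv \<iota> (D a * (1 \<otimes>\<^sub>M \<iota> b)))"

definition T2 :: "('a::complex_algebra \<Rightarrow> ('a \<otimes> 'a) multiplier) \<Rightarrow> 'a \<otimes> 'a \<Rightarrow> 'a \<otimes> 'a" where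
  "T2 D = tlift (\<lambda>a b. inv \<iota> ((\<iota> a \<otimes>\<^sub>M 1) * D b))"

text \<open>\<open>\<Delta> \<otimes> id\<close> and \<open>id \<otimes> \<Delta>\<close> as maps \<open>A \<otimes> A \<rightarrow> M(A \<otimes> A \<otimes> A)\<close>.\<close>

definition comult_id :: "('a::complex_algebra \<Rightarrow> ('a \<otimes> 'a) multiplier) \<Rightarrow> 'a \<otimes> 'a \<Rightarrow> ('a \<otimes> 'a \<otimes> 'a) multiplier" where
  "comult_id D = tlift (\<lambda>p q. D p \<otimes>\<^sub>M \<iota> q)"

definition id_comult :: "('a::complex_algebra \<Rightarrow> ('a \<otimes> 'a) multiplier) \<Rightarrow> 'a \<otimes> 'a \<Rightarrow> ('a \<otimes> 'a \<otimes> 'a) multiplier" where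
  "id_comult D = tlift (\<lambda>p q. mtransport tassoc (\<iota> p \<otimes>\<^sub>M D q))"

definition idempotent_algebra :: "'a::complex_algebra itself \<Rightarrow> bool" where
  "idempotent_algebra _ \<longleftrightarrow> cspan {a * b | a b :: 'a. True} = UNIV"

definition nondegenerate_algebra :: "'a::complex_algebra itself \<Rightarrow> bool" where
  "nondegenerate_algebra _ \<longleftrightarrow>
     (\<forall>a :: 'a. (\<forall>b. a * b = 0) \<longrightarrow> a = 0) \<and> (\<forall>b :: 'a. (\<forall>a. a * b = 0) \<longrightarrow> b = 0)"

definition coproduct :: "('a::complex_algebra \<Rightarrow> ('a \<otimes> 'a) multiplier) \<Rightarrow> bool" where
  "coproduct D \<longleftrightarrow>
     clinear D \<and> (\<forall>a b. D (a * b) = D a * D b) \<and>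
     (\<forall>a b. D a * (1 \<otimes>\<^sub>M \<iota> b) \<in> range \<iota>) \<and> (\<forall>a b. (\<iota> a \<otimes>\<^sub>M 1) * D b \<in> range \<iota>) \<and>
     (\<forall>a b c. (\<iota> a \<otimes>\<^sub>M 1 \<otimes>\<^sub>M 1) * comult_id D (T1 D (b \<otimes> c))
            = id_comult D (T2 D (a \<otimes> b)) * (1 \<otimes>\<^sub>M 1 \<otimes>\<^sub>M \<iota> c))"

definition full_coproduct :: "('a::complex_algebra \<Rightarrow> ('a \<otimes> 'a) multiplier) \<Rightarrow> bool" where
  "full_coproduct D \<longleftrightarrow>
     (\<forall>V W. csubspace V \<and> csubspace W \<and>
        (\<forall>a b. T1 D (a \<otimes> b) \<in> tensor_subspace V UNIV) \<and> (\<forall>a b. T2 D (a \<otimes> b) \<in> tensor_subspace UNIV W)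
        \<longrightarrow> V = UNIV \<and> W = UNIV)"

definition is_counit :: "('a::complex_algebra \<Rightarrow> ('a \<otimes> 'a) multiplier) \<Rightarrow> ('a \<Rightarrow> complex) \<Rightarrow> bool" where
  "is_counit D \<epsilon> \<longleftrightarrow> clinear \<epsilon> \<and>
     (\<forall>a b. tlift (\<lambda>x y. \<epsilon> x *\<^sub>C y) (T1 D (a \<otimes> b)) = a * b \<and>
            tlift (\<lambda>x y. \<epsilon> y *\<^sub>C x) (T2 D (a \<otimes> b)) = a * b)"

text \<open>The extension of a homomorphism \<open>\<phi> : B \<rightarrow> M(C)\<close> to \<open>M(B)\<close> with \<open>\<phi>(1) = e\<close>, where \<open>e\<close> is an
  idempotent with \<open>\<phi>(B) C = e C\<close> and \<open>C \<phi>(B) = C e\<close>: the value at \<open>m\<close> is the unique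
  \<open>X = e X = X e\<close> with \<open>X \<phi>(b) = \<phi>(m b)\<close> and \<open>\<phi>(b) X = \<phi>(b m)\<close>.\<close>

definition extend_hom :: "('b::complex_algebra \<Rightarrow> 'c::complex_algebra multiplier) \<Rightarrow> 'c multiplier \<Rightarrow>
    'b multiplier \<Rightarrow> 'c multiplier" where
  "extend_hom \<phi> e m =
     (THE X. e * X = X \<and> X * e = X \<and> (\<forall>b. X * \<phi> b = \<phi> (m \<rhd> b) \<and> \<phi> b * X = \<phi> (b \<lhd> m)))"

text \<open>\<open>E\<close> is the canonical idempotent and \<open>G1\<close>, \<open>G2\<close> are the projections with kernels
  \<open>ker T1\<close>, \<open>ker T2\<close>.\<close>

definition weak_multiplier_hopf_structure :: "('a::complex_algebra \<Rightarrow> ('a \<otimes> 'a) multiplier) \<Rightarrow> ('a \<Rightarrow> complex) \<Rightarrow>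
    ('a \<otimes> 'a) multiplier \<Rightarrow> ('a \<otimes> 'a \<Rightarrow> 'a \<otimes> 'a) \<Rightarrow> ('a \<otimes> 'a \<Rightarrow> 'a \<otimes> 'a) \<Rightarrow> bool" where
  "weak_multiplier_hopf_structure D \<epsilon> E G1 G2 \<longleftrightarrow>
     idempotent_algebra TYPE('a) \<and> nondegenerate_algebra TYPE('a) \<and>
     coproduct D \<and> full_coproduct D \<and> is_counit D \<epsilon> \<and>
     E * E = E \<and>
     range (T1 D) = range (\<lambda>x. E \<rhd> x) \<and> range (T2 D) = range (\<lambda>x. x \<lhd> E) \<and>
     extend_hom (comult_id D) (leg12 E) E = leg12 E * leg23 E \<and>
     leg12 E * leg23 E = leg23 E * leg12 E \<and>
     extend_hom (id_comult D) (leg23 E) E = leg12 E * leg23 E \<and>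
     clinear G1 \<and> G1 \<circ> G1 = G1 \<and>
     (\<forall>a b c. \<iota> (tmap G1 (\<lambda>x. x) (inv \<iota> (leg13 (D a) * (1 \<otimes>\<^sub>M \<iota> b \<otimes>\<^sub>M \<iota> c))))
            = leg13 (D a) * leg23 E * (1 \<otimes>\<^sub>M \<iota> b \<otimes>\<^sub>M \<iota> c)) \<and>
     clinear G2 \<and> G2 \<circ> G2 = G2 \<and>
     (\<forall>a b c. \<iota> ((tassoc \<circ> tmap (\<lambda>x. x) G2 \<circ> inv tassoc) (inv \<iota> ((\<iota> a \<otimes>\<^sub>M \<iota> b \<otimes>\<^sub>M 1) * leg13 (D c))))
            = (\<iota> a \<otimes>\<^sub>M \<iota> b \<otimes>\<^sub>M 1) * leg12 E * leg13 (D c)) \<and>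
     {x. T1 D x = 0} = range (\<lambda>x. x - G1 x) \<and>
     {x. T2 D x = 0} = range (\<lambda>x. x - G2 x)"

definition weak_multiplier_hopf_algebra :: "('a::complex_algebra \<Rightarrow> ('a \<otimes> 'a) multiplier) \<Rightarrow> ('a \<Rightarrow> complex) \<Rightarrow> bool" where
  "weak_multiplier_hopf_algebra D \<epsilon> \<longleftrightarrow> (\<exists>E G1 G2. weak_multiplier_hopf_structure D \<epsilon> E G1 G2)"

text \<open>The formulas \<open>R1 (a \<otimes> b) = \<Sum> a(1) \<otimes> S(a(2)) b\<close> and \<open>R2 (a \<otimes> b) = \<Sum> a S(b(1)) \<otimes> b(2)\<close> are
  read after multiplying the first leg from the left by \<open>c\<close>, respectively the second leg from the
  right by \<open>c\<close>, as usual for non-unital algebras.\<close>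

definition wmha_antipode :: "('a::complex_algebra \<Rightarrow> ('a \<otimes> 'a) multiplier) \<Rightarrow> ('a \<Rightarrow> complex) \<Rightarrow> 'a \<Rightarrow> 'a multiplier" where
  "wmha_antipode D \<epsilon> = (THE S. clinear S \<and>
     (\<exists>E G1 G2 R1 R2. weak_multiplier_hopf_structure D \<epsilon> E G1 G2 \<and> clinear R1 \<and> clinear R2 \<and>
        (\<forall>a b c. (\<iota> c \<otimes>\<^sub>M 1) \<rhd> R1 (a \<otimes> b) = tlift (\<lambda>p q. p \<otimes> (S q \<rhd> b)) (T2 D (c \<otimes> a))) \<and>
        (\<forall>a b c. R2 (a \<otimes> b) \<lhd> (1 \<otimes>\<^sub>M \<iota> c) = tlift (\<lambda>p q. (a \<lhd> S p) \<otimes> q) (T1 D (b \<otimes> c))) \<and>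
        T1 D \<circ> R1 = (\<lambda>x. E \<rhd> x) \<and> R1 \<circ> T1 D = G1 \<and> T1 D \<circ> R1 \<circ> T1 D = T1 D \<and> R1 \<circ> T1 D \<circ> R1 = R1 \<and>
        T2 D \<circ> R2 = (\<lambda>x. x \<lhd> E) \<and> R2 \<circ> T2 D = G2 \<and> T2 D \<circ> R2 \<circ> T2 D = T2 D \<and> R2 \<circ> T2 D \<circ> R2 = R2))"

end

theory Submission
  imports Defs
begin

text \<open>
  The four indices of the grading are detected by the local units: \<open>u k m * a * u l n\<close> is the part of \<open>a\<close>
  in degree \<open>(k, l, m, n)\<close>. For \<open>a\<close> of this degree the legs of \<open>\<Delta> r s a\<close> have degrees \<open>(k, l, r, s)\<close> and
  \<open>(r, s, m, n)\<close>. The whole family \<open>\<Delta> r s a\<close> is infinite, but its rows and columns are finite; they are the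
  elements \<open>(1 \<otimes> \<lambda>\<^sub>r) D(a)\<close> and \<open>D(a) (1 \<otimes> \<lambda>\<^sub>s)\<close> of \<open>A \<otimes> A\<close>, where \<open>D\<close> is the total comultiplication.
  A homogeneous factor selects one row or one column, so \<open>T\<^sub>1 (a \<otimes> b)\<close> is a Sweedler sum over a single column
  and \<open>T\<^sub>2 (a \<otimes> b)\<close> one over a single row. The maps \<open>E\<^sub>1, E\<^sub>2, G\<^sub>1, G\<^sub>2\<close> are diagonal on homogeneous pure
  tensors: each tests whether two indices agree.

  An antipode \<open>S\<close> yields the generalized inverses \<open>R\<^sub>1 (a \<otimes> b) = a(1) \<otimes> S(a(2)) b\<close> and
  \<open>R\<^sub>2 (a \<otimes> b) = a S(b(1)) \<otimes> b(2)\<close> by the computation known from Hopf algebras, with coassociativity for a row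
  against a column (\<open>coassoc_col_row\<close>, \<open>coassoc_row_col\<close>) and with the antipode axioms in the form
  \<open>a(1) S(a(2)) = \<epsilon>(a) u k r\<close> and \<open>S(a(1)) a(2) = \<epsilon>(a) u s n\<close> (\<open>antipode_row\<close>, \<open>antipode_col\<close>).

  Conversely, a generalized inverse \<open>R\<^sub>1\<close> with \<open>T\<^sub>1 R\<^sub>1 = E\<^sub>1\<close> and \<open>R\<^sub>1 T\<^sub>1 = G\<^sub>1\<close> inherits all compatibilities
  of \<open>T\<^sub>1\<close> (\<open>generalized_inverse_intertwines\<close>). Applied to right multiplication in the second leg, to the
  projections onto degrees and to the left coaction, this shows \<open>R\<^sub>1 (a \<otimes> b) = a(1) \<otimes> S(a(2)) b\<close> for
  \<open>S(a) b = (\<epsilon> \<otimes> id) R\<^sub>1 (a \<otimes> b)\<close> (\<open>R1_eq_antipode\<close>). The two antipode axioms are then the two equations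
  for \<open>R\<^sub>1\<close>, sliced by the counit (\<open>partial_antipode_of_R1\<close>).

  The canonical idempotent is \<open>E = \<Sum>p. \<rho>\<^sub>p \<otimes> \<lambda>\<^sub>p\<close>, which is \<open>D(1)\<close>; multiplication by \<open>E\<close> from the left and from
  the right gives \<open>E\<^sub>1\<close> and \<open>E\<^sub>2\<close>. The axioms on \<open>E\<close> and on its legs hold since both sides test the same pairs
  of indices, and the existence of \<open>R\<^sub>1\<close> and \<open>R\<^sub>2\<close> provides the conditions on ranges and kernels
  (\<open>structure_of_generalized_inverses\<close>). In the other direction the data of a weak multiplier Hopf algebra are
  forced: \<open>E\<close> by the ranges of \<open>T\<^sub>1\<close> and \<open>T\<^sub>2\<close>, and \<open>G\<^sub>1, G\<^sub>2\<close> by slicing their defining equations with the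
  counit. With these values the conditions on ranges and kernels say precisely that \<open>T\<^sub>1\<close> and \<open>T\<^sub>2\<close> have
  generalized inverses of the required kind (\<open>generalized_inverse_exists\<close>). Since \<open>R\<^sub>1\<close> is unique, its expression
  through the antipode determines the antipode (\<open>wmha_antipode_eq\<close>).
\<close>

section \<open>Linear maps on tensor products\<close>

named_theorems clin "introduction rules for linearity and bilinearity of composite maps"

lemma clinear_zero: "clinear (\<lambda>x. 0)"
  by (rule clinearI) simp_all

lemma clinear_times_const:
  fixes f :: "'a::complex_vector \<Rightarrow> 'b::complex_algebra"
  assumes "clinear f"
  shows "clinear (\<lambda>x. c * f x)" "clinear (\<lambda>x. f x * c)"
  by (rule clinearI; simp add: clinear_add[OF assms] clinear_scale[OF assms] distrib_left distrib_right
      mult_scaleC_left mult_scaleC_right)+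

lemma clinear_pure_tensor:
  assumes "clinear f"
  shows "clinear (\<lambda>x. f x \<otimes> b)" "clinear (\<lambda>x. a \<otimes> f x)"
  by (rule clinearI; simp add: clinear_add[OF assms] clinear_scale[OF assms] tensor_bilin)+

lemma clinear_scaleC_left:
  fixes f :: "'a::complex_vector \<Rightarrow> complex"
  assumes "clinear f"
  shows "clinear (\<lambda>x. f x *\<^sub>C b)"
  by (rule clinearI; simp add: clinear_add[OF assms] clinear_scale[OF assms] scaleC_add_left
      scaleC_complex_def scaleC_scaleC)

lemma clinear_lact_ract_comp:
  assumes "clinear f"
  shows "clinear (\<lambda>x. m \<rhd> f x)" "clinear (\<lambda>x. f x \<lhd> m)"
  by (rule clinear_compose[OF assms clinear_lact], rule clinear_compose[OF assms clinear_ract])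

lemma clinear_multiplier_act:
  assumes "clinear f"
  shows "clinear (\<lambda>x. f x \<rhd> a)" "clinear (\<lambda>x. a \<lhd> f x)"
  by (rule clinearI; simp add: clinear_add[OF assms] clinear_scale[OF assms] multiplier_act)+

lemma clinear_mult_of:
  assumes "clinear f"
  shows "clinear (\<lambda>x. \<iota> (f x))"
  by (rule clinearI; rule multiplier_eqI; simp add: clinear_add[OF assms] clinear_scale[OF assms]
      multiplier_act mult_of_act distrib_left distrib_right mult_scaleC_left mult_scaleC_right)

lemma clinear_tmap_comp:
  assumes "clinear f" "clinear g" "clinear h"
  shows "clinear (\<lambda>x. tmap f g (h x))"
  by (rule clinear_compose[OF assms(3) clinear_tmap[OF assms(1,2)]])

lemma clinear_tlift_comp:
  assumes "cbilinear B" "clinear f"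
  shows "clinear (\<lambda>x. tlift B (f x))"
  by (rule clinear_compose[OF assms(2) clinear_tlift[OF assms(1)]])

lemma clinear_tassoc_comp:
  assumes "clinear f"
  shows "clinear (\<lambda>x. tassoc (f x))"
  by (rule clinear_compose[OF assms clinear_tassoc])

lemma clinear_tswap23_comp:
  assumes "clinear f"
  shows "clinear (\<lambda>x. tswap23 (f x))"
  by (rule clinear_compose[OF assms clinear_tswap23])

lemma clinear_tmap_param:
  assumes "\<And>z. clinear (f z)" "\<And>z. clinear (g z)" "\<And>a b. clinear (\<lambda>z. f z a \<otimes> g z b)"
  shows "clinear (\<lambda>z. tmap (f z) (g z) x)"
  unfolding tmap_def by (rule clinear_tlift_param) (intro cbilinear_tmap assms, rule assms)

lemma clinear_mtensor:
  assumes "clinear f"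
  shows "clinear (\<lambda>x. f x \<otimes>\<^sub>M n)" "clinear (\<lambda>x. m \<otimes>\<^sub>M f x)"
proof -
  have lin: "clinear (\<lambda>x. tmap ((\<rhd>) (f x)) ((\<rhd>) n) z)" "clinear (\<lambda>x. tmap (\<lambda>a. a \<lhd> f x) (\<lambda>b. b \<lhd> n) z)"
    "clinear (\<lambda>x. tmap ((\<rhd>) m) ((\<rhd>) (f x)) w)" "clinear (\<lambda>x. tmap (\<lambda>b. b \<lhd> m) (\<lambda>a. a \<lhd> f x) w)"
    for z w
    by (intro clinear_tmap_param clinear_lact clinear_ract clinear_pure_tensor clinear_multiplier_act assms)+
  note [simp] = multiplier_act mtensor_act lin[THEN clinear_add] lin[THEN clinear_scale]
  show "clinear (\<lambda>x. f x \<otimes>\<^sub>M n)" "clinear (\<lambda>x. m \<otimes>\<^sub>M f x)"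
    by (rule clinearI; rule multiplier_eqI; simp)+
qed

lemmas [clin] = clinear_id clinear_zero clinear_plus clinear_scaleC clinear_times_const
  clinear_pure_tensor clinear_scaleC_left clinear_lact_ract_comp clinear_multiplier_act
  clinear_mult_of clinear_tmap_comp clinear_tlift_comp clinear_tassoc_comp
  clinear_tswap23_comp clinear_mtensor clinear_tlift_param cbilinearI

text \<open>
  \<open>tlift B z\<close> plays the role of the Sweedler sum \<open>\<Sum> B z(1) z(2)\<close>, and linear maps may be moved into it.
\<close>

lemma tlift_linear:
  assumes "clinear F" "cbilinear B"
  shows "F (tlift B z) = tlift (\<lambda>x y. F (B x y)) z"
proof -
  have "cbilinear (\<lambda>x y. F (B x y))"
    using assms by (auto simp: cbilinear_def intro: clinear_compose)
  then show ?thesis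
    by (intro clinear_tensor_eqI[where F = "\<lambda>z. F (tlift B z)" and x = z]
        clinear_compose[OF clinear_tlift[OF assms(2)] assms(1)] clinear_tlift)
      (simp_all add: tlift_pure assms(2))
qed

lemma tlift_pure_tensor: "tlift (\<otimes>) z = z"
  by (rule clinear_tensor_eqI[of "tlift (\<otimes>)"])
    (simp_all add: clinear_tlift cbilinear_pure_tensor tlift_pure clinear_id)

text \<open>
  This is how expressions in a Sweedler sum are compared: it is enough to look at the homogeneous parts
  in which the two legs lie.
\<close>

lemma tlift_cong_subspace:
  assumes "z \<in> tensor_subspace V W" "cbilinear B" "cbilinear B'"
    and eq: "\<And>x y. x \<in> V \<Longrightarrow> y \<in> W \<Longrightarrow> B x y = B' x y"
  shows "tlift B z = tlift B' z"
proof -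
  have "csubspace {z. tlift B z = tlift B' z}"
    by (intro complex_vector.subspaceI)
      (simp_all add: clinear_0 clinear_add clinear_scale clinear_tlift assms)
  moreover have "{v \<otimes> w | v w. v \<in> V \<and> w \<in> W} \<subseteq> {z. tlift B z = tlift B' z}"
    using eq by (auto simp: tlift_pure assms)
  ultimately have "tensor_subspace V W \<subseteq> {z. tlift B z = tlift B' z}"
    unfolding tensor_subspace_def by (rule complex_vector.span_minimal[rotated])
  with assms(1) show ?thesis by blast
qed

lemma tlift_zero: "tlift (\<lambda>x y. 0) z = 0"
  by (rule clinear_tensor_eqI[where F = "tlift (\<lambda>x y. 0)"]) (simp_all add: tlift_pure clinear_tlift cbilinearI clinear_zero)

lemma tensor_zero [simp]: "a \<otimes> 0 = 0" "0 \<otimes> b = 0"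
  by (simp_all add: clinear_0[OF clinear_pure_tensor(1)[OF clinear_id]] clinear_0[OF clinear_pure_tensor(2)[OF clinear_id]])

lemma tlift_if: "tlift (\<lambda>x y. if P then B x y else 0) z = (if P then tlift B z else 0)"
  by (simp add: tlift_zero)

section \<open>Finitely supported sums\<close>

lemma supp_sum_superset:
  assumes "finite F" "F \<subseteq> J" "\<And>j. j \<in> J \<Longrightarrow> f j \<noteq> 0 \<Longrightarrow> j \<in> F"
  shows "supp_sum f J = sum f F"
  unfolding supp_sum_def support_on_def using assms by (intro sum.mono_neutral_left) auto

lemma supp_sum_single:
  assumes "i \<in> J" "\<And>j. j \<in> J \<Longrightarrow> j \<noteq> i \<Longrightarrow> f j = 0"
  shows "supp_sum f J = f i"
proof -
  have "supp_sum f J = sum f {i}" using assms by (intro supp_sum_superset) auto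
  then show ?thesis by simp
qed

lemma supp_sum_zero: "(\<And>j. j \<in> J \<Longrightarrow> f j = 0) \<Longrightarrow> supp_sum f J = 0"
  unfolding supp_sum_def support_on_def by (rule sum.neutral) simp

lemma supp_sum_cong: "(\<And>j. j \<in> J \<Longrightarrow> f j = g j) \<Longrightarrow> supp_sum f J = supp_sum g J"
  unfolding supp_sum_def support_on_def by (intro sum.cong) auto

lemma clinear_sum:
  assumes "clinear F"
  shows "F (sum f S) = (\<Sum>i\<in>S. F (f i))"
  by (induction S rule: infinite_finite_induct) (simp_all add: clinear_0[OF assms] clinear_add[OF assms])

lemma supp_sum_linear:
  assumes "clinear F" "finite {j \<in> J. f j \<noteq> 0}"
  shows "F (supp_sum f J) = supp_sum (\<lambda>j. F (f j)) J"
proof -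
  have "supp_sum (\<lambda>j. F (f j)) J = (\<Sum>j\<in>{j \<in> J. f j \<noteq> 0}. F (f j))"
    using assms by (intro supp_sum_superset) (auto simp: clinear_0)
  moreover have "supp_sum f J = sum f {j \<in> J. f j \<noteq> 0}"
    using assms by (intro supp_sum_superset) auto
  ultimately show ?thesis by (simp add: clinear_sum[OF assms(1)])
qed

lemma subspace_finite_support:
  assumes "\<And>j. j \<in> J \<Longrightarrow> clinear (f j)"
  shows "csubspace {x. finite {j \<in> J. f j x \<noteq> 0}}"
proof (rule complex_vector.subspaceI)
  have empty: "{j \<in> J. f j 0 \<noteq> 0} = {}" using assms by (auto simp: clinear_0)
  show "0 \<in> {x. finite {j \<in> J. f j x \<noteq> 0}}"
    unfolding mem_Collect_eq empty by (rule finite.emptyI)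
next
  fix x y assume "x \<in> {x. finite {j \<in> J. f j x \<noteq> 0}}" "y \<in> {x. finite {j \<in> J. f j x \<noteq> 0}}"
  moreover have "{j \<in> J. f j (x + y) \<noteq> 0} \<subseteq> {j \<in> J. f j x \<noteq> 0} \<union> {j \<in> J. f j y \<noteq> 0}"
    using assms by (auto simp: clinear_add)
  ultimately show "x + y \<in> {x. finite {j \<in> J. f j x \<noteq> 0}}"
    by (auto intro: finite_subset)
next
  fix c x assume "x \<in> {x. finite {j \<in> J. f j x \<noteq> 0}}"
  moreover have "{j \<in> J. f j (c *\<^sub>C x) \<noteq> 0} \<subseteq> {j \<in> J. f j x \<noteq> 0}"
    using assms by (auto simp: clinear_scale)
  ultimately show "c *\<^sub>C x \<in> {x. finite {j \<in> J. f j x \<noteq> 0}}"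
    by (auto intro: finite_subset)
qed

lemma finite_support_tensor:
  assumes "\<And>j. j \<in> J \<Longrightarrow> clinear (f j)" "\<And>a b. finite {j \<in> J. f j (a \<otimes> b) \<noteq> 0}"
  shows "finite {j \<in> J. f j z \<noteq> 0}"
proof (induction z rule: tensor_induct)
  case (pure c a b)
  show ?case
    using complex_vector.subspace_scale[OF subspace_finite_support[of J f], OF assms(1), of "a \<otimes> b" c]
      assms(2) by simp
next
  case (add x y)
  then show ?case
    using complex_vector.subspace_add[OF subspace_finite_support[of J f], OF assms(1), of x y] by simp
qed

lemma clinear_supp_sum:
  assumes lin: "\<And>j. j \<in> J \<Longrightarrow> clinear (f j)" and fin: "\<And>x. finite {j \<in> J. f j x \<noteq> 0}"
  shows "clinear (\<lambda>x. supp_sum (\<lambda>j. f j x) J)"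
proof (rule clinearI)
  fix x y c
  define F where "F = {j \<in> J. f j x \<noteq> 0} \<union> {j \<in> J. f j y \<noteq> 0}"
  have F: "finite F" "F \<subseteq> J" unfolding F_def using fin by auto
  have *: "supp_sum (\<lambda>j. f j z) J = (\<Sum>j\<in>F. f j z)" if "\<And>j. j \<in> J \<Longrightarrow> f j z \<noteq> 0 \<Longrightarrow> j \<in> F" for z
    by (rule supp_sum_superset[OF F that])
  have "supp_sum (\<lambda>j. f j (x + y)) J = (\<Sum>j\<in>F. f j (x + y))"
    by (rule *) (auto simp: F_def clinear_add[OF lin])
  also have "\<dots> = (\<Sum>j\<in>F. f j x + f j y)"
    using F by (intro sum.cong) (auto simp: clinear_add[OF lin])
  also have "\<dots> = supp_sum (\<lambda>j. f j x) J + supp_sum (\<lambda>j. f j y) J"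
    by (subst (1 2) *) (auto simp: F_def sum.distrib)
  finally show "supp_sum (\<lambda>j. f j (x + y)) J = supp_sum (\<lambda>j. f j x) J + supp_sum (\<lambda>j. f j y) J" .
  have "supp_sum (\<lambda>j. f j (c *\<^sub>C x)) J = (\<Sum>j\<in>F. f j (c *\<^sub>C x))"
    by (rule *) (auto simp: F_def clinear_scale[OF lin])
  also have "\<dots> = (\<Sum>j\<in>F. c *\<^sub>C f j x)"
    using F by (intro sum.cong) (auto simp: clinear_scale[OF lin])
  also have "\<dots> = c *\<^sub>C supp_sum (\<lambda>j. f j x) J"
    by (subst *) (auto simp: F_def complex_vector.scale_sum_right)
  finally show "supp_sum (\<lambda>j. f j (c *\<^sub>C x)) J = c *\<^sub>C supp_sum (\<lambda>j. f j x) J" .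
qed

lemma supp_sum_swap:
  assumes "finite P" "finite Q" "\<And>i j. i \<in> I \<Longrightarrow> j \<in> J \<Longrightarrow> g i j \<noteq> 0 \<Longrightarrow> i \<in> P \<and> j \<in> Q"
  shows "supp_sum (\<lambda>i. supp_sum (\<lambda>j. g i j) J) I = supp_sum (\<lambda>j. supp_sum (\<lambda>i. g i j) I) J"
proof -
  have 1: "supp_sum (\<lambda>j. g i j) J = (\<Sum>j\<in>Q \<inter> J. g i j)" if "i \<in> I" for i
    using assms that by (intro supp_sum_superset) auto
  have 2: "supp_sum (\<lambda>i. g i j) I = (\<Sum>i\<in>P \<inter> I. g i j)" if "j \<in> J" for j
    using assms that by (intro supp_sum_superset) auto
  have "supp_sum (\<lambda>i. supp_sum (\<lambda>j. g i j) J) I = (\<Sum>i\<in>P \<inter> I. supp_sum (\<lambda>j. g i j) J)"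
  proof (rule supp_sum_superset)
    fix i assume i: "i \<in> I" "supp_sum (g i) J \<noteq> 0"
    then obtain j where "j \<in> J" "g i j \<noteq> 0" using supp_sum_zero[of J "g i"] by blast
    with i assms(3) show "i \<in> P \<inter> I" by blast
  qed (use assms in auto)
  also have "\<dots> = (\<Sum>i\<in>P \<inter> I. \<Sum>j\<in>Q \<inter> J. g i j)"
    by (intro sum.cong) (auto simp: 1)
  also have "\<dots> = (\<Sum>j\<in>Q \<inter> J. \<Sum>i\<in>P \<inter> I. g i j)"
    by (rule sum.swap)
  also have "\<dots> = (\<Sum>j\<in>Q \<inter> J. supp_sum (\<lambda>i. g i j) I)"
    by (intro sum.cong) (auto simp: 2)
  also have "\<dots> = supp_sum (\<lambda>j. supp_sum (\<lambda>i. g i j) I) J"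
  proof (rule supp_sum_superset[symmetric])
    fix j assume j: "j \<in> J" "supp_sum (\<lambda>i. g i j) I \<noteq> 0"
    then obtain i where "i \<in> I" "g i j \<noteq> 0" using supp_sum_zero[of I "\<lambda>i. g i j"] by blast
    with j assms(3) show "j \<in> Q \<inter> J" by blast
  qed (use assms in auto)
  finally show ?thesis .
qed

text \<open>
  The support need not be bounded uniformly in \<open>x\<close> and \<open>y\<close>: a tensor is a finite sum of pure tensors,
  each of which sees finitely many summands.
\<close>

lemma tlift_supp_sum:
  assumes bil: "\<And>j. j \<in> J \<Longrightarrow> cbilinear (f j)" and fin: "\<And>x y. finite {j \<in> J. f j x y \<noteq> 0}"
  shows "cbilinear (\<lambda>x y. supp_sum (\<lambda>j. f j x y) J)"
    and "tlift (\<lambda>x y. supp_sum (\<lambda>j. f j x y) J) z = supp_sum (\<lambda>j. tlift (f j) z) J"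
proof -
  have lin: "clinear (f j x)" "clinear (\<lambda>x. f j x y)" if "j \<in> J" for j x y
    using bil[OF that] by (auto simp: cbilinear_def)
  show 1: "cbilinear (\<lambda>x y. supp_sum (\<lambda>j. f j x y) J)"
    by (intro cbilinearI clinear_supp_sum lin fin)
  have fin': "finite {j \<in> J. tlift (f j) z \<noteq> 0}" for z
  proof (rule finite_support_tensor)
    show "finite {j \<in> J. tlift (f j) (a \<otimes> b) \<noteq> 0}" for a b
      by (rule finite_subset[OF _ fin[of a b]]) (auto simp: tlift_pure[OF bil])
  qed (rule clinear_tlift[OF bil])
  have "clinear (\<lambda>z. supp_sum (\<lambda>j. tlift (f j) z) J)"
    by (intro clinear_supp_sum clinear_tlift bil fin')
  moreover have "tlift (\<lambda>x y. supp_sum (\<lambda>j. f j x y) J) (a \<otimes> b) = supp_sum (\<lambda>j. tlift (f j) (a \<otimes> b)) J" for a b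
    unfolding tlift_pure[OF 1] by (rule supp_sum_cong) (simp add: tlift_pure bil)
  ultimately show "tlift (\<lambda>x y. supp_sum (\<lambda>j. f j x y) J) z = supp_sum (\<lambda>j. tlift (f j) z) J"
    by (rule clinear_tensor_eqI[OF clinear_tlift[OF 1]])
qed

section \<open>Multipliers and their legs\<close>

text \<open>
  The identities that define a double centralizer involve, for given arguments, finitely many summands
  only, so they pass to the sum.
\<close>

lemma has_strict_sum_strict_sum:
  assumes "\<And>a. finite {i \<in> I. f i \<rhd> a \<noteq> 0}" "\<And>a. finite {i \<in> I. a \<lhd> f i \<noteq> 0}"
  shows "has_strict_sum f I (strict_sum f I)"
proof -
  let ?L = "\<lambda>a. supp_sum (\<lambda>i. f i \<rhd> a) I" and ?R = "\<lambda>a. supp_sum (\<lambda>i. a \<lhd> f i) I"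
  define m where "m = abs_multiplier (?L, ?R)"
  have L: "?L (a * b) = ?L a * b" for a b
    by (simp add: lact_mult supp_sum_linear[OF clinear_times_const(2)[OF clinear_id] assms(1)])
  have R: "?R (a * b) = a * ?R b" for a b
    by (simp add: ract_mult supp_sum_linear[OF clinear_times_const(1)[OF clinear_id] assms(2)])
  have LR: "a * ?L b = ?R a * b" for a b
    by (simp add: mult_lact supp_sum_linear[OF clinear_times_const(1)[OF clinear_id] assms(1)]
        supp_sum_linear[OF clinear_times_const(2)[OF clinear_id] assms(2)])
  have linL: "clinear ?L" and linR: "clinear ?R"
    by (intro clinear_supp_sum clinear_lact clinear_ract assms)+
  have act: "m \<rhd> a = ?L a" "a \<lhd> m = ?R a" for a
    unfolding m_def by (rule act_abs_multiplier[where L = ?L and R = ?R, OF linL linR L R LR])+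
  have m: "has_strict_sum f I m"
    using assms by (simp add: has_strict_sum_def act)
  show ?thesis unfolding strict_sum_def
  proof (rule theI)
    show "m' = m" if "has_strict_sum f I m'" for m'
      using that m by (intro multiplier_eqI) (simp_all add: has_strict_sum_def)
  qed (rule m)
qed

text \<open>
  The left action determines the right action up to elements that are annihilated by all right
  multiplications, because \<open>(a \<lhd> m) * b = a * (m \<rhd> b)\<close>; local units exclude such elements.
\<close>

lemma multiplier_eqI_left:
  assumes "\<And>a::'a::complex_algebra. \<exists>e. a * e = a" "\<And>a. m \<rhd> a = n \<rhd> a"
  shows "m = (n :: 'a multiplier)"
proof (rule multiplier_eqI)
  fix a
  obtain e where e: "((a \<lhd> m) - (a \<lhd> n)) * e = (a \<lhd> m) - (a \<lhd> n)" using assms(1) by blast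
  have "((a \<lhd> m) - (a \<lhd> n)) * e = 0"
    by (simp add: left_diff_distrib mult_lact[symmetric] assms(2))
  with e show "a \<lhd> m = a \<lhd> n" by simp
qed (rule assms(2))

lemma multiplier_eqI_right:
  assumes "\<And>a::'a::complex_algebra. \<exists>e. e * a = a" "\<And>a. a \<lhd> m = a \<lhd> n"
  shows "m = (n :: 'a multiplier)"
proof (rule multiplier_eqI)
  fix a
  obtain e where e: "e * ((m \<rhd> a) - (n \<rhd> a)) = (m \<rhd> a) - (n \<rhd> a)" using assms(1) by blast
  have "e * ((m \<rhd> a) - (n \<rhd> a)) = 0"
    by (simp add: right_diff_distrib mult_lact assms(2))
  with e show "m \<rhd> a = n \<rhd> a" by simp
qed (rule assms(2))

lemma inj_mult_of:
  assumes "\<And>a::'a::complex_algebra. \<exists>e. a * e = a"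
  shows "inj (\<iota> :: 'a \<Rightarrow> _)"
proof (rule injI)
  fix x y :: 'a assume eq: "\<iota> x = \<iota> y"
  obtain e where e: "(x - y) * e = x - y" using assms by blast
  have "x * e = y * e" using arg_cong[OF eq, of "\<lambda>m. m \<rhd> e"] by (simp add: mult_of_act)
  with e show "x = y" by (simp add: left_diff_distrib)
qed

lemma mtensor_act_pure:
  "(m \<otimes>\<^sub>M n) \<rhd> (a \<otimes> b) = (m \<rhd> a) \<otimes> (n \<rhd> b)" "(a \<otimes> b) \<lhd> (m \<otimes>\<^sub>M n) = (a \<lhd> m) \<otimes> (b \<lhd> n)"
  by (simp_all add: mtensor_act tmap_pure clinear_lact clinear_ract)

lemma times_tensor_pure_right: "z * (c \<otimes> d) = tlift (\<lambda>x y. (x * c) \<otimes> (y * d)) z"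
  by (rule clinear_tensor_eqI[where x = z])
    (intro clin | simp add: times_pure tlift_pure[OF cbilinear_tmap[OF clinear_times_const(2) clinear_times_const(2)]] clinear_id)+

lemma times_tensor_pure_left: "(c \<otimes> d) * z = tlift (\<lambda>x y. (c * x) \<otimes> (d * y)) z"
  by (rule clinear_tensor_eqI[where x = z])
    (intro clin | simp add: times_pure tlift_pure[OF cbilinear_tmap[OF clinear_times_const(1) clinear_times_const(1)]] clinear_id)+

lemma clinear_tensor3_eqI:
  assumes "clinear F" "clinear G" "\<And>a b c. F (a \<otimes> b \<otimes> c) = G (a \<otimes> b \<otimes> c)"
  shows "F x = G x"
proof (rule clinear_tensor_eqI[OF assms(1,2)])
  show "F (y \<otimes> c) = G (y \<otimes> c)" for y c
    by (rule clinear_tensor_eqI[of "\<lambda>y. F (y \<otimes> c)"])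
      (intro clinear_compose[OF clinear_pure_tensor(1)[OF clinear_id]] assms)+
qed

lemma tswap23_times: "tswap23 (x * y) = tswap23 x * tswap23 y"
  for x y :: "'a::complex_algebra \<otimes> 'b::complex_algebra \<otimes> 'c::complex_algebra"
proof (rule clinear_tensor3_eqI[where x = x])
  fix a b c
  show "tswap23 ((a \<otimes> b \<otimes> c) * y) = tswap23 (a \<otimes> b \<otimes> c) * tswap23 y"
    by (rule clinear_tensor3_eqI[where x = y]) (intro clin | simp add: times_pure tswap23_pure)+
qed (intro clin)+

lemma bij_tassoc: "bij (tassoc :: 'a::complex_vector \<otimes> ('b::complex_vector \<otimes> 'c::complex_vector) \<Rightarrow> _)"
proof -
  define g :: "'a \<otimes> 'b \<otimes> 'c \<Rightarrow> 'a \<otimes> ('b \<otimes> 'c)"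
    where "g = tlift (\<lambda>x c. tlift (\<lambda>a b. a \<otimes> (b \<otimes> c)) x)"
  have 1: "cbilinear (\<lambda>(a::'a) (b::'b). a \<otimes> (b \<otimes> (c::'c)))" for c by (intro clin)
  have 2: "cbilinear (\<lambda>(x::'a \<otimes> 'b) (c::'c). tlift (\<lambda>a b. a \<otimes> (b \<otimes> c)) x)" by (intro clin)
  have g_pure: "g (a \<otimes> b \<otimes> c) = a \<otimes> (b \<otimes> c)" for a b c
    unfolding g_def by (simp add: tlift_pure 1 2)
  have g_lin: "clinear g"
    unfolding g_def by (intro clinear_tlift 2)
  have "tassoc (g x) = x" for x
    by (rule clinear_tensor3_eqI[where x = x]) (intro clin g_lin | simp add: g_pure tassoc_pure)+
  moreover have "g (tassoc x) = x" for x
  proof (rule clinear_tensor_eqI[where x = x])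
    fix a :: 'a and y :: "'b \<otimes> 'c"
    show "g (tassoc (a \<otimes> y)) = a \<otimes> y"
      by (rule clinear_tensor_eqI[where x = y])
        (intro clin clinear_compose[OF _ g_lin] | simp add: g_pure tassoc_pure)+
  qed (intro clin clinear_compose[OF clinear_tassoc g_lin])+
  ultimately show ?thesis by (metis bij_iff)
qed

lemma inv_tassoc_tassoc: "inv tassoc (tassoc x) = x"
  by (simp add: bij_tassoc bij_is_inj)

lemma tassoc_inv_tassoc: "tassoc (inv tassoc x) = x"
  by (simp add: bij_tassoc bij_is_surj surj_f_inv_f)

lemma clinear_inv_tassoc: "clinear (inv tassoc)"
  by (rule clinearI; rule injD[OF bij_is_inj[OF bij_tassoc]])
    (simp_all add: tassoc_inv_tassoc clinear_add[OF clinear_tassoc] clinear_scale[OF clinear_tassoc])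

lemma inv_tassoc_pure: "inv tassoc (a \<otimes> b \<otimes> c) = a \<otimes> (b \<otimes> c)"
  by (metis inv_tassoc_tassoc tassoc_pure)

lemma tassoc_times: "tassoc (x * y) = tassoc x * tassoc y"
  for x y :: "'a::complex_algebra \<otimes> ('b::complex_algebra \<otimes> 'c::complex_algebra)"
proof -
  have "tassoc (inv tassoc v * inv tassoc w) = v * w" for v w :: "'a \<otimes> 'b \<otimes> 'c"
  proof (rule clinear_tensor3_eqI[where x = v])
    fix a b c
    show "tassoc (inv tassoc (a \<otimes> b \<otimes> c) * inv tassoc w) = (a \<otimes> b \<otimes> c) * w"
      by (rule clinear_tensor3_eqI[where x = w])
        (intro clin clinear_compose[OF _ clinear_inv_tassoc] | simp add: times_pure tassoc_pure inv_tassoc_pure)+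
  qed (intro clin clinear_inv_tassoc)+
  from this[of "tassoc x" "tassoc y"] show ?thesis by (simp add: inv_tassoc_tassoc)
qed

lemma mtensor_times: "(m \<otimes>\<^sub>M n) * (m' \<otimes>\<^sub>M n') = (m * m') \<otimes>\<^sub>M (n * n')"
proof (rule multiplier_eqI)
  show "((m \<otimes>\<^sub>M n) * (m' \<otimes>\<^sub>M n')) \<rhd> z = ((m * m') \<otimes>\<^sub>M (n * n')) \<rhd> z" for z
    by (rule clinear_tensor_eqI[where x = z]) (intro clin | simp add: multiplier_act mtensor_act_pure)+
  show "z \<lhd> ((m \<otimes>\<^sub>M n) * (m' \<otimes>\<^sub>M n')) = z \<lhd> ((m * m') \<otimes>\<^sub>M (n * n'))" for z
    by (rule clinear_tensor_eqI[where x = z]) (intro clin | simp add: multiplier_act mtensor_act_pure)+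
qed

lemma times_mult_of:
  shows "m * \<iota> a = \<iota> (m \<rhd> a)" "\<iota> a * m = \<iota> (a \<lhd> m)" "\<iota> a * \<iota> b = \<iota> (a * b)"
  by (rule multiplier_eqI; simp add: multiplier_act mult_of_act lact_mult ract_mult mult_lact mult.assoc)+
text \<open>
  After left multiplication by any \<open>e\<close> both sides become \<open>(e \<lhd> m) * (x \<lhd> n)\<close>.
\<close>

lemma lact_ract_commute:
  assumes "\<And>x::'a::complex_algebra. \<exists>e. e * x = x"
  shows "(m \<rhd> (x::'a)) \<lhd> n = m \<rhd> (x \<lhd> n)"
proof -
  obtain e where e: "e * (((m \<rhd> x) \<lhd> n) - (m \<rhd> (x \<lhd> n))) = ((m \<rhd> x) \<lhd> n) - (m \<rhd> (x \<lhd> n))"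
    using assms by blast
  have "e * ((m \<rhd> x) \<lhd> n) = e * (m \<rhd> (x \<lhd> n))"
    by (simp only: ract_mult[symmetric] mult_lact)
  with e show ?thesis by (simp add: right_diff_distrib)
qed
lemma mult_of_mtensor: "\<iota> a \<otimes>\<^sub>M \<iota> b = \<iota> (a \<otimes> b)"
proof (rule multiplier_eqI)
  show "(\<iota> a \<otimes>\<^sub>M \<iota> b) \<rhd> z = \<iota> (a \<otimes> b) \<rhd> z" for z
    by (rule clinear_tensor_eqI[where x = z]) (intro clin | simp add: mtensor_act_pure mult_of_act times_pure)+
  show "z \<lhd> (\<iota> a \<otimes>\<^sub>M \<iota> b) = z \<lhd> \<iota> (a \<otimes> b)" for z
    by (rule clinear_tensor_eqI[where x = z]) (intro clin | simp add: mtensor_act_pure mult_of_act times_pure)+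
qed

lemma leg12_act: "leg12 m \<rhd> (z \<otimes> c) = (m \<rhd> z) \<otimes> c" "(z \<otimes> c) \<lhd> leg12 m = (z \<lhd> m) \<otimes> c"
  by (simp_all add: leg12_def mtensor_act_pure multiplier_act)

lemma leg23_act: "leg23 m \<rhd> tassoc (a \<otimes> z) = tassoc (a \<otimes> (m \<rhd> z))" "tassoc (a \<otimes> z) \<lhd> leg23 m = tassoc (a \<otimes> (z \<lhd> m))"
  by (simp_all add: leg23_def mtransport_tassoc mtensor_act_pure multiplier_act)

lemma leg23_act_pure: "leg23 m \<rhd> (a \<otimes> b \<otimes> c) = tassoc (a \<otimes> (m \<rhd> (b \<otimes> c)))"
  using leg23_act(1)[of m a "b \<otimes> c"] by (simp add: tassoc_pure)

lemma leg13_act: "leg13 m \<rhd> tswap23 (z \<otimes> c) = tswap23 ((m \<rhd> z) \<otimes> c)" "tswap23 (z \<otimes> c) \<lhd> leg13 m = tswap23 ((z \<lhd> m) \<otimes> c)"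
  by (simp_all add: leg13_def mtransport_tswap23 mtensor_act_pure multiplier_act)

section \<open>Generalized inverses of linear maps\<close>

text \<open>
  \<open>G\<close> is a projection along the kernel of \<open>T\<close>, so \<open>T\<close> maps \<open>range G\<close> bijectively onto
  \<open>range T = range P\<close>. Following \<open>P\<close> by the inverse bijection gives \<open>R\<close>.
\<close>

lemma generalized_inverse_exists:
  fixes T :: "'v::complex_vector \<Rightarrow> 'w::complex_vector"
  assumes T: "clinear T" and G: "clinear G" "\<And>x. G (G x) = G x" "{x. T x = 0} = range (\<lambda>x. x - G x)"
    and P: "clinear P" "range T = range P" "\<And>x. P (T x) = T x"
  shows "\<exists>R. clinear R \<and> T \<circ> R = P \<and> R \<circ> T = G \<and> T \<circ> R \<circ> T = T \<and> R \<circ> T \<circ> R = R"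
proof -
  have TG: "T (G x) = T x" for x
  proof -
    have "x - G x \<in> {x. T x = 0}" unfolding G(3) by blast
    then show ?thesis by (simp add: clinear_diff[OF T])
  qed
  have GT: "G x = G y" if "T x = T y" for x y
  proof -
    have "x - y \<in> {x. T x = 0}" using that by (simp add: clinear_diff[OF T])
    then obtain z where "x - y = z - G z" unfolding G(3) by blast
    then have "G (x - y) = 0" by (simp add: clinear_diff[OF G(1)] G(2))
    then show ?thesis by (simp add: clinear_diff[OF G(1)])
  qed
  have "\<exists>x. T x = P y" for y using P(2) by (metis rangeE rangeI)
  then obtain Q where Q: "\<And>y. T (Q y) = P y" by metis
  define R where "R y = G (Q y)" for y
  have TR: "T (R y) = P y" for y by (simp add: R_def TG Q)
  have GR: "G (R y) = R y" for y by (simp add: R_def G(2))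
  have R_eqI: "R y = G x" if "T x = P y" for x y
    unfolding R_def by (rule GT) (simp add: Q that)
  have "clinear R"
  proof (rule clinearI)
    show "R (x + y) = R x + R y" for x y
      using R_eqI[of "R x + R y" "x + y"]
      by (simp add: clinear_add[OF T] clinear_add[OF P(1)] clinear_add[OF G(1)] TR GR)
    show "R (c *\<^sub>C x) = c *\<^sub>C R x" for c x
      using R_eqI[of "c *\<^sub>C R x" "c *\<^sub>C x"]
      by (simp add: clinear_scale[OF T] clinear_scale[OF P(1)] clinear_scale[OF G(1)] TR GR)
  qed
  moreover have RT: "R (T x) = G x" for x by (rule R_eqI) (simp add: P(3))
  moreover have "R (P x) = R x" for x by (simp only: TR[symmetric] RT GR)
  ultimately show ?thesis by (intro exI[of _ R]) (auto simp: fun_eq_iff TR RT TG P(3))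
qed

text \<open>
  A generalized inverse \<open>R\<close> with prescribed \<open>R T\<close> and \<open>T R\<close> is unique, and therefore inherits the
  compatibilities of \<open>T\<close>: \<open>R' Y = R' T' R' Y = R' Y T R = R' T' X R = X R T R = X R\<close>.
\<close>

lemma generalized_inverse_intertwines:
  assumes "\<And>x. R (T (R x)) = R x" "\<And>x. R' (T' (R' x)) = R' x"
    and "\<And>x. T' (X x) = Y (T x)"
    and "\<And>y. T' (R' (Y y)) = Y (T (R y))" "\<And>x. R' (T' (X x)) = X (R (T x))"
  shows "R' (Y y) = X (R y)"
  by (metis assms)

section \<open>Homogeneous elements of a partial bialgebra\<close>

context partial_bialgebra
begin

abbreviation "lam \<equiv> lambda_mult I u"
abbreviation "rho \<equiv> rho_mult I u"

text \<open>
  The indices are required to lie in \<open>I\<close>, since the axioms say nothing about \<open>A\<close> at other indices.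
\<close>

definition homog :: "'i \<Rightarrow> 'i \<Rightarrow> 'i \<Rightarrow> 'i \<Rightarrow> 'a \<Rightarrow> bool" where
  "homog k l m n a \<longleftrightarrow> k \<in> I \<and> l \<in> I \<and> m \<in> I \<and> n \<in> I \<and> a \<in> A k l m n"

lemma homog_index:
  assumes "homog k l m n a"
  shows "k \<in> I" "l \<in> I" "m \<in> I" "n \<in> I"
  using assms by (auto simp: homog_def)

lemma subspace_A: "\<lbrakk>k \<in> I; l \<in> I; m \<in> I; n \<in> I\<rbrakk> \<Longrightarrow> csubspace (A k l m n)"
  using direct_sum by (auto simp: internal_direct_sum_def)

lemma homog_0: "\<lbrakk>k \<in> I; l \<in> I; m \<in> I; n \<in> I\<rbrakk> \<Longrightarrow> homog k l m n 0"
  by (simp add: homog_def complex_vector.subspace_0[OF subspace_A])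

lemma homog_mult_0: "homog k l m n a \<Longrightarrow> homog l' p n' q b \<Longrightarrow> l \<noteq> l' \<or> n \<noteq> n' \<Longrightarrow> a * b = 0"
  unfolding homog_def using mult_noncomposable by (metis prod.inject)

lemma homog_mult:
  assumes a: "homog k l m n a" and b: "homog l' p n' q b"
  shows "homog k p m q (a * b)"
proof (cases "l = l' \<and> n = n'")
  case True
  then show ?thesis using a b mult_closed unfolding homog_def by blast
next
  case False
  then have "a * b = 0" using homog_mult_0[OF a b] by blast
  then show ?thesis using a b by (simp add: homog_0 homog_def[of _ _ _ _ a] homog_def[of _ _ _ _ b])
qed

lemma homog_unit: "k \<in> I \<Longrightarrow> m \<in> I \<Longrightarrow> homog k k m m (u k m)"
  by (simp add: homog_def unit_closed)

lemma unit_times_homog: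
  "\<lbrakk>homog k l m n a; k' \<in> I; m' \<in> I\<rbrakk> \<Longrightarrow> u k' m' * a = (if k' = k \<and> m' = m then a else 0)"
  using homog_mult_0[OF homog_unit, of k' m' k l m n a] by (auto simp: homog_def unit_left)

lemma homog_times_unit:
  "\<lbrakk>homog k l m n a; l' \<in> I; n' \<in> I\<rbrakk> \<Longrightarrow> a * u l' n' = (if l' = l \<and> n' = n then a else 0)"
  using homog_mult_0[OF _ homog_unit, of k l m n a l' n'] by (auto simp: homog_def unit_right)

lemma subspace_homogI:
  assumes "csubspace V" "\<And>k l m n a. homog k l m n a \<Longrightarrow> a \<in> V"
  shows "a \<in> V"
proof -
  have "(\<Union>j\<in>I \<times> I \<times> I \<times> I. case j of (k, l, m, n) \<Rightarrow> A k l m n) \<subseteq> V"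
    using assms(2) by (force simp: homog_def)
  then have "cspan (\<Union>j\<in>I \<times> I \<times> I \<times> I. case j of (k, l, m, n) \<Rightarrow> A k l m n) \<subseteq> V"
    using assms(1) by (rule complex_vector.span_minimal)
  moreover have "cspan (\<Union>j\<in>I \<times> I \<times> I \<times> I. case j of (k, l, m, n) \<Rightarrow> A k l m n) = UNIV"
    using direct_sum by (simp add: internal_direct_sum_def)
  ultimately show ?thesis by blast
qed

lemma homog_eqI:
  assumes "clinear F" "clinear G" "\<And>k l m n a. homog k l m n a \<Longrightarrow> F a = G a"
  shows "F a = G a"
proof -
  have "csubspace {a. F a = G a}"
    using assms(1,2) by (intro complex_vector.subspaceI) (simp_all add: clinear_0 clinear_add clinear_scale)
  from subspace_homogI[OF this, of a] assms(3) show ?thesis by blast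
qed

lemma homog_tensor_eqI:
  assumes "clinear F" "clinear G"
    "\<And>k l m n k' l' m' n' a b. homog k l m n a \<Longrightarrow> homog k' l' m' n' b \<Longrightarrow> F (a \<otimes> b) = G (a \<otimes> b)"
  shows "F z = G z"
proof (rule clinear_tensor_eqI[OF assms(1,2)])
  fix a b
  have lin: "clinear (\<lambda>a. F (a \<otimes> b))" "clinear (\<lambda>a. G (a \<otimes> b))"
    "clinear (\<lambda>b. F (a \<otimes> b))" "clinear (\<lambda>b. G (a \<otimes> b))" for a b
    by (intro clinear_compose[OF _ assms(1)] clinear_compose[OF _ assms(2)] clin)+
  have "F (a \<otimes> b) = G (a \<otimes> b)" if "homog k l m n a" for k l m n a
    by (rule homog_eqI[OF lin(3,4)]) (rule assms(3)[OF that])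
  then show "F (a \<otimes> b) = G (a \<otimes> b)"
    by (rule homog_eqI[OF lin(1,2)])
qed

lemma homog_tensor3_eqI:
  assumes "clinear F" "clinear G"
    "\<And>k l m n k' l' m' n' k'' l'' m'' n'' a b c. homog k l m n a \<Longrightarrow> homog k' l' m' n' b \<Longrightarrow>
      homog k'' l'' m'' n'' c \<Longrightarrow> F (a \<otimes> b \<otimes> c) = G (a \<otimes> b \<otimes> c)"
  shows "F z = G z"
proof (rule clinear_tensor_eqI[OF assms(1,2)])
  fix y c
  have lin: "clinear (\<lambda>a. F (a \<otimes> b))" "clinear (\<lambda>a. G (a \<otimes> b))"
    "clinear (\<lambda>b. F (a \<otimes> b))" "clinear (\<lambda>b. G (a \<otimes> b))" for a b
    by (intro clinear_compose[OF _ assms(1)] clinear_compose[OF _ assms(2)] clin)+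
  have "F (y \<otimes> c) = G (y \<otimes> c)" if "homog k l m n c" for k l m n c
    by (rule homog_tensor_eqI[OF lin(1,2)]) (rule assms(3)[OF _ _ that])
  then show "F (y \<otimes> c) = G (y \<otimes> c)"
    by (rule homog_eqI[OF lin(3,4)])
qed

lemma finite_support_homog:
  assumes "\<And>j. j \<in> J \<Longrightarrow> clinear (f j)" "\<And>k l m n a. homog k l m n a \<Longrightarrow> finite {j \<in> J. f j a \<noteq> 0}"
  shows "finite {j \<in> J. f j a \<noteq> 0}"
  using subspace_homogI[OF subspace_finite_support[of J f], OF assms(1), of a] assms(2) by blast

lemma finite_support_homog_tensor:
  assumes lin: "\<And>j. j \<in> J \<Longrightarrow> clinear (f j)"
    and fin: "\<And>k l m n k' l' m' n' a b. homog k l m n a \<Longrightarrow> homog k' l' m' n' b \<Longrightarrow> finite {j \<in> J. f j (a \<otimes> b) \<noteq> 0}"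
  shows "finite {j \<in> J. f j z \<noteq> 0}"
proof (rule finite_support_tensor[OF lin])
  fix a b
  have lin': "clinear (\<lambda>b. f j (a \<otimes> b))" "clinear (\<lambda>a. f j (a \<otimes> b))" if "j \<in> J" for j a b
    by (intro clinear_compose[OF _ lin[OF that]] clin)+
  have fin': "finite {j \<in> J. f j (a \<otimes> b) \<noteq> 0}" if "homog k l m n a" for k l m n a
    by (rule finite_support_homog[OF lin'(1)], assumption, rule fin[OF that])
  show "finite {j \<in> J. f j (a \<otimes> b) \<noteq> 0}"
    by (rule finite_support_homog[where f = "\<lambda>j a. f j (a \<otimes> b)"], erule lin'(2), erule fin')
qed

lemma finite_support_unit_row:
  assumes "k \<in> I"
  shows "finite {l \<in> I. \<iota> (u k l) \<rhd> a \<noteq> 0}" "finite {l \<in> I. a \<lhd> \<iota> (u k l) \<noteq> 0}"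
    "finite {l \<in> I. \<iota> (u l k) \<rhd> a \<noteq> 0}" "finite {l \<in> I. a \<lhd> \<iota> (u l k) \<noteq> 0}"
proof -
  have "{l \<in> I. u k l * a \<noteq> 0} \<subseteq> {m'}" "{l \<in> I. a * u k l \<noteq> 0} \<subseteq> {n'}"
    "{l \<in> I. u l k * a \<noteq> 0} \<subseteq> {k'}" "{l \<in> I. a * u l k \<noteq> 0} \<subseteq> {l'}" if "homog k' l' m' n' a" for k' l' m' n' a
    using assms by (auto simp: unit_times_homog[OF that] homog_times_unit[OF that] split: if_splits)
  note * = this[THEN finite_subset, OF _ finite.insertI[OF finite.emptyI]]
  show "finite {l \<in> I. \<iota> (u k l) \<rhd> a \<noteq> 0}" unfolding mult_of_act
    by (rule finite_support_homog[where a = a], intro clin, rule *(1))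
  show "finite {l \<in> I. a \<lhd> \<iota> (u k l) \<noteq> 0}" unfolding mult_of_act
    by (rule finite_support_homog[where a = a], intro clin, rule *(2))
  show "finite {l \<in> I. \<iota> (u l k) \<rhd> a \<noteq> 0}" unfolding mult_of_act
    by (rule finite_support_homog[where a = a], intro clin, rule *(3))
  show "finite {l \<in> I. a \<lhd> \<iota> (u l k) \<noteq> 0}" unfolding mult_of_act
    by (rule finite_support_homog[where a = a], intro clin, rule *(4))
qed

lemma
  assumes "p \<in> I"
  shows lam_act: "lam p \<rhd> a = supp_sum (\<lambda>l. u p l * a) I" "a \<lhd> lam p = supp_sum (\<lambda>l. a * u p l) I"
    and rho_act: "rho p \<rhd> a = supp_sum (\<lambda>k. u k p * a) I" "a \<lhd> rho p = supp_sum (\<lambda>k. a * u k p) I"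
proof -
  have "has_strict_sum (\<lambda>l. \<iota> (u p l)) I (lam p)" "has_strict_sum (\<lambda>k. \<iota> (u k p)) I (rho p)"
    unfolding lambda_mult_def rho_mult_def
    by (intro has_strict_sum_strict_sum finite_support_unit_row assms)+
  then show "lam p \<rhd> a = supp_sum (\<lambda>l. u p l * a) I" "a \<lhd> lam p = supp_sum (\<lambda>l. a * u p l) I"
    "rho p \<rhd> a = supp_sum (\<lambda>k. u k p * a) I" "a \<lhd> rho p = supp_sum (\<lambda>k. a * u k p) I"
    by (simp_all add: has_strict_sum_def mult_of_act)
qed

lemma lam_rho_homog:
  assumes a: "homog k l m n a" and p: "p \<in> I"
  shows "lam p \<rhd> a = (if p = k then a else 0)" "a \<lhd> lam p = (if p = l then a else 0)"
    "rho p \<rhd> a = (if p = m then a else 0)" "a \<lhd> rho p = (if p = n then a else 0)"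
proof -
  note I = homog_index[OF a] and act = lam_act[OF p] rho_act[OF p]
  note [simp] = unit_times_homog[OF a] homog_times_unit[OF a] p
  show "lam p \<rhd> a = (if p = k then a else 0)" unfolding act
    by (subst supp_sum_single[where i = m]) (use I in simp_all)
  show "a \<lhd> lam p = (if p = l then a else 0)" unfolding act
    by (subst supp_sum_single[where i = n]) (use I in simp_all)
  show "rho p \<rhd> a = (if p = m then a else 0)" unfolding act
    by (subst supp_sum_single[where i = k]) (use I in simp_all)
  show "a \<lhd> rho p = (if p = n then a else 0)" unfolding act
    by (subst supp_sum_single[where i = l]) (use I in simp_all)
qed

lemma finite_support_lam_rho:
  "finite {p \<in> I. lam p \<rhd> a \<noteq> 0}" "finite {p \<in> I. a \<lhd> lam p \<noteq> 0}"
  "finite {p \<in> I. rho p \<rhd> a \<noteq> 0}" "finite {p \<in> I. a \<lhd> rho p \<noteq> 0}"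
proof -
  have "{p \<in> I. lam p \<rhd> a \<noteq> 0} \<subseteq> {k}" "{p \<in> I. a \<lhd> lam p \<noteq> 0} \<subseteq> {l}"
    "{p \<in> I. rho p \<rhd> a \<noteq> 0} \<subseteq> {m}" "{p \<in> I. a \<lhd> rho p \<noteq> 0} \<subseteq> {n}" if "homog k l m n a" for k l m n a
    by (auto simp: lam_rho_homog[OF that] split: if_splits)
  note * = this[THEN finite_subset, OF _ finite.insertI[OF finite.emptyI]]
  show "finite {p \<in> I. lam p \<rhd> a \<noteq> 0}"
    by (rule finite_support_homog[where a = a], intro clin, rule *(1))
  show "finite {p \<in> I. a \<lhd> lam p \<noteq> 0}"
    by (rule finite_support_homog[where a = a], intro clin, rule *(2))
  show "finite {p \<in> I. rho p \<rhd> a \<noteq> 0}"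
    by (rule finite_support_homog[where a = a], intro clin, rule *(3))
  show "finite {p \<in> I. a \<lhd> rho p \<noteq> 0}"
    by (rule finite_support_homog[where a = a], intro clin, rule *(4))
qed

section \<open>Local units of the total algebra\<close>

text \<open>These finite sums form a net of two-sided local units.\<close>

definition unit_sum :: "'i set \<Rightarrow> 'a" where
  "unit_sum F = (\<Sum>(k, m)\<in>F \<times> F. u k m)"

lemma eventually_unit_sum:
  "\<forall>\<^sub>F F in finite_subsets_at_top I. unit_sum F * a = a \<and> a * unit_sum F = a"
proof (rule subspace_homogI[where a = a and V = "{a. \<forall>\<^sub>F F in finite_subsets_at_top I. unit_sum F * a = a \<and> a * unit_sum F = a}",
      unfolded mem_Collect_eq])
  show "csubspace {a. \<forall>\<^sub>F F in finite_subsets_at_top I. unit_sum F * a = a \<and> a * unit_sum F = a}"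
    by (rule complex_vector.subspaceI)
      (auto simp: distrib_left distrib_right mult_scaleC_left mult_scaleC_right elim: eventually_elim2 eventually_mono)
next
  fix k l m n a assume a: "homog k l m n a"
  note I = homog_index[OF a]
  have "unit_sum F * a = a \<and> a * unit_sum F = a" if F: "finite F" "{k, l, m, n} \<subseteq> F" "F \<subseteq> I" for F
  proof -
    have I': "x \<in> I" if "x \<in> F" for x using that F by blast
    note [simp] = unit_times_homog[OF a I' I'] homog_times_unit[OF a I' I']
    have "unit_sum F * a = (\<Sum>x\<in>F \<times> F. if x = (k, m) then a else 0)"
      unfolding unit_sum_def sum_distrib_right
      by (rule sum.cong) (auto split: if_splits)
    moreover have "a * unit_sum F = (\<Sum>x\<in>F \<times> F. if x = (l, n) then a else 0)"
      unfolding unit_sum_def sum_distrib_left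
      by (rule sum.cong) (auto split: if_splits)
    ultimately show ?thesis using F by (auto simp: sum.delta)
  qed
  then show "\<forall>\<^sub>F F in finite_subsets_at_top I. unit_sum F * a = a \<and> a * unit_sum F = a"
    unfolding eventually_finite_subsets_at_top using I
    by (intro exI[of _ "{k, l, m, n}"]) auto
qed

lemma eventually_unit_sum_tensor:
  fixes E :: "'i set \<Rightarrow> 'b::complex_algebra"
  assumes "\<And>b. \<forall>\<^sub>F F in finite_subsets_at_top I. E F * b = b \<and> b * E F = b"
  shows "\<forall>\<^sub>F F in finite_subsets_at_top I. (E F \<otimes> unit_sum F) * z = z \<and> z * (E F \<otimes> unit_sum F) = z"
proof (induction z rule: tensor_induct)
  case (pure c b a)
  from assms[of b] eventually_unit_sum[of a] show ?case
    by eventually_elim (simp add: mult_scaleC_left mult_scaleC_right times_pure)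
next
  case (add x y)
  then show ?case by eventually_elim (simp add: distrib_left distrib_right)
qed

lemma local_units:
  "\<exists>e. a * e = a" "\<exists>e. e * a = a"
  "\<exists>e. z * e = z" "\<exists>e. e * z = z"
  "\<exists>e. w * e = w" "\<exists>e. e * w = w"
  for a :: 'a and z :: "'a \<otimes> 'a" and w :: "'a \<otimes> 'a \<otimes> 'a"
  using eventually_happens[OF eventually_unit_sum[of a]]
    eventually_happens[OF eventually_unit_sum_tensor[OF eventually_unit_sum, of z]]
    eventually_happens[OF eventually_unit_sum_tensor[OF eventually_unit_sum_tensor[OF eventually_unit_sum], of w]]
    finite_subsets_at_top_neq_bot[of I]
  by blast+

lemmas multiplier_eqI_A = multiplier_eqI_left[OF local_units(1)]
lemmas multiplier_eqI_A2 = multiplier_eqI_left[OF local_units(3)]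
lemmas multiplier_eqI_A3 = multiplier_eqI_left[OF local_units(5)]
lemmas inj_mult_of_A2 = inj_mult_of[OF local_units(3)]
lemmas inj_mult_of_A3 = inj_mult_of[OF local_units(5)]

lemma homog_multiplier_tensor_eqI:
  assumes "\<And>k l m n k' l' m' n' a b. homog k l m n a \<Longrightarrow> homog k' l' m' n' b \<Longrightarrow> M \<rhd> (a \<otimes> b) = N \<rhd> (a \<otimes> b)"
  shows "M = N"
  by (rule multiplier_eqI_A2, rule homog_tensor_eqI) (intro clin | rule assms | assumption)+

lemma homog_multiplier_tensor3_eqI:
  assumes "\<And>k l m n k' l' m' n' k'' l'' m'' n'' a b c. homog k l m n a \<Longrightarrow> homog k' l' m' n' b \<Longrightarrow>
    homog k'' l'' m'' n'' c \<Longrightarrow> M \<rhd> (a \<otimes> b \<otimes> c) = N \<rhd> (a \<otimes> b \<otimes> c)"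
  shows "M = N"
  by (rule multiplier_eqI_A3, rule homog_tensor3_eqI) (intro clin | rule assms | assumption)+

section \<open>Rows and columns of the comultiplication\<close>

lemma clinear_comult: "r \<in> I \<Longrightarrow> s \<in> I \<Longrightarrow> clinear f \<Longrightarrow> clinear (\<lambda>x. \<Delta> r s (f x))"
  by (rule clinear_compose[OF _ comult_linear])

lemma clinear_counit: "clinear f \<Longrightarrow> clinear (\<lambda>x. \<epsilon> (f x))"
  by (rule clinear_compose[OF _ counit_linear])

lemmas [clin] = clinear_comult clinear_counit

text \<open>
  The legs of \<open>\<Delta> r s a\<close> are homogeneous with known degrees, so only those degrees matter for a Sweedler
  sum.
\<close>

lemma comult_cong:
  assumes "homog k l m n a" "r \<in> I" "s \<in> I" "cbilinear B" "cbilinear B'"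
    and "\<And>x y. homog k l r s x \<Longrightarrow> homog r s m n y \<Longrightarrow> B x y = B' x y"
  shows "tlift B (\<Delta> r s a) = tlift B' (\<Delta> r s a)"
proof (rule tlift_cong_subspace)
  show "\<Delta> r s a \<in> tensor_subspace (A k l r s) (A r s m n)"
    using assms by (auto simp: homog_def intro: comult_closed)
qed (use assms in \<open>auto simp: homog_def\<close>)

lemma finite_comult:
  shows finite_comult_col: "s \<in> I \<Longrightarrow> finite {r \<in> I. \<Delta> r s a \<noteq> 0}"
    and finite_comult_row: "r \<in> I \<Longrightarrow> finite {s \<in> I. \<Delta> r s a \<noteq> 0}"
  by (rule finite_support_homog[where a = a]; use comult_rcf in \<open>auto simp: homog_def rcf_def comult_linear\<close>)+

text \<open>
  Rows and columns of \<open>\<Delta>\<close> are finite. For the total comultiplication \<open>D\<close> they are the elements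
  \<open>D a * (1 \<otimes> \<lambda>\<^sub>s)\<close> and \<open>(1 \<otimes> \<lambda>\<^sub>r) * D a\<close> of the tensor square, and they stand in for the multiplier
  \<open>D a\<close> in all computations: multiplication by a homogeneous element selects one of them.
\<close>

definition comult_col :: "'i \<Rightarrow> 'a \<Rightarrow> 'a \<otimes> 'a" where
  "comult_col s a = supp_sum (\<lambda>r. \<Delta> r s a) I"

definition comult_row :: "'i \<Rightarrow> 'a \<Rightarrow> 'a \<otimes> 'a" where
  "comult_row r a = supp_sum (\<lambda>s. \<Delta> r s a) I"

lemma clinear_comult_col: "s \<in> I \<Longrightarrow> clinear f \<Longrightarrow> clinear (\<lambda>x. comult_col s (f x))"
  and clinear_comult_row: "r \<in> I \<Longrightarrow> clinear f \<Longrightarrow> clinear (\<lambda>x. comult_row r (f x))"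
  unfolding comult_col_def comult_row_def
  by (intro clinear_supp_sum clinear_comult finite_comult; assumption)+

lemmas [clin] = clinear_comult_col clinear_comult_row

lemma linear_comult_col: "s \<in> I \<Longrightarrow> clinear F \<Longrightarrow> F (comult_col s a) = supp_sum (\<lambda>r. F (\<Delta> r s a)) I"
  and linear_comult_row: "r \<in> I \<Longrightarrow> clinear F \<Longrightarrow> F (comult_row r a) = supp_sum (\<lambda>s. F (\<Delta> r s a)) I"
  unfolding comult_col_def comult_row_def by (intro supp_sum_linear finite_comult; assumption)+

lemma comult_col_cong:
  assumes "homog k l m n a" "s \<in> I" "cbilinear B" "cbilinear B'"
    and "\<And>r x y. homog k l r s x \<Longrightarrow> homog r s m n y \<Longrightarrow> B x y = B' x y"
  shows "tlift B (comult_col s a) = tlift B' (comult_col s a)"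
  unfolding linear_comult_col[OF assms(2) clinear_tlift[OF assms(3)]]
    linear_comult_col[OF assms(2) clinear_tlift[OF assms(4)]]
  by (rule supp_sum_cong, rule comult_cong[OF assms(1)]) (use assms in auto)

lemma comult_row_cong:
  assumes "homog k l m n a" "r \<in> I" "cbilinear B" "cbilinear B'"
    and "\<And>s x y. homog k l r s x \<Longrightarrow> homog r s m n y \<Longrightarrow> B x y = B' x y"
  shows "tlift B (comult_row r a) = tlift B' (comult_row r a)"
  unfolding linear_comult_row[OF assms(2) clinear_tlift[OF assms(3)]]
    linear_comult_row[OF assms(2) clinear_tlift[OF assms(4)]]
  by (rule supp_sum_cong, rule comult_cong[OF assms(1)]) (use assms in auto)

text \<open>
  Coassociativity read through a trilinear map: \<open>\<Sum> B a(11) a(12) a(2) = \<Sum> B a(1) a(21) a(22)\<close>.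
\<close>

lemma coassoc_sweedler:
  assumes I: "p \<in> I" "q \<in> I" "r \<in> I" "s \<in> I"
    and lin: "\<And>y z. clinear (\<lambda>x. B x y z)" "\<And>x z. clinear (\<lambda>y. B x y z)" "\<And>x y. clinear (\<lambda>z. B x y z)"
  shows "tlift (\<lambda>x z. tlift (\<lambda>x1 x2. B x1 x2 z) (\<Delta> p q x)) (\<Delta> r s a)
       = tlift (\<lambda>x y. tlift (\<lambda>y1 y2. B x y1 y2) (\<Delta> r s y)) (\<Delta> p q a)"
proof (rule homog_eqI[where a = a])
  define L where "L = tlift (\<lambda>w z. tlift (\<lambda>x1 x2. B x1 x2 z) w)"
  have bil: "cbilinear (\<lambda>w z. tlift (\<lambda>x1 x2. B x1 x2 z) w)" by (intro clin lin)
  have L_lin: "clinear L" unfolding L_def by (rule clinear_tlift[OF bil])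
  have L_pure: "L (w \<otimes> z) = tlift (\<lambda>x1 x2. B x1 x2 z) w" for w z
    unfolding L_def by (rule tlift_pure[OF bil])
  have L_assoc: "L (tassoc (x \<otimes> w)) = tlift (\<lambda>y1 y2. B x y1 y2) w" for x w
  proof (rule clinear_tensor_eqI[where x = w])
    show "L (tassoc (x \<otimes> (b \<otimes> c))) = tlift (B x) (b \<otimes> c)" for b c
      by (simp add: tassoc_pure L_pure tlift_pure cbilinearI lin)
  qed (intro clin lin clinear_compose[OF _ L_lin])+
  fix k l m n a assume "homog k l m n a"
  then have "L (tmap (\<Delta> p q) (\<lambda>x. x) (\<Delta> r s a)) = L (tassoc (tmap (\<lambda>x. x) (\<Delta> r s) (\<Delta> p q a)))"
    using coassoc[of k l m n p q r s a] I by (simp add: homog_def)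
  moreover have "L (tmap (\<Delta> p q) (\<lambda>x. x) (\<Delta> r s a))
      = tlift (\<lambda>x z. tlift (\<lambda>x1 x2. B x1 x2 z) (\<Delta> p q x)) (\<Delta> r s a)"
    unfolding tmap_def by (subst tlift_linear[OF L_lin]) (intro clin I, simp add: L_pure)
  moreover have "L (tassoc (tmap (\<lambda>x. x) (\<Delta> r s) (\<Delta> p q a)))
      = tlift (\<lambda>x y. tlift (\<lambda>y1 y2. B x y1 y2) (\<Delta> r s y)) (\<Delta> p q a)"
    unfolding tmap_def
    by (subst tlift_linear[OF clinear_compose[OF clinear_tassoc L_lin]]) (intro clin I, simp add: L_assoc)
  ultimately show "tlift (\<lambda>x z. tlift (\<lambda>x1 x2. B x1 x2 z) (\<Delta> p q x)) (\<Delta> r s a)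
       = tlift (\<lambda>x y. tlift (\<lambda>y1 y2. B x y1 y2) (\<Delta> r s y)) (\<Delta> p q a)" by simp
qed (intro clin I lin)+

text \<open>
  Coassociativity survives summation over the indices of both comultiplications. In each iterated sum
  the inner support depends on the outer term, but the two forms \<open>g\<close> and \<open>h\<close> of a term show that it
  vanishes unless both indices lie in the finite supports belonging to \<open>a\<close> itself; hence the order of
  summation can be changed.
\<close>

lemma coassoc_supp_sum:
  fixes B :: "'a \<Rightarrow> 'a \<Rightarrow> 'a \<Rightarrow> 'b::complex_vector"
  assumes IJ: "\<And>j. j \<in> J \<Longrightarrow> \<alpha> j \<in> I" "\<And>j. j \<in> J \<Longrightarrow> \<beta> j \<in> I" "\<And>j. j \<in> K \<Longrightarrow> \<gamma> j \<in> I" "\<And>j. j \<in> K \<Longrightarrow> \<delta> j \<in> I"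
    and fin: "\<And>a. finite {j \<in> J. \<Delta> (\<alpha> j) (\<beta> j) a \<noteq> 0}" "\<And>a. finite {j \<in> K. \<Delta> (\<gamma> j) (\<delta> j) a \<noteq> 0}"
    and lin: "\<And>y z. clinear (\<lambda>x. B x y z)" "\<And>x z. clinear (\<lambda>y. B x y z)" "\<And>x y. clinear (\<lambda>z. B x y z)"
  defines "\<Delta>1 \<equiv> \<lambda>a. supp_sum (\<lambda>j. \<Delta> (\<alpha> j) (\<beta> j) a) J" and "\<Delta>2 \<equiv> \<lambda>a. supp_sum (\<lambda>j. \<Delta> (\<gamma> j) (\<delta> j) a) K"
  shows "tlift (\<lambda>x z. tlift (\<lambda>x1 x2. B x1 x2 z) (\<Delta>1 x)) (\<Delta>2 a) = tlift (\<lambda>x y. tlift (B x) (\<Delta>2 y)) (\<Delta>1 a)" (is "?L = ?R")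
proof -
  have lin\<Delta>: "clinear (\<lambda>a. \<Delta> (\<alpha> j) (\<beta> j) (f a))" if "j \<in> J" "clinear f" for j f
    using that by (intro clinear_comult IJ)
  have lin\<Delta>': "clinear (\<lambda>a. \<Delta> (\<gamma> j) (\<delta> j) (f a))" if "j \<in> K" "clinear f" for j f
    using that by (intro clinear_comult IJ)
  have lin1: "clinear \<Delta>1" and lin2: "clinear \<Delta>2"
    unfolding \<Delta>1_def \<Delta>2_def by (intro clinear_supp_sum lin\<Delta> lin\<Delta>' fin clinear_id; assumption)+
  have sum1: "F (\<Delta>1 a) = supp_sum (\<lambda>j. F (\<Delta> (\<alpha> j) (\<beta> j) a)) J"
    and sum2: "F (\<Delta>2 a) = supp_sum (\<lambda>j. F (\<Delta> (\<gamma> j) (\<delta> j) a)) K" if "clinear F" for F :: "'a \<otimes> 'a \<Rightarrow> 'b" and a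
    unfolding \<Delta>1_def \<Delta>2_def by (intro supp_sum_linear that fin)+
  define g where "g p s = tlift (\<lambda>x z. tlift (\<lambda>x1 x2. B x1 x2 z) (\<Delta> (\<alpha> p) (\<beta> p) x)) (\<Delta> (\<gamma> s) (\<delta> s) a)" for p s
  define h where "h p s = tlift (\<lambda>x y. tlift (B x) (\<Delta> (\<gamma> s) (\<delta> s) y)) (\<Delta> (\<alpha> p) (\<beta> p) a)" for p s
  have gh: "g p s = h p s" if "p \<in> J" "s \<in> K" for p s
    unfolding g_def h_def by (rule coassoc_sweedler) (use that IJ lin in auto)
  have b1: "cbilinear (\<lambda>x z. tlift (\<lambda>x1 x2. B x1 x2 z) (\<Delta>1 x))" and b2: "cbilinear (\<lambda>x y. tlift (B x) (\<Delta>2 y))"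
    and b3: "p \<in> J \<Longrightarrow> cbilinear (\<lambda>x z. tlift (\<lambda>x1 x2. B x1 x2 z) (\<Delta> (\<alpha> p) (\<beta> p) x))"
    and b4: "s \<in> K \<Longrightarrow> cbilinear (\<lambda>x y. tlift (B x) (\<Delta> (\<gamma> s) (\<delta> s) y))"
    and b5: "cbilinear (\<lambda>x1 x2. B x1 x2 z)" and b6: "cbilinear (B x)" for p s x z
    by (intro clin lin lin\<Delta> lin\<Delta>' clinear_compose[OF _ lin1] clinear_compose[OF _ lin2]; assumption)+
  have fin1: "finite {p \<in> J. tlift (\<lambda>x1 x2. B x1 x2 z) (\<Delta> (\<alpha> p) (\<beta> p) x) \<noteq> 0}" for x z
    by (rule finite_subset[OF _ fin(1)[of x]]) (auto simp: clinear_0[OF clinear_tlift[OF b5]])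
  have fin2: "finite {s \<in> K. tlift (B x) (\<Delta> (\<gamma> s) (\<delta> s) y) \<noteq> 0}" for x y
    by (rule finite_subset[OF _ fin(2)[of y]]) (auto simp: clinear_0[OF clinear_tlift[OF b6]])
  have 1: "?L = supp_sum (\<lambda>s. supp_sum (\<lambda>p. g p s) J) K"
    unfolding sum2[OF clinear_tlift[OF b1]]
  proof (rule supp_sum_cong)
    show "tlift (\<lambda>x z. tlift (\<lambda>x1 x2. B x1 x2 z) (\<Delta>1 x)) (\<Delta> (\<gamma> s) (\<delta> s) a) = supp_sum (\<lambda>p. g p s) J" for s
      unfolding g_def sum1[OF clinear_tlift[OF b5]] by (rule tlift_supp_sum(2)[OF b3 fin1])
  qed
  have 2: "?R = supp_sum (\<lambda>p. supp_sum (\<lambda>s. h p s) K) J"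
    unfolding sum1[OF clinear_tlift[OF b2]]
  proof (rule supp_sum_cong)
    show "tlift (\<lambda>x y. tlift (B x) (\<Delta>2 y)) (\<Delta> (\<alpha> p) (\<beta> p) a) = supp_sum (\<lambda>s. h p s) K" for p
      unfolding h_def sum2[OF clinear_tlift[OF b6]] by (rule tlift_supp_sum(2)[OF b4 fin2])
  qed
  have "supp_sum (\<lambda>s. supp_sum (\<lambda>p. g p s) J) K = supp_sum (\<lambda>p. supp_sum (\<lambda>s. g p s) K) J"
  proof (rule supp_sum_swap[OF fin(2)[of a] fin(1)[of a]])
    fix s p assume "s \<in> K" "p \<in> J" "g p s \<noteq> 0"
    moreover from this have "h p s \<noteq> 0" by (simp add: gh)
    ultimately show "s \<in> {s \<in> K. \<Delta> (\<gamma> s) (\<delta> s) a \<noteq> 0} \<and> p \<in> {p \<in> J. \<Delta> (\<alpha> p) (\<beta> p) a \<noteq> 0}"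
      by (auto simp: g_def h_def clinear_0[OF clinear_tlift[OF b3]] clinear_0[OF clinear_tlift[OF b4]])
  qed
  also have "\<dots> = supp_sum (\<lambda>p. supp_sum (\<lambda>s. h p s) K) J"
    by (intro supp_sum_cong gh)
  finally show ?thesis unfolding 1 2 .
qed

lemma coassoc_col_row:
  assumes "q \<in> I" "r \<in> I"
    and "\<And>y z. clinear (\<lambda>x. B x y z)" "\<And>x z. clinear (\<lambda>y. B x y z)" "\<And>x y. clinear (\<lambda>z. B x y z)"
  shows "tlift (\<lambda>x z. tlift (\<lambda>x1 x2. B x1 x2 z) (comult_col q x)) (comult_row r a)
       = tlift (\<lambda>x y. tlift (\<lambda>y1 y2. B x y1 y2) (comult_row r y)) (comult_col q a)"
  unfolding comult_row_def comult_col_def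
  by (rule coassoc_supp_sum[where \<alpha> = "\<lambda>j. j" and \<beta> = "\<lambda>_. q" and \<gamma> = "\<lambda>_. r" and \<delta> = "\<lambda>j. j"])
    (assumption | rule assms finite_comult)+

lemma coassoc_row_col:
  assumes "p \<in> I" "s \<in> I"
    and "\<And>y z. clinear (\<lambda>x. B x y z)" "\<And>x z. clinear (\<lambda>y. B x y z)" "\<And>x y. clinear (\<lambda>z. B x y z)"
  shows "tlift (\<lambda>x z. tlift (\<lambda>x1 x2. B x1 x2 z) (comult_row p x)) (comult_col s a)
       = tlift (\<lambda>x y. tlift (\<lambda>y1 y2. B x y1 y2) (comult_col s y)) (comult_row p a)"
  unfolding comult_row_def comult_col_def
  by (rule coassoc_supp_sum[where \<alpha> = "\<lambda>_. p" and \<beta> = "\<lambda>j. j" and \<gamma> = "\<lambda>j. j" and \<delta> = "\<lambda>_. s"])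
    (assumption | rule assms finite_comult)+

lemma homog_counit_0: "homog k l m n a \<Longrightarrow> k \<noteq> m \<or> l \<noteq> n \<Longrightarrow> \<epsilon> a = 0"
  using counit_zero by (auto simp: homog_def)

text \<open>
  The counit kills a leg whose upper and lower indices differ. This leaves one pair \<open>(r, s)\<close>, for which
  the counit axiom applies.
\<close>

lemma counit_comult:
  assumes a: "homog k l m n a" and I: "r \<in> I" "s \<in> I" and F: "clinear F"
  shows "tlift (\<lambda>x y. \<epsilon> x *\<^sub>C F y) (\<Delta> r s a) = (if r = k \<and> s = l then F a else 0)"
    and "tlift (\<lambda>x y. \<epsilon> y *\<^sub>C F x) (\<Delta> r s a) = (if r = m \<and> s = n then F a else 0)"
proof -
  have b: "cbilinear (\<lambda>x y. \<epsilon> x *\<^sub>C F y)" "cbilinear (\<lambda>x y. \<epsilon> y *\<^sub>C F x)"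
    "cbilinear (\<lambda>x y. \<epsilon> x *\<^sub>C (y::'a))" "cbilinear (\<lambda>x y. \<epsilon> y *\<^sub>C (x::'a))" "cbilinear (\<lambda>(x::'a) (y::'a). 0::'b)"
    by (intro clin F clinear_compose[OF _ F])+
  have "tlift (\<lambda>x y. \<epsilon> x *\<^sub>C F y) z = F (tlift (\<lambda>x y. \<epsilon> x *\<^sub>C y) z)"
    "tlift (\<lambda>x y. \<epsilon> y *\<^sub>C F x) z = F (tlift (\<lambda>x y. \<epsilon> y *\<^sub>C x) z)" for z
    by (simp_all add: tlift_linear[OF F] b clinear_scale[OF F])
  then have "tlift (\<lambda>x y. \<epsilon> x *\<^sub>C F y) (\<Delta> k l a) = F a" "tlift (\<lambda>x y. \<epsilon> y *\<^sub>C F x) (\<Delta> m n a) = F a"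
    using a counit_left[of k l m n a] counit_right[of k l m n a] by (simp_all add: homog_def)
  moreover have "tlift (\<lambda>x y. \<epsilon> x *\<^sub>C F y) (\<Delta> r s a) = 0" if "\<not> (r = k \<and> s = l)"
    using comult_cong[OF a I b(1) b(5)] that homog_counit_0 by (force simp: tlift_zero)
  moreover have "tlift (\<lambda>x y. \<epsilon> y *\<^sub>C F x) (\<Delta> r s a) = 0" if "\<not> (r = m \<and> s = n)"
    using comult_cong[OF a I b(2) b(5)] that homog_counit_0 by (force simp: tlift_zero)
  ultimately show "tlift (\<lambda>x y. \<epsilon> x *\<^sub>C F y) (\<Delta> r s a) = (if r = k \<and> s = l then F a else 0)"
    "tlift (\<lambda>x y. \<epsilon> y *\<^sub>C F x) (\<Delta> r s a) = (if r = m \<and> s = n then F a else 0)" by auto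
qed

lemma counit_comult_row:
  assumes a: "homog k l m n a" and r: "r \<in> I" and F: "clinear F"
  shows "tlift (\<lambda>x y. \<epsilon> x *\<^sub>C F y) (comult_row r a) = (if r = k then F a else 0)"
    and "tlift (\<lambda>x y. \<epsilon> y *\<^sub>C F x) (comult_row r a) = (if r = m then F a else 0)"
proof -
  have b: "cbilinear (\<lambda>x y. \<epsilon> x *\<^sub>C F y)" "cbilinear (\<lambda>x y. \<epsilon> y *\<^sub>C F x)"
    by (intro clin F clinear_compose[OF _ F])+
  show "tlift (\<lambda>x y. \<epsilon> x *\<^sub>C F y) (comult_row r a) = (if r = k then F a else 0)"
    unfolding linear_comult_row[OF r clinear_tlift[OF b(1)]]
    by (subst supp_sum_single[where i = l]) (use homog_index[OF a] in \<open>auto simp: counit_comult[OF a r _ F]\<close>)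
  show "tlift (\<lambda>x y. \<epsilon> y *\<^sub>C F x) (comult_row r a) = (if r = m then F a else 0)"
    unfolding linear_comult_row[OF r clinear_tlift[OF b(2)]]
    by (subst supp_sum_single[where i = n]) (use homog_index[OF a] in \<open>auto simp: counit_comult[OF a r _ F]\<close>)
qed

lemma counit_comult_col:
  assumes a: "homog k l m n a" and s: "s \<in> I" and F: "clinear F"
  shows "tlift (\<lambda>x y. \<epsilon> x *\<^sub>C F y) (comult_col s a) = (if s = l then F a else 0)"
    and "tlift (\<lambda>x y. \<epsilon> y *\<^sub>C F x) (comult_col s a) = (if s = n then F a else 0)"
proof -
  have b: "cbilinear (\<lambda>x y. \<epsilon> x *\<^sub>C F y)" "cbilinear (\<lambda>x y. \<epsilon> y *\<^sub>C F x)"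
    by (intro clin F clinear_compose[OF _ F])+
  show "tlift (\<lambda>x y. \<epsilon> x *\<^sub>C F y) (comult_col s a) = (if s = l then F a else 0)"
    unfolding linear_comult_col[OF s clinear_tlift[OF b(1)]]
    by (subst supp_sum_single[where i = k]) (use homog_index[OF a] in \<open>auto simp: counit_comult[OF a _ s F]\<close>)
  show "tlift (\<lambda>x y. \<epsilon> y *\<^sub>C F x) (comult_col s a) = (if s = n then F a else 0)"
    unfolding linear_comult_col[OF s clinear_tlift[OF b(2)]]
    by (subst supp_sum_single[where i = m]) (use homog_index[OF a] in \<open>auto simp: counit_comult[OF a _ s F]\<close>)
qed

section \<open>The total comultiplication\<close>

lemma tlift_act: "tlift (\<lambda>x y. (m \<rhd> x) \<otimes> (n \<rhd> y)) z = (m \<otimes>\<^sub>M n) \<rhd> z"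
    "tlift (\<lambda>x y. (x \<lhd> m) \<otimes> (y \<lhd> n)) z = z \<lhd> (m \<otimes>\<^sub>M n)"
  by (simp_all add: mtensor_act tmap_def)

lemma comult_act:
  assumes I: "r \<in> I" "s \<in> I" "t \<in> I"
  shows "(1 \<otimes>\<^sub>M lam t) \<rhd> \<Delta> r s a = (if t = r then \<Delta> r s a else 0)"
    "(rho t \<otimes>\<^sub>M 1) \<rhd> \<Delta> r s a = (if t = r then \<Delta> r s a else 0)"
    "\<Delta> r s a \<lhd> (1 \<otimes>\<^sub>M lam t) = (if t = s then \<Delta> r s a else 0)"
    "\<Delta> r s a \<lhd> (rho t \<otimes>\<^sub>M 1) = (if t = s then \<Delta> r s a else 0)"
proof -
  have b: "cbilinear (\<lambda>x y. ((m::'a multiplier) \<rhd> x) \<otimes> ((n::'a multiplier) \<rhd> y))"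
    "cbilinear (\<lambda>x y. (x \<lhd> (m::'a multiplier)) \<otimes> (y \<lhd> (n::'a multiplier)))"
    for m n
    by (intro clin)+
  have b': "cbilinear (\<lambda>(x::'a) (y::'a). if c then x \<otimes> y else 0)" for c
    by (cases c) (simp add: cbilinear_pure_tensor, simp, intro clin)
  have if_out: "tlift (\<lambda>x y. if c then x \<otimes> y else 0) z = (if c then z else 0)" for c and z :: "'a \<otimes> 'a"
    by (simp add: tlift_zero tlift_pure_tensor)
  note lin = clinear_comult[OF I(1,2) clinear_id]
  have left: "(m \<otimes>\<^sub>M n) \<rhd> \<Delta> r s a = (if c then \<Delta> r s a else 0)"
    if "\<And>k l p q x y. homog k l r s x \<Longrightarrow> homog r s p q y \<Longrightarrow> (m \<rhd> x) \<otimes> (n \<rhd> y) = (if c then x \<otimes> y else 0)" for m n c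
  proof -
    have "tlift (\<lambda>x y. (m \<rhd> x) \<otimes> (n \<rhd> y)) (\<Delta> r s a) = tlift (\<lambda>x y. if c then x \<otimes> y else 0) (\<Delta> r s a)"
      by (rule homog_eqI[where a = a], (intro clinear_tlift_comp b b' lin)+, rule comult_cong[OF _ I(1,2) b(1) b'], assumption, rule that)
    then show ?thesis by (simp only: tlift_act if_out)
  qed
  have right: "\<Delta> r s a \<lhd> (m \<otimes>\<^sub>M n) = (if c then \<Delta> r s a else 0)"
    if "\<And>k l p q x y. homog k l r s x \<Longrightarrow> homog r s p q y \<Longrightarrow> (x \<lhd> m) \<otimes> (y \<lhd> n) = (if c then x \<otimes> y else 0)" for m n c
  proof -
    have "tlift (\<lambda>x y. (x \<lhd> m) \<otimes> (y \<lhd> n)) (\<Delta> r s a) = tlift (\<lambda>x y. if c then x \<otimes> y else 0) (\<Delta> r s a)"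
      by (rule homog_eqI[where a = a], (intro clinear_tlift_comp b b' lin)+, rule comult_cong[OF _ I(1,2) b(2) b'], assumption, rule that)
    then show ?thesis by (simp only: tlift_act if_out)
  qed
  note [simp] = multiplier_act lam_rho_homog I clinear_0[OF clinear_pure_tensor(1)[OF clinear_id]]
    clinear_0[OF clinear_pure_tensor(2)[OF clinear_id]]
  show "(1 \<otimes>\<^sub>M lam t) \<rhd> \<Delta> r s a = (if t = r then \<Delta> r s a else 0)" by (rule left) simp
  show "(rho t \<otimes>\<^sub>M 1) \<rhd> \<Delta> r s a = (if t = r then \<Delta> r s a else 0)" by (rule left) simp
  show "\<Delta> r s a \<lhd> (1 \<otimes>\<^sub>M lam t) = (if t = s then \<Delta> r s a else 0)" by (rule right) simp
  show "\<Delta> r s a \<lhd> (rho t \<otimes>\<^sub>M 1) = (if t = s then \<Delta> r s a else 0)" by (rule right) simp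
qed

lemma comult_col_act:
  assumes I: "s \<in> I" "t \<in> I"
  shows "(1 \<otimes>\<^sub>M lam t) \<rhd> comult_col s a = \<Delta> t s a" "(rho t \<otimes>\<^sub>M 1) \<rhd> comult_col s a = \<Delta> t s a"
    "comult_col s a \<lhd> (1 \<otimes>\<^sub>M lam t) = (if t = s then comult_col s a else 0)"
    "comult_col s a \<lhd> (rho t \<otimes>\<^sub>M 1) = (if t = s then comult_col s a else 0)"
proof -
  have col: "m \<rhd> comult_col s a = supp_sum (\<lambda>r. m \<rhd> \<Delta> r s a) I"
    "comult_col s a \<lhd> m = supp_sum (\<lambda>r. \<Delta> r s a \<lhd> m) I" for m
    by (rule linear_comult_col[OF I(1) clinear_lact] linear_comult_col[OF I(1) clinear_ract])+
  show "(1 \<otimes>\<^sub>M lam t) \<rhd> comult_col s a = \<Delta> t s a" "(rho t \<otimes>\<^sub>M 1) \<rhd> comult_col s a = \<Delta> t s a"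
    unfolding col by (subst supp_sum_single[where i = t]; simp add: comult_act I)+
  show "comult_col s a \<lhd> (1 \<otimes>\<^sub>M lam t) = (if t = s then comult_col s a else 0)"
    "comult_col s a \<lhd> (rho t \<otimes>\<^sub>M 1) = (if t = s then comult_col s a else 0)"
    unfolding col using I
    by (auto simp: comult_act comult_col_def cong: supp_sum_cong intro!: supp_sum_zero supp_sum_cong)
qed

lemma comult_row_act:
  assumes I: "r \<in> I" "t \<in> I"
  shows "comult_row r a \<lhd> (1 \<otimes>\<^sub>M lam t) = \<Delta> r t a" "comult_row r a \<lhd> (rho t \<otimes>\<^sub>M 1) = \<Delta> r t a"
    "(1 \<otimes>\<^sub>M lam t) \<rhd> comult_row r a = (if t = r then comult_row r a else 0)"
    "(rho t \<otimes>\<^sub>M 1) \<rhd> comult_row r a = (if t = r then comult_row r a else 0)"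
proof -
  have row: "m \<rhd> comult_row r a = supp_sum (\<lambda>s. m \<rhd> \<Delta> r s a) I"
    "comult_row r a \<lhd> m = supp_sum (\<lambda>s. \<Delta> r s a \<lhd> m) I" for m
    by (rule linear_comult_row[OF I(1) clinear_lact] linear_comult_row[OF I(1) clinear_ract])+
  show "comult_row r a \<lhd> (1 \<otimes>\<^sub>M lam t) = \<Delta> r t a" "comult_row r a \<lhd> (rho t \<otimes>\<^sub>M 1) = \<Delta> r t a"
    unfolding row by (subst supp_sum_single[where i = t]; simp add: comult_act I)+
  show "(1 \<otimes>\<^sub>M lam t) \<rhd> comult_row r a = (if t = r then comult_row r a else 0)"
    "(rho t \<otimes>\<^sub>M 1) \<rhd> comult_row r a = (if t = r then comult_row r a else 0)"
    unfolding row using I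
    by (auto simp: comult_act comult_row_def cong: supp_sum_cong intro!: supp_sum_zero supp_sum_cong)
qed

text \<open>
  A homogeneous \<open>y\<close> in the second leg, multiplied from the right, selects one column. A homogeneous \<open>x\<close>
  in the first leg, multiplied from the left, selects one row, and a row is finite.
\<close>

lemma finite_support_comult_col:
  "finite {s \<in> I. \<iota> (comult_col s a) \<rhd> z \<noteq> 0}" "finite {s \<in> I. z \<lhd> \<iota> (comult_col s a) \<noteq> 0}"
proof -
  have left: "comult_col s a * (x \<otimes> y) = 0" if "homog k l m n y" "s \<in> I" "s \<noteq> k" for k l m n s x y
  proof -
    have "comult_col s a * (x \<otimes> y) = comult_col s a * ((1 \<otimes>\<^sub>M lam k) \<rhd> (x \<otimes> y))"
      using that homog_index[OF that(1)] by (simp add: mtensor_act_pure lam_rho_homog multiplier_act)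
    then show ?thesis using that homog_index[OF that(1)] by (simp add: mult_lact comult_col_act)
  qed
  have right: "(x \<otimes> y) * comult_col s a = (x \<otimes> y) * \<Delta> n s a" if "homog k l m n x" "s \<in> I" for k l m n s x y
  proof -
    have "(x \<otimes> y) * comult_col s a = ((x \<otimes> y) \<lhd> (rho n \<otimes>\<^sub>M 1)) * comult_col s a"
      using that homog_index[OF that(1)] by (simp add: mtensor_act_pure lam_rho_homog multiplier_act)
    then show ?thesis using that homog_index[OF that(1)] by (simp add: mult_lact[symmetric] comult_col_act)
  qed
  show "finite {s \<in> I. \<iota> (comult_col s a) \<rhd> z \<noteq> 0}"
  proof (rule finite_support_homog_tensor)
    fix k l m n k' l' m' n' x y assume "homog k l m n x" and y: "homog k' l' m' n' y"
    have "{s \<in> I. \<iota> (comult_col s a) \<rhd> (x \<otimes> y) \<noteq> 0} \<subseteq> {k'}" using left[OF y] by (auto simp: mult_of_act)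
    then show "finite {s \<in> I. \<iota> (comult_col s a) \<rhd> (x \<otimes> y) \<noteq> 0}" by (rule finite_subset) simp
  qed (rule clinear_lact)
  show "finite {s \<in> I. z \<lhd> \<iota> (comult_col s a) \<noteq> 0}"
  proof (rule finite_support_homog_tensor)
    fix k l m n k' l' m' n' x y assume x: "homog k l m n x" "homog k' l' m' n' y"
    have "{s \<in> I. (x \<otimes> y) \<lhd> \<iota> (comult_col s a) \<noteq> 0} \<subseteq> {s \<in> I. \<Delta> n s a \<noteq> 0}"
      by (auto simp: mult_of_act right[OF x(1)])
    then show "finite {s \<in> I. (x \<otimes> y) \<lhd> \<iota> (comult_col s a) \<noteq> 0}"
      by (rule finite_subset) (rule finite_comult_row[OF homog_index(4)[OF x(1)]])
  qed (rule clinear_ract)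
qed

text \<open>
  Since right multiplication by \<open>1 \<otimes> \<lambda>\<^sub>s\<close> extracts the column \<open>s\<close>, this multiplier has the property that
  characterises the total comultiplication.
\<close>

definition comult_sum :: "'a \<Rightarrow> ('a \<otimes> 'a) multiplier" where
  "comult_sum a = strict_sum (\<lambda>s. \<iota> (comult_col s a)) I"

lemma comult_sum_act:
  "comult_sum a \<rhd> z = supp_sum (\<lambda>s. comult_col s a * z) I"
  "z \<lhd> comult_sum a = supp_sum (\<lambda>s. z * comult_col s a) I"
  using has_strict_sum_strict_sum[of I "\<lambda>s. \<iota> (comult_col s a)", OF finite_support_comult_col]
  by (simp_all add: comult_sum_def has_strict_sum_def mult_of_act)

lemma comult_sum_times:
  assumes "s \<in> I"
  shows "comult_sum a * (1 \<otimes>\<^sub>M lam s) = \<iota> (comult_col s a)" "comult_sum a * (rho s \<otimes>\<^sub>M 1) = \<iota> (comult_col s a)"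
    "(1 \<otimes>\<^sub>M lam s) * comult_sum a = \<iota> (comult_row s a)" "(rho s \<otimes>\<^sub>M 1) * comult_sum a = \<iota> (comult_row s a)"
proof -
  show "comult_sum a * (1 \<otimes>\<^sub>M lam s) = \<iota> (comult_col s a)" "comult_sum a * (rho s \<otimes>\<^sub>M 1) = \<iota> (comult_col s a)"
    by (rule multiplier_eqI_A2;
        simp add: multiplier_act comult_sum_act mult_of_act mult_lact; subst supp_sum_single[where i = s];
        simp add: assms comult_col_act)+
  have "z * comult_row s a = supp_sum (\<lambda>t. z * \<Delta> s t a) I" for z
    by (rule linear_comult_row[OF assms]) (intro clin)
  then show "(1 \<otimes>\<^sub>M lam s) * comult_sum a = \<iota> (comult_row s a)" "(rho s \<otimes>\<^sub>M 1) * comult_sum a = \<iota> (comult_row s a)"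
    by (intro multiplier_eqI_right[OF local_units(4)],
        simp add: multiplier_act comult_sum_act mult_of_act flip: mult_lact,
        auto simp: comult_col_act assms intro: supp_sum_cong)+
qed

lemma tensor_eq_supp_sum_lam:
  fixes z :: "'a \<otimes> 'a"
  shows "z = supp_sum (\<lambda>r. (1 \<otimes>\<^sub>M lam r) \<rhd> z) I"
proof (rule homog_tensor_eqI[where F = "\<lambda>z. z" and G = "\<lambda>z. supp_sum (\<lambda>r. (1 \<otimes>\<^sub>M lam r) \<rhd> z) I" and z = z])
  have *: "(1 \<otimes>\<^sub>M lam r) \<rhd> (x \<otimes> y) = (if r = k then x \<otimes> y else 0)"
    if "homog k l m n y" "r \<in> I" for k l m n r and x y :: 'a
    using that by (simp add: mtensor_act_pure multiplier_act lam_rho_homog)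
  have fin: "finite {r \<in> I. (1 \<otimes>\<^sub>M lam r) \<rhd> z \<noteq> 0}" for z :: "'a \<otimes> 'a"
  proof (rule finite_support_homog_tensor[OF clinear_lact])
    fix k l m n k' l' m' n' x y assume y: "homog k l m n x" "homog k' l' m' n' y"
    then have "{r \<in> I. (1 \<otimes>\<^sub>M lam r) \<rhd> (x \<otimes> y) \<noteq> 0} \<subseteq> {k'}"
      by (auto simp: *[OF y(2)] split: if_splits)
    then show "finite {r \<in> I. (1 \<otimes>\<^sub>M lam r) \<rhd> (x \<otimes> y) \<noteq> 0}" by (rule finite_subset) simp
  qed
  show "clinear (\<lambda>z :: 'a \<otimes> 'a. supp_sum (\<lambda>r. (1 \<otimes>\<^sub>M lam r) \<rhd> z) I)"
    by (rule clinear_supp_sum, rule clinear_lact, rule fin)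
  fix k l m n k' l' m' n' x y assume y: "homog k l m n x" "homog k' l' m' n' y"
  show "x \<otimes> y = supp_sum (\<lambda>r. (1 \<otimes>\<^sub>M lam r) \<rhd> (x \<otimes> y)) I"
    by (subst supp_sum_single[where i = k']) (auto simp: *[OF y(2)] homog_index[OF y(2)])
qed (rule clinear_id)

lemma tensor_eqI_lam:
  fixes z w :: "'a \<otimes> 'a"
  assumes "\<And>r. r \<in> I \<Longrightarrow> (1 \<otimes>\<^sub>M lam r) \<rhd> z = (1 \<otimes>\<^sub>M lam r) \<rhd> w"
  shows "z = w"
proof -
  have "supp_sum (\<lambda>r. (1 \<otimes>\<^sub>M lam r) \<rhd> z) I = supp_sum (\<lambda>r. (1 \<otimes>\<^sub>M lam r) \<rhd> w) I"
    by (rule supp_sum_cong) (rule assms)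
  then show ?thesis by (simp flip: tensor_eq_supp_sum_lam)
qed

lemma multiplier_eqI_lam:
  fixes M N :: "('a \<otimes> 'a) multiplier"
  assumes "\<And>s. s \<in> I \<Longrightarrow> M * (1 \<otimes>\<^sub>M lam s) = N * (1 \<otimes>\<^sub>M lam s)"
  shows "M = N"
proof (rule homog_multiplier_tensor_eqI)
  fix k l m n k' l' m' n' x y assume "homog k l m n x" and y: "homog k' l' m' n' y"
  have "M \<rhd> ((1 \<otimes>\<^sub>M lam k') \<rhd> (x \<otimes> y)) = N \<rhd> ((1 \<otimes>\<^sub>M lam k') \<rhd> (x \<otimes> y))"
    using assms[OF homog_index(1)[OF y]] by (simp flip: multiplier_act)
  then show "M \<rhd> (x \<otimes> y) = N \<rhd> (x \<otimes> y)"
    using homog_index[OF y] by (simp add: mtensor_act_pure multiplier_act lam_rho_homog[OF y])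
qed

text \<open>
  The sum over the middle index \<open>t\<close> in the product axiom is a product of a row and a column, because
  \<open>\<Delta> r t a * comult_col s b = \<Delta> r t a * \<Delta> t s b\<close>. For factors that are not composable every term
  vanishes.
\<close>

lemma comult_times: "r \<in> I \<Longrightarrow> s \<in> I \<Longrightarrow> \<Delta> r s (a * b) = comult_row r a * comult_col s b"
proof (rule homog_eqI[where a = a])
  assume I: "r \<in> I" "s \<in> I"
  have expand: "comult_row r a * comult_col s b = supp_sum (\<lambda>t. \<Delta> r t a * \<Delta> t s b) I" for a b
  proof -
    have "comult_row r a * comult_col s b = supp_sum (\<lambda>t. \<Delta> r t a * comult_col s b) I"
      by (rule linear_comult_row[OF I(1)]) (intro clin)
    also have "\<dots> = supp_sum (\<lambda>t. \<Delta> r t a * \<Delta> t s b) I"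
    proof (rule supp_sum_cong)
      fix t assume t: "t \<in> I"
      have "\<Delta> r t a * comult_col s b = (\<Delta> r t a \<lhd> (rho t \<otimes>\<^sub>M 1)) * comult_col s b"
        by (simp add: comult_act I t)
      then show "\<Delta> r t a * comult_col s b = \<Delta> r t a * \<Delta> t s b"
        by (simp add: comult_col_act I t flip: mult_lact)
    qed
    finally show ?thesis .
  qed
  fix k l m n a assume a: "homog k l m n a"
  show "\<Delta> r s (a * b) = comult_row r a * comult_col s b"
  proof (rule homog_eqI[where a = b])
    fix k' l' m' n' b assume b: "homog k' l' m' n' b"
    show "\<Delta> r s (a * b) = comult_row r a * comult_col s b"
    proof (cases "l = k' \<and> n = m'")
      case True
      then show ?thesis
        using comult_mult[of k l m n l' n' r s a b] a b I by (simp add: homog_def expand)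
    next
      case False
      have z: "(x \<otimes> y) * \<Delta> t s b = 0" if xy: "homog k l r t x" "homog r t m n y" and t: "t \<in> I" for t x y
      proof -
        have "(x \<otimes> y) * \<Delta> t s b = tlift (\<lambda>x' y'. 0) (\<Delta> t s b)"
          unfolding times_tensor_pure_left
        proof (rule comult_cong[OF b t I(2)])
          fix x' y' assume "homog k' l' t s x'" "homog t s m' n' y'"
          then have "x * x' = 0 \<or> y * y' = 0"
            using False xy homog_mult_0 by metis
          then show "(x * x') \<otimes> (y * y') = 0"
            by (auto simp: clinear_0[OF clinear_pure_tensor(1)[OF clinear_id]] clinear_0[OF clinear_pure_tensor(2)[OF clinear_id]])
        qed (intro clin)+
        then show ?thesis by (simp add: tlift_zero)
      qed
      have "\<Delta> r t a * \<Delta> t s b = 0" if t: "t \<in> I" for t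
      proof -
        have "tlift (\<lambda>x y. (x \<otimes> y) * \<Delta> t s b) (\<Delta> r t a) = tlift (\<lambda>x y. 0) (\<Delta> r t a)"
          by (rule comult_cong[OF a I(1) t]) (intro clin | rule z[OF _ _ t]; assumption)+
        moreover have "tlift (\<lambda>x y. (x \<otimes> y) * \<Delta> t s b) w = tlift (\<otimes>) w * \<Delta> t s b" for w
          by (rule tlift_linear[symmetric]) (intro clin cbilinear_pure_tensor)+
        ultimately show ?thesis by (simp add: tlift_zero tlift_pure_tensor)
      qed
      then have "comult_row r a * comult_col s b = 0" unfolding expand by (intro supp_sum_zero)
      moreover have "a * b = 0" using False a b homog_mult_0 by metis
      ultimately show ?thesis using I by (simp add: clinear_0[OF comult_linear])
    qed
  qed (intro clin I)+
qed (intro clin; assumption)+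

lemma clinear_comult_sum: "clinear comult_sum"
  by (rule clinearI; rule multiplier_eqI_lam)
    (simp_all add: distrib_right mult_scaleC_left comult_sum_times clinear_add[OF clinear_comult_col[OF _ clinear_id]]
      clinear_scale[OF clinear_comult_col[OF _ clinear_id]] clinear_add[OF clinear_mult_of[OF clinear_id]]
      clinear_scale[OF clinear_mult_of[OF clinear_id]])

text \<open>
  Both sides are compared after cutting with \<open>1 \<otimes> \<lambda>\<^sub>r\<close> and \<open>1 \<otimes> \<lambda>\<^sub>s\<close>, where the claim is the previous
  formula.
\<close>

lemma comult_sum_mult: "comult_sum (a * b) = comult_sum a * comult_sum b"
proof (rule multiplier_eqI_lam)
  fix s assume s: "s \<in> I"
  have "comult_col s (a * b) = comult_sum a \<rhd> comult_col s b"
  proof (rule tensor_eqI_lam)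
    fix r assume r: "r \<in> I"
    have "(1 \<otimes>\<^sub>M lam r) \<rhd> (comult_sum a \<rhd> comult_col s b) = comult_row r a * comult_col s b"
      using arg_cong[OF comult_sum_times(3)[OF r], of "\<lambda>m. m \<rhd> comult_col s b" a]
      by (simp add: multiplier_act mult_of_act)
    then show "(1 \<otimes>\<^sub>M lam r) \<rhd> comult_col s (a * b) = (1 \<otimes>\<^sub>M lam r) \<rhd> (comult_sum a \<rhd> comult_col s b)"
      by (simp add: comult_col_act r s comult_times)
  qed
  then show "comult_sum (a * b) * (1 \<otimes>\<^sub>M lam s) = comult_sum a * comult_sum b * (1 \<otimes>\<^sub>M lam s)"
    by (simp add: comult_sum_times s mult.assoc times_mult_of)
qed

text \<open>
  A multiplier of the tensor square is determined by its products with \<open>1 \<otimes> \<lambda>\<^sub>r\<close> from the left and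
  \<open>1 \<otimes> \<lambda>\<^sub>s\<close> from the right, which gives uniqueness.
\<close>

lemma total_comult_eq: "total_comult I A u \<Delta> = comult_sum"
  unfolding total_comult_def
proof (rule the_equality)
  have "\<iota> (\<Delta> r s a) = (1 \<otimes>\<^sub>M lam r) * comult_sum a * (1 \<otimes>\<^sub>M lam s)"
    "\<iota> (\<Delta> r s a) = (rho r \<otimes>\<^sub>M 1) * comult_sum a * (rho s \<otimes>\<^sub>M 1)" if "r \<in> I" "s \<in> I" for r s a
    using that by (simp_all add: comult_sum_times times_mult_of comult_row_act)
  then show "clinear comult_sum \<and> (\<forall>a b. comult_sum (a * b) = comult_sum a * comult_sum b) \<and>
    (\<forall>k\<in>I. \<forall>l\<in>I. \<forall>m\<in>I. \<forall>n\<in>I. \<forall>a\<in>A k l m n. \<forall>r\<in>I. \<forall>s\<in>I.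
      \<iota> (\<Delta> r s a) = (1 \<otimes>\<^sub>M lam r) * comult_sum a * (1 \<otimes>\<^sub>M lam s) \<and>
      \<iota> (\<Delta> r s a) = (rho r \<otimes>\<^sub>M 1) * comult_sum a * (rho s \<otimes>\<^sub>M 1))"
    using clinear_comult_sum comult_sum_mult by blast
  fix D assume D: "clinear D \<and> (\<forall>a b. D (a * b) = D a * D b) \<and>
    (\<forall>k\<in>I. \<forall>l\<in>I. \<forall>m\<in>I. \<forall>n\<in>I. \<forall>a\<in>A k l m n. \<forall>r\<in>I. \<forall>s\<in>I.
      \<iota> (\<Delta> r s a) = (1 \<otimes>\<^sub>M lam r) * D a * (1 \<otimes>\<^sub>M lam s) \<and>
      \<iota> (\<Delta> r s a) = (rho r \<otimes>\<^sub>M 1) * D a * (rho s \<otimes>\<^sub>M 1))"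
  show "D = comult_sum"
  proof
    show "D a = comult_sum a" for a
    proof (rule homog_eqI[where a = a])
      fix k l m n a assume a: "homog k l m n a"
      show "D a = comult_sum a"
      proof (rule multiplier_eqI_lam, rule multiplier_eqI_A2, rule tensor_eqI_lam)
        fix r s z assume I: "r \<in> I" "s \<in> I"
        have "(1 \<otimes>\<^sub>M lam r) * D a * (1 \<otimes>\<^sub>M lam s) = (1 \<otimes>\<^sub>M lam r) * comult_sum a * (1 \<otimes>\<^sub>M lam s)"
          using D a I by (simp add: homog_def comult_sum_times times_mult_of comult_row_act) metis
        then show "(1 \<otimes>\<^sub>M lam r) \<rhd> ((D a * (1 \<otimes>\<^sub>M lam s)) \<rhd> z) = (1 \<otimes>\<^sub>M lam r) \<rhd> ((comult_sum a * (1 \<otimes>\<^sub>M lam s)) \<rhd> z)"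
          by (metis multiplier_act(13))
      qed
    qed (use D clinear_comult_sum in simp_all)
  qed
qed

abbreviation "D \<equiv> total_comult I A u \<Delta>"

lemmas total_comult_times = comult_sum_times[folded total_comult_eq]

lemmas clinear_total_comult = clinear_comult_sum[folded total_comult_eq]
lemmas total_comult_mult = comult_sum_mult[folded total_comult_eq]

lemma clinear_total_comult_comp [clin]: "clinear f \<Longrightarrow> clinear (\<lambda>x. D (f x))"
  by (rule clinear_compose[OF _ clinear_total_comult])

section \<open>The canonical idempotent and the canonical maps\<close>

text \<open>This is \<open>D(1)\<close>, the strict sum of the multipliers \<open>D (u k m)\<close>.\<close>

definition canonical_idempotent :: "('a \<otimes> 'a) multiplier" where
  "canonical_idempotent = strict_sum (\<lambda>p. rho p \<otimes>\<^sub>M lam p) I"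

abbreviation "E0 \<equiv> canonical_idempotent"

lemma canonical_idempotent_homog:
  assumes a: "homog k l m n a" and b: "homog k' l' m' n' b"
  shows "E0 \<rhd> (a \<otimes> b) = (if m = k' then a \<otimes> b else 0)"
    and "(a \<otimes> b) \<lhd> E0 = (if n = l' then a \<otimes> b else 0)"
proof -
  have act: "(rho p \<otimes>\<^sub>M lam p) \<rhd> (a \<otimes> b) = (if p = m \<and> p = k' then a \<otimes> b else 0)"
    "(a \<otimes> b) \<lhd> (rho p \<otimes>\<^sub>M lam p) = (if p = n \<and> p = l' then a \<otimes> b else 0)"
    if "homog k l m n a" "homog k' l' m' n' b" "p \<in> I" for k l m n k' l' m' n' a b p
    using that by (auto simp: mtensor_act_pure lam_rho_homog)
  have sub: "{p \<in> I. (rho p \<otimes>\<^sub>M lam p) \<rhd> (a \<otimes> b) \<noteq> 0} \<subseteq> {m}"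
    "{p \<in> I. (a \<otimes> b) \<lhd> (rho p \<otimes>\<^sub>M lam p) \<noteq> 0} \<subseteq> {n}"
    if "homog k l m n a" "homog k' l' m' n' b" for k l m n k' l' m' n' a b
    by (auto simp: act[OF that] split: if_splits)
  note fin = sub[THEN finite_subset, OF _ _ finite.insertI[OF finite.emptyI]]
  have "has_strict_sum (\<lambda>p. rho p \<otimes>\<^sub>M lam p) I E0"
    unfolding canonical_idempotent_def
    by (rule has_strict_sum_strict_sum)
      (rule finite_support_homog_tensor[OF clinear_lact], erule (1) fin,
       rule finite_support_homog_tensor[OF clinear_ract], erule (1) fin)
  then have E: "E0 \<rhd> (a \<otimes> b) = supp_sum (\<lambda>p. (rho p \<otimes>\<^sub>M lam p) \<rhd> (a \<otimes> b)) I"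
    "(a \<otimes> b) \<lhd> E0 = supp_sum (\<lambda>p. (a \<otimes> b) \<lhd> (rho p \<otimes>\<^sub>M lam p)) I"
    by (simp_all add: has_strict_sum_def)
  show "E0 \<rhd> (a \<otimes> b) = (if m = k' then a \<otimes> b else 0)" unfolding E
    by (subst supp_sum_single[where i = m]) (use homog_index[OF a] in \<open>auto simp: act[OF a b]\<close>)
  show "(a \<otimes> b) \<lhd> E0 = (if n = l' then a \<otimes> b else 0)" unfolding E
    by (subst supp_sum_single[where i = n]) (use homog_index[OF a] in \<open>auto simp: act[OF a b]\<close>)
qed

text \<open>
  On homogeneous pure tensors each of the four maps is the identity or zero: it tests the equality of
  one pair of indices.
\<close>

lemma
  shows clinear_partial_G1: "clinear (partial_G1 I u)" and clinear_partial_E1: "clinear (partial_E1 I u)"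
    and clinear_partial_G2: "clinear (partial_G2 I u)" and clinear_partial_E2: "clinear (partial_E2 I u)"
    and partial_homog: "homog k l m n a \<Longrightarrow> homog k' l' m' n' b \<Longrightarrow>
      partial_G1 I u (a \<otimes> b) = (if n = m' then a \<otimes> b else 0) \<and>
      partial_E1 I u (a \<otimes> b) = (if m = k' then a \<otimes> b else 0) \<and>
      partial_G2 I u (a \<otimes> b) = (if l = k' then a \<otimes> b else 0) \<and>
      partial_E2 I u (a \<otimes> b) = (if n = l' then a \<otimes> b else 0)"
proof -
  have bil: "cbilinear (\<lambda>a b. supp_sum (\<lambda>p. f p a \<otimes> g p b) I)"
    if "\<And>p. clinear (f p)" "\<And>p. clinear (g p)" "\<And>a. finite {p \<in> I. f p a \<noteq> 0}"
    for f g :: "'i \<Rightarrow> 'a \<Rightarrow> 'a"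
  proof (rule tlift_supp_sum(1))
    show "finite {p \<in> I. f p a \<otimes> g p b \<noteq> 0}" for a b
      by (rule finite_subset[OF _ that(3)[of a]]) auto
  qed (rule cbilinear_tmap[OF that(1,2)])
  note b = bil[OF clinear_ract clinear_lact finite_support_lam_rho(4)]
    bil[OF clinear_lact clinear_lact finite_support_lam_rho(3)]
    bil[OF clinear_ract clinear_lact finite_support_lam_rho(2)]
    bil[OF clinear_ract clinear_ract finite_support_lam_rho(4)]
  show "clinear (partial_G1 I u)" "clinear (partial_E1 I u)" "clinear (partial_G2 I u)" "clinear (partial_E2 I u)"
    unfolding partial_G1_def partial_E1_def partial_G2_def partial_E2_def by (intro clinear_tlift b)+
  assume a: "homog k l m n a" and c: "homog k' l' m' n' b"
  have single: "supp_sum F I = (if P then a \<otimes> b else 0)"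
    if "i \<in> I" "\<And>p. p \<in> I \<Longrightarrow> F p = (if p = i \<and> P then a \<otimes> b else 0)" for i P and F :: "'i \<Rightarrow> 'a \<otimes> 'a"
    using that by (subst supp_sum_single[where i = i]) auto
  note [simp] = lam_rho_homog[OF a] lam_rho_homog[OF c]
  show "partial_G1 I u (a \<otimes> b) = (if n = m' then a \<otimes> b else 0) \<and>
      partial_E1 I u (a \<otimes> b) = (if m = k' then a \<otimes> b else 0) \<and>
      partial_G2 I u (a \<otimes> b) = (if l = k' then a \<otimes> b else 0) \<and>
      partial_E2 I u (a \<otimes> b) = (if n = l' then a \<otimes> b else 0)"
    unfolding partial_G1_def partial_E1_def partial_G2_def partial_E2_def tlift_pure[OF b(1)]
      tlift_pure[OF b(2)] tlift_pure[OF b(3)] tlift_pure[OF b(4)]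
  proof (intro conjI)
    show "supp_sum (\<lambda>p. (a \<lhd> rho p) \<otimes> (rho p \<rhd> b)) I = (if n = m' then a \<otimes> b else 0)"
      by (rule single[OF homog_index(4)[OF a]]) auto
    show "supp_sum (\<lambda>p. (rho p \<rhd> a) \<otimes> (lam p \<rhd> b)) I = (if m = k' then a \<otimes> b else 0)"
      by (rule single[OF homog_index(3)[OF a]]) auto
    show "supp_sum (\<lambda>p. (a \<lhd> lam p) \<otimes> (lam p \<rhd> b)) I = (if l = k' then a \<otimes> b else 0)"
      by (rule single[OF homog_index(2)[OF a]]) auto
    show "supp_sum (\<lambda>p. (a \<lhd> rho p) \<otimes> (b \<lhd> lam p)) I = (if n = l' then a \<otimes> b else 0)"
      by (rule single[OF homog_index(4)[OF a]]) auto
  qed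
qed

lemmas partial_maps_homog = partial_homog[THEN conjunct1]
  partial_homog[THEN conjunct2, THEN conjunct1]
  partial_homog[THEN conjunct2, THEN conjunct2, THEN conjunct1]
  partial_homog[THEN conjunct2, THEN conjunct2, THEN conjunct2]

lemma partial_E1_eq: "partial_E1 I u z = E0 \<rhd> z"
  by (rule homog_tensor_eqI[where z = z, OF clinear_partial_E1 clinear_lact])
    (simp add: partial_maps_homog canonical_idempotent_homog)

lemma partial_E2_eq: "partial_E2 I u z = z \<lhd> E0"
  by (rule homog_tensor_eqI[where z = z, OF clinear_partial_E2 clinear_ract])
    (simp add: partial_maps_homog canonical_idempotent_homog)

lemma mult_of_mtensor_act:
  "z \<lhd> (1 \<otimes>\<^sub>M \<iota> b) = tlift (\<lambda>x y. x \<otimes> (y * b)) z" "(\<iota> a \<otimes>\<^sub>M 1) \<rhd> z = tlift (\<lambda>x y. (a * x) \<otimes> y) z"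
  by (simp_all add: mtensor_act tmap_def multiplier_act mult_of_act)

lemma subspace_range_mult_of:
  assumes "clinear F"
  shows "csubspace {x. F x \<in> range \<iota>}"
  using clinear_0[OF assms] clinear_add[OF assms] clinear_scale[OF assms]
  by (intro complex_vector.subspaceI)
    (auto simp: image_iff clinear_0[OF clinear_mult_of[OF clinear_id], symmetric]
      simp flip: clinear_add[OF clinear_mult_of[OF clinear_id]] clinear_scale[OF clinear_mult_of[OF clinear_id]])

text \<open>
  If \<open>lam s \<rhd> b = b\<close>, then multiplication by \<open>b\<close> in the second leg sees the column \<open>s\<close> only.
\<close>

lemma total_comult_mult_of:
  assumes "s \<in> I" "lam s \<rhd> b = b"
  shows "D a * (1 \<otimes>\<^sub>M \<iota> b) = \<iota> (tlift (\<lambda>x y. x \<otimes> (y * b)) (comult_col s a))"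
proof -
  have "1 \<otimes>\<^sub>M \<iota> b = (1 \<otimes>\<^sub>M lam s) * (1 \<otimes>\<^sub>M \<iota> b)" using assms by (simp add: mtensor_times times_mult_of)
  then have "D a * (1 \<otimes>\<^sub>M \<iota> b) = D a * (1 \<otimes>\<^sub>M lam s) * (1 \<otimes>\<^sub>M \<iota> b)" by (metis mult.assoc)
  then show ?thesis by (simp add: total_comult_times assms times_mult_of mult_of_mtensor_act)
qed

lemma mult_of_total_comult:
  assumes "r \<in> I" "a \<lhd> rho r = a"
  shows "(\<iota> a \<otimes>\<^sub>M 1) * D b = \<iota> (tlift (\<lambda>x y. (a * x) \<otimes> y) (comult_row r b))"
proof -
  have "\<iota> a \<otimes>\<^sub>M 1 = (\<iota> a \<otimes>\<^sub>M 1) * (rho r \<otimes>\<^sub>M 1)" using assms by (simp add: mtensor_times times_mult_of)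
  then have "(\<iota> a \<otimes>\<^sub>M 1) * D b = (\<iota> a \<otimes>\<^sub>M 1) * ((rho r \<otimes>\<^sub>M 1) * D b)" by (metis mult.assoc)
  then show ?thesis by (simp add: total_comult_times assms times_mult_of mult_of_mtensor_act)
qed

lemma total_comult_in_range: "D a * (1 \<otimes>\<^sub>M \<iota> b) \<in> range \<iota>" "(\<iota> a \<otimes>\<^sub>M 1) * D b \<in> range \<iota>"
proof -
  have "clinear (\<lambda>b. D a * (1 \<otimes>\<^sub>M \<iota> b))" "clinear (\<lambda>a. (\<iota> a \<otimes>\<^sub>M 1) * D b)" by (intro clin)+
  note sub = this[THEN subspace_range_mult_of]
  have "b \<in> {b. D a * (1 \<otimes>\<^sub>M \<iota> b) \<in> range \<iota>}"
  proof (rule subspace_homogI[OF sub(1)])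
    show "b \<in> {b. D a * (1 \<otimes>\<^sub>M \<iota> b) \<in> range \<iota>}" if "homog k l m n b" for k l m n b
      using that homog_index[OF that] by (simp add: total_comult_mult_of[of k] lam_rho_homog[OF that])
  qed
  then show "D a * (1 \<otimes>\<^sub>M \<iota> b) \<in> range \<iota>" by simp
  have "a \<in> {a. (\<iota> a \<otimes>\<^sub>M 1) * D b \<in> range \<iota>}"
  proof (rule subspace_homogI[OF sub(2)])
    show "a \<in> {a. (\<iota> a \<otimes>\<^sub>M 1) * D b \<in> range \<iota>}" if "homog k l m n a" for k l m n a
      using that homog_index[OF that] by (simp add: mult_of_total_comult[of n] lam_rho_homog[OF that])
  qed
  then show "(\<iota> a \<otimes>\<^sub>M 1) * D b \<in> range \<iota>" by simp
qed

lemma inv_mult_of: "inv \<iota> (\<iota> z) = z" for z :: "'a \<otimes> 'a"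
  by (rule inv_f_f[OF inj_mult_of_A2])

lemma clinear_inv_mult_of:
  fixes F :: "'b::complex_vector \<Rightarrow> ('a \<otimes> 'a) multiplier"
  assumes "clinear F" "\<And>x. F x \<in> range \<iota>"
  shows "clinear (\<lambda>x. inv \<iota> (F x))"
proof -
  define G where "G x = inv \<iota> (F x)" for x
  have G: "F x = \<iota> (G x)" for x unfolding G_def by (rule f_inv_into_f[OF assms(2), symmetric])
  note lin = clinear_mult_of[OF clinear_id]
  have "\<iota> (G (x + y)) = \<iota> (G x + G y)" "\<iota> (G (c *\<^sub>C x)) = \<iota> (c *\<^sub>C G x)" for x y c
    using clinear_add[OF assms(1)] clinear_scale[OF assms(1)] by (simp_all add: G clinear_add[OF lin] clinear_scale[OF lin])
  then have "clinear G" by (intro clinearI) (blast intro: injD[OF inj_mult_of_A2])+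
  then show ?thesis by (simp add: G inv_mult_of)
qed

lemma
  shows clinear_T1: "clinear (T1 D)" and T1_mult_of: "D a * (1 \<otimes>\<^sub>M \<iota> b) = \<iota> (T1 D (a \<otimes> b))"
    and clinear_T2: "clinear (T2 D)" and T2_mult_of: "(\<iota> a \<otimes>\<^sub>M 1) * D b = \<iota> (T2 D (a \<otimes> b))"
proof -
  have b1: "cbilinear (\<lambda>a b. inv \<iota> (D a * (1 \<otimes>\<^sub>M \<iota> b)))" and b2: "cbilinear (\<lambda>a b. inv \<iota> ((\<iota> a \<otimes>\<^sub>M 1) * D b))"
    by (intro cbilinearI clinear_inv_mult_of total_comult_in_range; intro clin)+
  show "clinear (T1 D)" "clinear (T2 D)" unfolding T1_def T2_def by (intro clinear_tlift b1 b2)+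
  show "D a * (1 \<otimes>\<^sub>M \<iota> b) = \<iota> (T1 D (a \<otimes> b))" "(\<iota> a \<otimes>\<^sub>M 1) * D b = \<iota> (T2 D (a \<otimes> b))"
    unfolding T1_def T2_def tlift_pure[OF b1] tlift_pure[OF b2]
    by (simp_all add: total_comult_in_range f_inv_into_f)
qed

lemma T1_homog:
  assumes "homog s l m n b"
  shows "T1 D (a \<otimes> b) = tlift (\<lambda>x y. x \<otimes> (y * b)) (comult_col s a)"
  using total_comult_mult_of[of s b a] assms homog_index[OF assms]
  by (auto simp: T1_mult_of lam_rho_homog intro: injD[OF inj_mult_of_A2])

lemma T2_homog:
  assumes "homog k l m r a"
  shows "T2 D (a \<otimes> b) = tlift (\<lambda>x y. (a * x) \<otimes> y) (comult_row r b)"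
  using mult_of_total_comult[of r a b] assms homog_index[OF assms]
  by (auto simp: T2_mult_of lam_rho_homog intro: injD[OF inj_mult_of_A2])

lemma clinear_T_comp [clin]:
  "clinear f \<Longrightarrow> clinear (\<lambda>x. T1 D (f x))" "clinear f \<Longrightarrow> clinear (\<lambda>x. T2 D (f x))"
  by (rule clinear_compose[OF _ clinear_T1] clinear_compose[OF _ clinear_T2]; assumption)+

text \<open>
  In \<open>\<Delta> r s a\<close> the lower left index of the first leg and the upper left index of the second leg are both
  \<open>r\<close>, and the equality of these two indices is what \<open>E0\<close> tests from the left.
\<close>

lemma canonical_idempotent_T1: "E0 \<rhd> T1 D z = T1 D z"
proof (rule homog_tensor_eqI[where z = z])
  fix k l m n k' l' m' n' a b assume a: "homog k l m n a" and b: "homog k' l' m' n' b"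
  have bil: "cbilinear (\<lambda>x y. E0 \<rhd> (x \<otimes> (y * b)))" "cbilinear (\<lambda>x y. x \<otimes> (y * b))"
    by (intro clin)+
  show "E0 \<rhd> T1 D (a \<otimes> b) = T1 D (a \<otimes> b)"
    unfolding T1_homog[OF b] tlift_linear[OF clinear_lact bil(2)]
  proof (rule comult_col_cong[OF a homog_index(1)[OF b] bil])
    fix r x y assume x: "homog k l r k' x" and y: "homog r k' m n y"
    show "E0 \<rhd> (x \<otimes> (y * b)) = x \<otimes> (y * b)"
      using canonical_idempotent_homog(1)[OF x homog_mult[OF y b]] by simp
  qed
qed (intro clin)+

text \<open>
  From the right, \<open>E0\<close> compares the indices that are both \<open>s\<close> in \<open>\<Delta> r s a\<close>.
\<close>

lemma canonical_idempotent_T2: "T2 D z \<lhd> E0 = T2 D z"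
proof (rule homog_tensor_eqI[where z = z])
  fix k l m n k' l' m' n' a b assume a: "homog k l m n a" and b: "homog k' l' m' n' b"
  have bil: "cbilinear (\<lambda>x y. ((a * x) \<otimes> y) \<lhd> E0)" "cbilinear (\<lambda>x y. (a * x) \<otimes> y)"
    by (intro clin)+
  show "T2 D (a \<otimes> b) \<lhd> E0 = T2 D (a \<otimes> b)"
    unfolding T2_homog[OF a] tlift_linear[OF clinear_ract bil(2)]
  proof (rule comult_row_cong[OF b homog_index(4)[OF a] bil])
    fix s x y assume x: "homog k' l' n s x" and y: "homog n s m' n' y"
    show "((a * x) \<otimes> y) \<lhd> E0 = (a * x) \<otimes> y"
      using canonical_idempotent_homog(2)[OF homog_mult[OF a x] y] by simp
  qed
qed (intro clin)+

section \<open>From an antipode to generalized inverses\<close>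

lemma counit_T1: "tlift (\<lambda>x y. \<epsilon> x *\<^sub>C y) (T1 D z) = tlift (*) z"
proof (rule homog_tensor_eqI[where z = z])
  have b: "cbilinear (\<lambda>x y. \<epsilon> x *\<^sub>C (y::'a))" "cbilinear (\<lambda>x y. x * (y::'a))" by (intro clin)+
  fix k l m n k' l' m' n' a b assume a: "homog k l m n a" and c: "homog k' l' m' n' b"
  have b': "cbilinear (\<lambda>x y. x \<otimes> (y * b))" by (intro clin)
  show "tlift (\<lambda>x y. \<epsilon> x *\<^sub>C y) (T1 D (a \<otimes> b)) = tlift (*) (a \<otimes> b)"
    unfolding T1_homog[OF c] tlift_linear[OF clinear_tlift[OF b(1)] b'] tlift_pure[OF b(1)] tlift_pure[OF b(2)]
    by (subst counit_comult_col(1)[OF a homog_index(1)[OF c], where F = "\<lambda>y. y * b"])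
      (intro clin, use homog_mult_0[OF a c] in auto)
qed (intro clin)+

lemma counit_T2: "tlift (\<lambda>x y. \<epsilon> y *\<^sub>C x) (T2 D z) = tlift (*) z"
proof (rule homog_tensor_eqI[where z = z])
  have b: "cbilinear (\<lambda>x y. \<epsilon> y *\<^sub>C (x::'a))" "cbilinear (\<lambda>x y. x * (y::'a))" by (intro clin)+
  fix k l m n k' l' m' n' a b assume a: "homog k l m n a" and c: "homog k' l' m' n' b"
  have b': "cbilinear (\<lambda>x y. (a * x) \<otimes> y)" by (intro clin)
  show "tlift (\<lambda>x y. \<epsilon> y *\<^sub>C x) (T2 D (a \<otimes> b)) = tlift (*) (a \<otimes> b)"
    unfolding T2_homog[OF a] tlift_linear[OF clinear_tlift[OF b(1)] b'] tlift_pure[OF b(1)] tlift_pure[OF b(2)]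
    by (subst counit_comult_row(2)[OF c homog_index(4)[OF a], where F = "\<lambda>y. a * y"])
      (intro clin, use homog_mult_0[OF a c] in auto)
qed (intro clin)+

context
  fixes S :: "'a \<Rightarrow> 'a"
  assumes S: "partial_antipode I A u \<Delta> \<epsilon> S"
begin

lemma clinear_antipode [clin]: "clinear f \<Longrightarrow> clinear (\<lambda>x. S (f x))"
  using S by (auto simp: partial_antipode_def intro: clinear_compose)

lemma antipode_homog: "homog k l m n a \<Longrightarrow> homog n m l k (S a)"
  using S unfolding partial_antipode_def homog_def by blast

text \<open>
  The axiom for the antipode, extended to all degrees: for \<open>l \<noteq> n\<close> the products \<open>x * S y\<close> are not
  composable, and the counit vanishes unless \<open>k = m\<close> and \<open>l = n\<close>.
\<close>

lemma antipode_row: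
  assumes a: "homog k l m n a" and r: "r \<in> I"
  shows "tlift (\<lambda>x y. x * S y) (comult_row r a) = \<epsilon> a *\<^sub>C u k r"
proof (cases "l = n")
  case True
  have "tlift (\<lambda>x y. x * S y) (comult_row r a) = (if k = m then \<epsilon> a *\<^sub>C u k r else 0)"
    using S a r True by (subst linear_comult_row[OF r]) (intro clin, auto simp: partial_antipode_def homog_def)
  then show ?thesis using homog_counit_0[OF a] by auto
next
  case False
  have "tlift (\<lambda>x y. x * S y) (comult_row r a) = tlift (\<lambda>x y. 0) (comult_row r a)"
    by (rule comult_row_cong[OF a r]) (intro clin | use antipode_homog homog_mult_0 False in blast)+
  then show ?thesis using homog_counit_0[OF a] False by (simp add: tlift_zero)
qed

lemma antipode_col:
  assumes a: "homog k l m n a" and s: "s \<in> I"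
  shows "tlift (\<lambda>x y. S x * y) (comult_col s a) = \<epsilon> a *\<^sub>C u s n"
proof (cases "k = m")
  case True
  have "tlift (\<lambda>x y. S x * y) (comult_col s a) = (if l = n then \<epsilon> a *\<^sub>C u s n else 0)"
    using S a s True by (subst linear_comult_col[OF s]) (intro clin, auto simp: partial_antipode_def homog_def)
  then show ?thesis using homog_counit_0[OF a] by auto
next
  case False
  have "tlift (\<lambda>x y. S x * y) (comult_col s a) = tlift (\<lambda>x y. 0) (comult_col s a)"
    by (rule comult_col_cong[OF a s]) (intro clin | use antipode_homog homog_mult_0 False in blast)+
  then show ?thesis using homog_counit_0[OF a] False by (simp add: tlift_zero)
qed

text \<open>
  This is \<open>a \<otimes> b \<mapsto> a(1) \<otimes> S(a(2)) b\<close>. The lower left index of \<open>b\<close> selects the row, and the outer sum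
  splits \<open>b\<close> by that index.
\<close>

definition antipode_R1 :: "'a \<otimes> 'a \<Rightarrow> 'a \<otimes> 'a" where
  "antipode_R1 = tlift (\<lambda>a b. supp_sum (\<lambda>r. tlift (\<lambda>x y. x \<otimes> (S y * (rho r \<rhd> b))) (comult_row r a)) I)"

text \<open>
  This is \<open>a \<otimes> b \<mapsto> a S(b(1)) \<otimes> b(2)\<close>. The upper right index of \<open>a\<close> selects the column.
\<close>

definition antipode_R2 :: "'a \<otimes> 'a \<Rightarrow> 'a \<otimes> 'a" where
  "antipode_R2 = tlift (\<lambda>a b. supp_sum (\<lambda>s. tlift (\<lambda>x y. ((a \<lhd> lam s) * S x) \<otimes> y) (comult_col s b)) I)"

lemma
  shows clinear_antipode_R1: "clinear antipode_R1"
    and antipode_R1_homog: "homog k l r n b \<Longrightarrow>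
      antipode_R1 (a \<otimes> b) = tlift (\<lambda>x y. x \<otimes> (S y * b)) (comult_row r a)"
proof -
  have bil: "cbilinear (\<lambda>a b. supp_sum (\<lambda>r. tlift (\<lambda>x y. x \<otimes> (S y * (rho r \<rhd> b))) (comult_row r a)) I)"
  proof (rule tlift_supp_sum(1))
    show "cbilinear (\<lambda>a b. tlift (\<lambda>x y. x \<otimes> (S y * (rho r \<rhd> b))) (comult_row r a))" if "r \<in> I" for r
      by (intro clin that)
    show "finite {r \<in> I. tlift (\<lambda>x y. x \<otimes> (S y * (rho r \<rhd> b))) (comult_row r a) \<noteq> 0}" for a b
      by (rule finite_subset[OF _ finite_support_lam_rho(3)[of b]]) (auto simp: tlift_zero)
  qed
  show "clinear antipode_R1" unfolding antipode_R1_def by (rule clinear_tlift[OF bil])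
  assume b: "homog k l r n b"
  show "antipode_R1 (a \<otimes> b) = tlift (\<lambda>x y. x \<otimes> (S y * b)) (comult_row r a)"
    unfolding antipode_R1_def tlift_pure[OF bil]
    by (subst supp_sum_single[where i = r]) (use homog_index[OF b] in \<open>simp_all add: lam_rho_homog[OF b] tlift_zero\<close>)
qed

lemma
  shows clinear_antipode_R2: "clinear antipode_R2"
    and antipode_R2_homog: "homog k s m n a \<Longrightarrow>
      antipode_R2 (a \<otimes> b) = tlift (\<lambda>x y. (a * S x) \<otimes> y) (comult_col s b)"
proof -
  have bil: "cbilinear (\<lambda>a b. supp_sum (\<lambda>s. tlift (\<lambda>x y. ((a \<lhd> lam s) * S x) \<otimes> y) (comult_col s b)) I)"
  proof (rule tlift_supp_sum(1))
    show "cbilinear (\<lambda>a b. tlift (\<lambda>x y. ((a \<lhd> lam s) * S x) \<otimes> y) (comult_col s b))" if "s \<in> I" for s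
      by (intro clin that)
    show "finite {s \<in> I. tlift (\<lambda>x y. ((a \<lhd> lam s) * S x) \<otimes> y) (comult_col s b) \<noteq> 0}" for a b
      by (rule finite_subset[OF _ finite_support_lam_rho(2)[of a]]) (auto simp: tlift_zero)
  qed
  show "clinear antipode_R2" unfolding antipode_R2_def by (rule clinear_tlift[OF bil])
  assume a: "homog k s m n a"
  have [simp]: "(\<otimes>) (0::'a) = (\<lambda>y::'a. 0)" by (rule ext) simp
  show "antipode_R2 (a \<otimes> b) = tlift (\<lambda>x y. (a * S x) \<otimes> y) (comult_col s b)"
    unfolding antipode_R2_def tlift_pure[OF bil]
    by (subst supp_sum_single[where i = s]) (use homog_index[OF a] in \<open>simp_all add: lam_rho_homog[OF a] tlift_zero\<close>)
qed

lemma clinear_antipode_R_comp [clin]: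
  "clinear f \<Longrightarrow> clinear (\<lambda>x. antipode_R1 (f x))" "clinear f \<Longrightarrow> clinear (\<lambda>x. antipode_R2 (f x))"
  by (rule clinear_compose[OF _ clinear_antipode_R1] clinear_compose[OF _ clinear_antipode_R2]; assumption)+

text \<open>
  \<open>a(1) \<otimes> a(2) S(a(3)) b = a(1) \<otimes> \<epsilon>(a(2)) u m m' b = a \<otimes> u m m' b\<close>, and the unit \<open>u m m'\<close> acts on \<open>b\<close> as
  the identity or as zero, in accordance with \<open>partial_E1\<close>.
\<close>

lemma T1_antipode_R1: "T1 D (antipode_R1 z) = partial_E1 I u z"
proof (rule homog_tensor_eqI[where z = z])
  fix k l m n k' l' m' n' a b assume a: "homog k l m n a" and b: "homog k' l' m' n' b"
  note I = homog_index[OF a] homog_index[OF b]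
  have bil: "cbilinear (\<lambda>x y. x \<otimes> (S y * b))" by (intro clin)
  have "T1 D (antipode_R1 (a \<otimes> b)) = tlift (\<lambda>x y. T1 D (x \<otimes> (S y * b))) (comult_row m' a)"
    unfolding antipode_R1_homog[OF b] by (rule tlift_linear[OF clinear_T1 bil])
  also have "\<dots> = tlift (\<lambda>x y. tlift (\<lambda>x1 x2. x1 \<otimes> (x2 * (S y * b))) (comult_col n x)) (comult_row m' a)"
  proof (rule comult_row_cong[OF a I(7)])
    fix s x y assume y: "homog m' s m n y"
    show "T1 D (x \<otimes> (S y * b)) = tlift (\<lambda>x1 x2. x1 \<otimes> (x2 * (S y * b))) (comult_col n x)"
      by (rule T1_homog[OF homog_mult[OF antipode_homog[OF y] b]])
  qed (intro clin I)+
  also have "\<dots> = tlift (\<lambda>x y. tlift (\<lambda>y1 y2. x \<otimes> (y1 * (S y2 * b))) (comult_row m' y)) (comult_col n a)"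
    by (rule coassoc_col_row[OF I(4,7)]) (intro clin)+
  also have "\<dots> = tlift (\<lambda>x y. \<epsilon> y *\<^sub>C (x \<otimes> (u m m' * b))) (comult_col n a)"
  proof (rule comult_col_cong[OF a I(4)])
    fix r x y assume y: "homog r n m n y"
    have "tlift (\<lambda>y1 y2. x \<otimes> (y1 * (S y2 * b))) (comult_row m' y)
        = x \<otimes> (tlift (\<lambda>y1 y2. y1 * S y2) (comult_row m' y) * b)"
      by (subst tlift_linear[where F = "\<lambda>v. x \<otimes> (v * b)"]) ((intro clin)+, simp add: mult.assoc)
    then show "tlift (\<lambda>y1 y2. x \<otimes> (y1 * (S y2 * b))) (comult_row m' y) = \<epsilon> y *\<^sub>C (x \<otimes> (u m m' * b))"
      using homog_counit_0[OF y] by (cases "r = m") (simp_all add: antipode_row[OF y I(7)] mult_scaleC_left tensor_scale_right)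
  qed (intro clin I)+
  also have "\<dots> = a \<otimes> (u m m' * b)"
    by (subst counit_comult_col(2)[OF a I(4), where F = "\<lambda>x. x \<otimes> (u m m' * b)"]) (intro clin, simp)
  also have "\<dots> = partial_E1 I u (a \<otimes> b)"
    by (simp add: partial_maps_homog(2)[OF a b] unit_times_homog[OF b] I)
  finally show "T1 D (antipode_R1 (a \<otimes> b)) = partial_E1 I u (a \<otimes> b)" .
qed (intro clin clinear_partial_E1)+

text \<open>
  \<open>a(1) \<otimes> S(a(2)) a(3) b = a(1) \<otimes> \<epsilon>(a(2)) u k' n b = a \<otimes> u k' n b\<close>.
\<close>

lemma antipode_R1_T1: "antipode_R1 (T1 D z) = partial_G1 I u z"
proof (rule homog_tensor_eqI[where z = z])
  fix k l m n k' l' m' n' a b assume a: "homog k l m n a" and b: "homog k' l' m' n' b"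
  note I = homog_index[OF a] homog_index[OF b]
  have bil: "cbilinear (\<lambda>x y. x \<otimes> (y * b))" by (intro clin)
  have "antipode_R1 (T1 D (a \<otimes> b)) = tlift (\<lambda>x y. antipode_R1 (x \<otimes> (y * b))) (comult_col k' a)"
    unfolding T1_homog[OF b] by (rule tlift_linear[OF clinear_antipode_R1 bil])
  also have "\<dots> = tlift (\<lambda>x y. tlift (\<lambda>x1 x2. x1 \<otimes> (S x2 * (y * b))) (comult_row m x)) (comult_col k' a)"
  proof (rule comult_col_cong[OF a I(5)])
    fix r x y assume y: "homog r k' m n y"
    show "antipode_R1 (x \<otimes> (y * b)) = tlift (\<lambda>x1 x2. x1 \<otimes> (S x2 * (y * b))) (comult_row m x)"
      by (rule antipode_R1_homog[OF homog_mult[OF y b]])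
  qed (intro clin I)+
  also have "\<dots> = tlift (\<lambda>x y. tlift (\<lambda>y1 y2. x \<otimes> (S y1 * (y2 * b))) (comult_col k' y)) (comult_row m a)"
    by (rule coassoc_row_col[OF I(3,5)]) (intro clin)+
  also have "\<dots> = tlift (\<lambda>x y. \<epsilon> y *\<^sub>C (x \<otimes> (u k' n * b))) (comult_row m a)"
  proof (rule comult_row_cong[OF a I(3)])
    fix s x y assume y: "homog m s m n y"
    have "tlift (\<lambda>y1 y2. x \<otimes> (S y1 * (y2 * b))) (comult_col k' y)
        = x \<otimes> (tlift (\<lambda>y1 y2. S y1 * y2) (comult_col k' y) * b)"
      by (subst tlift_linear[where F = "\<lambda>v. x \<otimes> (v * b)"]) ((intro clin)+, simp add: mult.assoc)
    then show "tlift (\<lambda>y1 y2. x \<otimes> (S y1 * (y2 * b))) (comult_col k' y) = \<epsilon> y *\<^sub>C (x \<otimes> (u k' n * b))"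
      by (simp add: antipode_col[OF y I(5)] mult_scaleC_left tensor_scale_right)
  qed (intro clin I)+
  also have "\<dots> = a \<otimes> (u k' n * b)"
    by (subst counit_comult_row(2)[OF a I(3), where F = "\<lambda>x. x \<otimes> (u k' n * b)"]) (intro clin, simp)
  also have "\<dots> = partial_G1 I u (a \<otimes> b)"
    by (simp add: partial_maps_homog(1)[OF a b] unit_times_homog[OF b] I)
  finally show "antipode_R1 (T1 D (a \<otimes> b)) = partial_G1 I u (a \<otimes> b)" .
qed (intro clin clinear_partial_G1)+

lemma partial_G1_antipode_R1: "partial_G1 I u (antipode_R1 z) = antipode_R1 z"
proof (rule homog_tensor_eqI[where z = z])
  fix k l m n k' l' m' n' a b assume a: "homog k l m n a" and b: "homog k' l' m' n' b"
  note I = homog_index[OF a] homog_index[OF b]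
  have bil: "cbilinear (\<lambda>x y. x \<otimes> (S y * b))" "cbilinear (\<lambda>x y. partial_G1 I u (x \<otimes> (S y * b)))"
    by (intro clin clinear_compose[OF _ clinear_partial_G1])+
  show "partial_G1 I u (antipode_R1 (a \<otimes> b)) = antipode_R1 (a \<otimes> b)"
    unfolding antipode_R1_homog[OF b] tlift_linear[OF clinear_partial_G1 bil(1)]
  proof (rule comult_row_cong[OF a I(7) bil(2,1)])
    fix s x y assume x: "homog k l m' s x" and y: "homog m' s m n y"
    show "partial_G1 I u (x \<otimes> (S y * b)) = x \<otimes> (S y * b)"
      using partial_maps_homog(1)[OF x homog_mult[OF antipode_homog[OF y] b]] by simp
  qed
qed (intro clin clinear_compose[OF _ clinear_partial_G1])+

text \<open>\<open>a S(b(1)) b(2) \<otimes> b(3) = a u l l' \<otimes> b\<close>.\<close>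

lemma T2_antipode_R2: "T2 D (antipode_R2 z) = partial_E2 I u z"
proof (rule homog_tensor_eqI[where z = z])
  fix k l m n k' l' m' n' a b assume a: "homog k l m n a" and b: "homog k' l' m' n' b"
  note I = homog_index[OF a] homog_index[OF b]
  have bil: "cbilinear (\<lambda>x y. (a * S x) \<otimes> y)" by (intro clin)
  have "T2 D (antipode_R2 (a \<otimes> b)) = tlift (\<lambda>x y. T2 D ((a * S x) \<otimes> y)) (comult_col l b)"
    unfolding antipode_R2_homog[OF a] by (rule tlift_linear[OF clinear_T2 bil])
  also have "\<dots> = tlift (\<lambda>x y. tlift (\<lambda>y1 y2. (a * S x * y1) \<otimes> y2) (comult_row k' y)) (comult_col l b)"
  proof (rule comult_col_cong[OF b I(2)])
    fix r x y assume x: "homog k' l' r l x"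
    show "T2 D ((a * S x) \<otimes> y) = tlift (\<lambda>y1 y2. (a * S x * y1) \<otimes> y2) (comult_row k' y)"
      by (rule T2_homog[OF homog_mult[OF a antipode_homog[OF x]]])
  qed (intro clin I)+
  also have "\<dots> = tlift (\<lambda>x z. tlift (\<lambda>x1 x2. (a * S x1 * x2) \<otimes> z) (comult_col l x)) (comult_row k' b)"
    by (rule coassoc_col_row[OF I(2,5), symmetric]) (intro clin)+
  also have "\<dots> = tlift (\<lambda>x z. \<epsilon> x *\<^sub>C ((a * u l l') \<otimes> z)) (comult_row k' b)"
  proof (rule comult_row_cong[OF b I(5)])
    fix s x z assume x: "homog k' l' k' s x"
    have "tlift (\<lambda>x1 x2. (a * S x1 * x2) \<otimes> z) (comult_col l x)
        = (a * tlift (\<lambda>x1 x2. S x1 * x2) (comult_col l x)) \<otimes> z"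
      by (subst tlift_linear[where F = "\<lambda>v. (a * v) \<otimes> z"]) ((intro clin)+, simp add: mult.assoc)
    then show "tlift (\<lambda>x1 x2. (a * S x1 * x2) \<otimes> z) (comult_col l x) = \<epsilon> x *\<^sub>C ((a * u l l') \<otimes> z)"
      using homog_counit_0[OF x] by (cases "s = l'") (simp_all add: antipode_col[OF x I(2)] mult_scaleC_right tensor_scale_left)
  qed (intro clin I)+
  also have "\<dots> = (a * u l l') \<otimes> b"
    by (subst counit_comult_row(1)[OF b I(5), where F = "\<lambda>z. (a * u l l') \<otimes> z"]) (intro clin, simp)
  also have "\<dots> = partial_E2 I u (a \<otimes> b)"
    by (simp add: partial_maps_homog(4)[OF a b] homog_times_unit[OF a] I)
  finally show "T2 D (antipode_R2 (a \<otimes> b)) = partial_E2 I u (a \<otimes> b)" .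
qed (intro clin clinear_partial_E2)+

text \<open>\<open>a b(1) S(b(2)) \<otimes> b(3) = a u k' n \<otimes> b\<close>.\<close>

lemma antipode_R2_T2: "antipode_R2 (T2 D z) = partial_G2 I u z"
proof (rule homog_tensor_eqI[where z = z])
  fix k l m n k' l' m' n' a b assume a: "homog k l m n a" and b: "homog k' l' m' n' b"
  note I = homog_index[OF a] homog_index[OF b]
  have bil: "cbilinear (\<lambda>x y. (a * x) \<otimes> y)" by (intro clin)
  have "antipode_R2 (T2 D (a \<otimes> b)) = tlift (\<lambda>x y. antipode_R2 ((a * x) \<otimes> y)) (comult_row n b)"
    unfolding T2_homog[OF a] by (rule tlift_linear[OF clinear_antipode_R2 bil])
  also have "\<dots> = tlift (\<lambda>x y. tlift (\<lambda>y1 y2. (a * x * S y1) \<otimes> y2) (comult_col l' y)) (comult_row n b)"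
  proof (rule comult_row_cong[OF b I(4)])
    fix s x y assume x: "homog k' l' n s x"
    show "antipode_R2 ((a * x) \<otimes> y) = tlift (\<lambda>y1 y2. (a * x * S y1) \<otimes> y2) (comult_col l' y)"
      by (rule antipode_R2_homog[OF homog_mult[OF a x]])
  qed (intro clin I)+
  also have "\<dots> = tlift (\<lambda>x z. tlift (\<lambda>x1 x2. (a * x1 * S x2) \<otimes> z) (comult_row n x)) (comult_col l' b)"
    by (rule coassoc_row_col[OF I(4,6), symmetric]) (intro clin)+
  also have "\<dots> = tlift (\<lambda>x z. \<epsilon> x *\<^sub>C ((a * u k' n) \<otimes> z)) (comult_col l' b)"
  proof (rule comult_col_cong[OF b I(6)])
    fix r x z assume x: "homog k' l' r l' x"
    have "tlift (\<lambda>x1 x2. (a * x1 * S x2) \<otimes> z) (comult_row n x)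
        = (a * tlift (\<lambda>x1 x2. x1 * S x2) (comult_row n x)) \<otimes> z"
      by (subst tlift_linear[where F = "\<lambda>v. (a * v) \<otimes> z"]) ((intro clin)+, simp add: mult.assoc)
    then show "tlift (\<lambda>x1 x2. (a * x1 * S x2) \<otimes> z) (comult_row n x) = \<epsilon> x *\<^sub>C ((a * u k' n) \<otimes> z)"
      by (simp add: antipode_row[OF x I(4)] mult_scaleC_right tensor_scale_left)
  qed (intro clin I)+
  also have "\<dots> = (a * u k' n) \<otimes> b"
    by (subst counit_comult_col(1)[OF b I(6), where F = "\<lambda>z. (a * u k' n) \<otimes> z"]) (intro clin, simp)
  also have "\<dots> = partial_G2 I u (a \<otimes> b)"
    by (auto simp: partial_maps_homog(3)[OF a b] homog_times_unit[OF a] I)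
  finally show "antipode_R2 (T2 D (a \<otimes> b)) = partial_G2 I u (a \<otimes> b)" .
qed (intro clin clinear_partial_G2)+

lemma partial_G2_antipode_R2: "partial_G2 I u (antipode_R2 z) = antipode_R2 z"
proof (rule homog_tensor_eqI[where z = z])
  fix k l m n k' l' m' n' a b assume a: "homog k l m n a" and b: "homog k' l' m' n' b"
  note I = homog_index[OF a] homog_index[OF b]
  have bil: "cbilinear (\<lambda>x y. (a * S x) \<otimes> y)" "cbilinear (\<lambda>x y. partial_G2 I u ((a * S x) \<otimes> y))"
    by (intro clin clinear_compose[OF _ clinear_partial_G2])+
  show "partial_G2 I u (antipode_R2 (a \<otimes> b)) = antipode_R2 (a \<otimes> b)"
    unfolding antipode_R2_homog[OF a] tlift_linear[OF clinear_partial_G2 bil(1)]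
  proof (rule comult_col_cong[OF b I(2) bil(2,1)])
    fix r x y assume x: "homog k' l' r l x" and y: "homog r l m' n' y"
    show "partial_G2 I u ((a * S x) \<otimes> y) = (a * S x) \<otimes> y"
      using partial_maps_homog(3)[OF homog_mult[OF a antipode_homog[OF x]] y] by simp
  qed
qed (intro clin clinear_compose[OF _ clinear_partial_G2])+

end

declare clinear_antipode [clin del]

section \<open>From a generalized inverse to the antipode\<close>

lemma homog_sandwich:
  assumes "k \<in> I" "l \<in> I" "m \<in> I" "n \<in> I"
  shows "homog k l m n (u k m * y * u l n)"
proof -
  have "y \<in> {y. u k m * y * u l n \<in> A k l m n}"
  proof (rule subspace_homogI)
    show "csubspace {y. u k m * y * u l n \<in> A k l m n}"
      by (rule complex_vector.subspaceI)
        (simp_all add: distrib_left distrib_right mult_scaleC_left mult_scaleC_right assms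
          complex_vector.subspace_0[OF subspace_A] complex_vector.subspace_add[OF subspace_A]
          complex_vector.subspace_scale[OF subspace_A])
    fix k' l' m' n' y assume y: "homog k' l' m' n' y"
    then show "y \<in> {y. u k m * y * u l n \<in> A k l m n}"
      by (auto simp: unit_times_homog[OF y] homog_times_unit[OF y] homog_def assms
          complex_vector.subspace_0[OF subspace_A])
  qed
  then show ?thesis by (simp add: homog_def assms)
qed

context
  fixes R1 :: "'a \<otimes> 'a \<Rightarrow> 'a \<otimes> 'a"
  assumes clinear_R1: "clinear R1"
    and T1_R1: "\<And>z. T1 D (R1 z) = partial_E1 I u z"
    and R1_T1: "\<And>z. R1 (T1 D z) = partial_G1 I u z"
    and R1_T1_R1: "\<And>z. R1 (T1 D (R1 z)) = R1 z"
begin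

lemma clinear_R1_comp [clin]: "clinear f \<Longrightarrow> clinear (\<lambda>x. R1 (f x))"
  by (rule clinear_compose[OF _ clinear_R1])

text \<open>
  \<open>T1\<close> commutes with right multiplication in the second leg, hence so does its generalized inverse.
\<close>

lemma R1_right_mult:
  assumes c: "homog k l m n c"
  shows "R1 (z \<lhd> (1 \<otimes>\<^sub>M \<iota> c)) = R1 z \<lhd> (1 \<otimes>\<^sub>M \<iota> c)"
proof (rule generalized_inverse_intertwines[where R = R1 and R' = R1 and T = "T1 D" and T' = "T1 D" and y = z
      and X = "\<lambda>z. z \<lhd> (1 \<otimes>\<^sub>M \<iota> c)" and Y = "\<lambda>z. z \<lhd> (1 \<otimes>\<^sub>M \<iota> c)"])
  show "T1 D (z \<lhd> (1 \<otimes>\<^sub>M \<iota> c)) = T1 D z \<lhd> (1 \<otimes>\<^sub>M \<iota> c)" for z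
  proof (rule clinear_tensor_eqI[where x = z])
    fix a b
    have "\<iota> (T1 D (a \<otimes> b) \<lhd> (1 \<otimes>\<^sub>M \<iota> c)) = D a * ((1 \<otimes>\<^sub>M \<iota> b) * (1 \<otimes>\<^sub>M \<iota> c))"
      by (simp only: times_mult_of(2)[symmetric] T1_mult_of[symmetric] mult.assoc)
    also have "\<dots> = \<iota> (T1 D (a \<otimes> (b * c)))"
      by (simp only: mtensor_times times_mult_of mult_of_act T1_mult_of[symmetric] mult_1)
    finally show "T1 D ((a \<otimes> b) \<lhd> (1 \<otimes>\<^sub>M \<iota> c)) = T1 D (a \<otimes> b) \<lhd> (1 \<otimes>\<^sub>M \<iota> c)"
      by (auto simp: mtensor_act_pure multiplier_act mult_of_act dest: injD[OF inj_mult_of_A2])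
  qed (intro clin)+
  show "T1 D (R1 (z \<lhd> (1 \<otimes>\<^sub>M \<iota> c))) = T1 D (R1 z) \<lhd> (1 \<otimes>\<^sub>M \<iota> c)" for z
    by (simp add: T1_R1 partial_E1_eq lact_ract_commute[OF local_units(4)])
  show "R1 (T1 D (z \<lhd> (1 \<otimes>\<^sub>M \<iota> c))) = R1 (T1 D z) \<lhd> (1 \<otimes>\<^sub>M \<iota> c)" for z
    unfolding R1_T1
  proof (rule homog_tensor_eqI[where z = z])
    fix k1 l1 m1 n1 k2 l2 m2 n2 a b assume a: "homog k1 l1 m1 n1 a" and b: "homog k2 l2 m2 n2 b"
    show "partial_G1 I u ((a \<otimes> b) \<lhd> (1 \<otimes>\<^sub>M \<iota> c)) = partial_G1 I u (a \<otimes> b) \<lhd> (1 \<otimes>\<^sub>M \<iota> c)"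
      using partial_maps_homog(1)[OF a homog_mult[OF b c]] partial_maps_homog(1)[OF a b]
      by (simp add: mtensor_act_pure multiplier_act mult_of_act clinear_0[OF clinear_ract])
  qed (intro clin clinear_compose[OF _ clinear_partial_G1])+
qed (rule R1_T1_R1)+

text \<open>
  \<open>T1\<close> maps the part of the tensor square with first leg in degrees \<open>(k, l, m, _)\<close> and second leg in
  degrees \<open>(s, _, _, _)\<close> to the part with first leg in degrees \<open>(k, l, _, s)\<close> and second leg in degrees
  \<open>(_, _, m, _)\<close>. The maps \<open>deg_in\<close> and \<open>deg_out\<close> are the projections onto these two parts.
\<close>

definition deg_in :: "'i \<Rightarrow> 'i \<Rightarrow> 'i \<Rightarrow> 'i \<Rightarrow> 'a \<otimes> 'a \<Rightarrow> 'a \<otimes> 'a" where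
  "deg_in k l m s z = ((\<iota> (u k m) \<otimes>\<^sub>M lam s) \<rhd> z) \<lhd> (lam l \<otimes>\<^sub>M 1)"

definition deg_out :: "'i \<Rightarrow> 'i \<Rightarrow> 'i \<Rightarrow> 'i \<Rightarrow> 'a \<otimes> 'a \<Rightarrow> 'a \<otimes> 'a" where
  "deg_out k l m s z = ((lam k \<otimes>\<^sub>M rho m) \<rhd> z) \<lhd> (\<iota> (u l s) \<otimes>\<^sub>M 1)"

lemma clinear_deg: "clinear (deg_in k l m s)" "clinear (deg_out k l m s)"
  unfolding deg_in_def deg_out_def by (intro clin)+

lemma deg_homog:
  assumes a: "homog k1 l1 m1 n1 a" and b: "homog k2 l2 m2 n2 b" and I: "k \<in> I" "l \<in> I" "m \<in> I" "s \<in> I"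
  shows "deg_in k l m s (a \<otimes> b) = (if k = k1 \<and> l = l1 \<and> m = m1 \<and> s = k2 then a \<otimes> b else 0)"
    "deg_out k l m s (a \<otimes> b) = (if k = k1 \<and> l = l1 \<and> s = n1 \<and> m = m2 then a \<otimes> b else 0)"
  by (auto simp: deg_in_def deg_out_def mtensor_act_pure multiplier_act mult_of_act I homog_index[OF a] homog_index[OF b]
      lam_rho_homog[OF a] lam_rho_homog[OF b] unit_times_homog[OF a] homog_times_unit[OF a] clinear_0[OF clinear_ract])

lemma R1_deg:
  assumes I: "k \<in> I" "l \<in> I" "m \<in> I" "s \<in> I"
  shows "R1 (deg_out k l m s z) = deg_in k l m s (R1 z)"
proof (rule generalized_inverse_intertwines[where R = R1 and R' = R1 and T = "T1 D" and T' = "T1 D" and y = z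
      and X = "deg_in k l m s" and Y = "deg_out k l m s"])
  show "T1 D (deg_in k l m s z) = deg_out k l m s (T1 D z)" for z
  proof (rule homog_tensor_eqI[where z = z])
    fix k1 l1 m1 n1 k2 l2 m2 n2 a b assume a: "homog k1 l1 m1 n1 a" and b: "homog k2 l2 m2 n2 b"
    define P where "P \<longleftrightarrow> k = k1 \<and> l = l1 \<and> m = m1 \<and> s = k2"
    have bil: "cbilinear (\<lambda>x y. x \<otimes> (y * b))" "cbilinear (\<lambda>x y. deg_out k l m s (x \<otimes> (y * b)))"
      by (intro clin clinear_compose[OF _ clinear_deg(2)])+
    have bil': "cbilinear (\<lambda>x y. if P then x \<otimes> (y * b) else 0)"
      by (cases P; simp; intro clin)
    have "deg_out k l m s (T1 D (a \<otimes> b)) = tlift (\<lambda>x y. deg_out k l m s (x \<otimes> (y * b))) (comult_col k2 a)"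
      unfolding T1_homog[OF b] by (rule tlift_linear[OF clinear_deg(2) bil(1)])
    also have "\<dots> = tlift (\<lambda>x y. if P then x \<otimes> (y * b) else 0) (comult_col k2 a)"
    proof (rule comult_col_cong[OF a homog_index(1)[OF b] bil(2) bil'])
      fix r x y assume x: "homog k1 l1 r k2 x" and y: "homog r k2 m1 n1 y"
      show "deg_out k l m s (x \<otimes> (y * b)) = (if P then x \<otimes> (y * b) else 0)"
        using deg_homog(2)[OF x homog_mult[OF y b] I] by (auto simp: P_def)
    qed
    also have "\<dots> = T1 D (deg_in k l m s (a \<otimes> b))"
      by (simp add: deg_homog(1)[OF a b I] T1_homog[OF b] P_def[symmetric] tlift_zero clinear_0[OF clinear_T1])
    finally show "T1 D (deg_in k l m s (a \<otimes> b)) = deg_out k l m s (T1 D (a \<otimes> b))" by simp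
  qed (intro clin clinear_compose[OF _ clinear_deg(2)] clinear_deg)+
  show "T1 D (R1 (deg_out k l m s z)) = deg_out k l m s (T1 D (R1 z))" for z
    unfolding T1_R1
    by (rule homog_tensor_eqI[where z = z], intro clinear_compose[OF clinear_deg(2) clinear_partial_E1],
        intro clinear_compose[OF clinear_partial_E1 clinear_deg(2)])
      (simp add: deg_homog I partial_maps_homog clinear_0[OF clinear_deg(2)] clinear_0[OF clinear_partial_E1])
  show "R1 (T1 D (deg_in k l m s z)) = deg_in k l m s (R1 (T1 D z))" for z
    unfolding R1_T1
    by (rule homog_tensor_eqI[where z = z], intro clinear_compose[OF clinear_deg(1) clinear_partial_G1],
        intro clinear_compose[OF clinear_partial_G1 clinear_deg(1)])
      (simp add: deg_homog I partial_maps_homog clinear_0[OF clinear_deg(1)] clinear_0[OF clinear_partial_G1])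
qed (rule R1_T1_R1)+

text \<open>
  This is \<open>comult_row p \<otimes> id\<close>, the left coaction for which \<open>T1\<close> is a comodule map.
\<close>

definition row_left :: "'i \<Rightarrow> 'a \<otimes> 'a \<Rightarrow> 'a \<otimes> ('a \<otimes> 'a)" where
  "row_left p = tlift (\<lambda>a b. tlift (\<lambda>x y. x \<otimes> (y \<otimes> b)) (comult_row p a))"

lemma
  assumes "p \<in> I"
  shows clinear_row_left: "clinear (row_left p)"
    and row_left_pure: "row_left p (a \<otimes> b) = tlift (\<lambda>x y. x \<otimes> (y \<otimes> b)) (comult_row p a)"
proof -
  have bil: "cbilinear (\<lambda>a b. tlift (\<lambda>x y. x \<otimes> (y \<otimes> b)) (comult_row p a))" by (intro clin assms)
  show "clinear (row_left p)" unfolding row_left_def by (rule clinear_tlift[OF bil])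
  show "row_left p (a \<otimes> b) = tlift (\<lambda>x y. x \<otimes> (y \<otimes> b)) (comult_row p a)"
    unfolding row_left_def by (rule tlift_pure[OF bil])
qed

lemma tmap_row_left:
  assumes p: "p \<in> I" and F: "clinear F"
  shows "tmap (\<lambda>x. x) F (row_left p (a \<otimes> b)) = tlift (\<lambda>x y. x \<otimes> F (y \<otimes> b)) (comult_row p a)"
  unfolding row_left_pure[OF p]
  by (subst tlift_linear[OF clinear_tmap[OF clinear_id F]]) (intro clin, simp add: tmap_pure clinear_id F)

lemma tmap_id_comp:
  assumes "clinear f" "clinear g" "\<And>x. f (g x) = h x"
  shows "tmap (\<lambda>x. x) f (tmap (\<lambda>x. x) g w) = tmap (\<lambda>x. x) h w"
proof -
  have h: "clinear h" using clinear_compose[OF assms(2,1)] assms(3) by simp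
  show ?thesis
    by (rule clinear_tensor_eqI[where x = w]) (intro clin assms h | simp add: tmap_pure clinear_id assms h)+
qed

text \<open>
  For \<open>T1\<close> the compatibility with the coaction is coassociativity for a row and a column; the coaction
  keeps the lower indices of the first leg and does not touch the second leg, and these carry the
  indices tested by \<open>partial_E1\<close> and \<open>partial_G1\<close>. So \<open>R1\<close> is compatible with the coaction as well.
\<close>

lemma R1_row_left:
  assumes p: "p \<in> I"
  shows "tmap (\<lambda>x. x) R1 (row_left p z) = row_left p (R1 z)"
proof (rule generalized_inverse_intertwines[where R = R1 and R' = "tmap (\<lambda>x. x) R1" and T = "T1 D"
      and T' = "tmap (\<lambda>x. x) (T1 D)" and y = z and X = "row_left p" and Y = "row_left p"])
  show "R1 (T1 D (R1 x)) = R1 x" for x by (rule R1_T1_R1)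
  show "tmap (\<lambda>x. x) R1 (tmap (\<lambda>x. x) (T1 D) (tmap (\<lambda>x. x) R1 x)) = tmap (\<lambda>x. x) R1 x" for x :: "'a \<otimes> ('a \<otimes> 'a)"
    by (subst tmap_id_comp[OF clinear_T1 clinear_R1 T1_R1], rule tmap_id_comp[OF clinear_R1 clinear_partial_E1])
      (metis T1_R1 R1_T1_R1)
  note lin = clinear_row_left[OF p]
  show "tmap (\<lambda>x. x) (T1 D) (row_left p z) = row_left p (T1 D z)" for z
  proof (rule homog_tensor_eqI[where z = z])
    fix k l m n k' l' m' n' a b assume a: "homog k l m n a" and b: "homog k' l' m' n' b"
    have s: "k' \<in> I" using homog_index[OF b] by simp
    have "tmap (\<lambda>x. x) (T1 D) (row_left p (a \<otimes> b))
        = tlift (\<lambda>x y. tlift (\<lambda>y1 y2. x \<otimes> (y1 \<otimes> (y2 * b))) (comult_col k' y)) (comult_row p a)"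
      unfolding tmap_row_left[OF p clinear_T1] T1_homog[OF b]
      by (subst tlift_linear[where F = "\<lambda>w. c \<otimes> w" for c]) ((intro clin)+, simp)
    also have "\<dots> = tlift (\<lambda>x z. tlift (\<lambda>x1 x2. x1 \<otimes> (x2 \<otimes> (z * b))) (comult_row p x)) (comult_col k' a)"
      by (rule coassoc_row_col[OF p s, symmetric]) (intro clin)+
    also have "\<dots> = row_left p (T1 D (a \<otimes> b))"
      unfolding T1_homog[OF b]
      by (subst tlift_linear[OF lin]) (intro clin, simp add: row_left_pure[OF p])
    finally show "tmap (\<lambda>x. x) (T1 D) (row_left p (a \<otimes> b)) = row_left p (T1 D (a \<otimes> b))" .
  qed (intro clin clinear_T1 lin clinear_compose[OF _ lin])+
  have tmap_lin: "clinear (\<lambda>z. tmap (\<lambda>x. x) F (row_left p z))" if "clinear F" for F :: "'a \<otimes> 'a \<Rightarrow> 'a \<otimes> 'a"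
    by (rule clinear_compose[OF lin clinear_tmap[OF clinear_id that]])
  have bil: "cbilinear (\<lambda>x y. if P then x \<otimes> (y \<otimes> (b::'a)) else 0)" for P and b
    by (cases P; simp; intro clin)
  have graded: "tmap (\<lambda>x. x) F (row_left p z) = row_left p (F z)"
    if F: "clinear F" and P: "\<And>k l m n k' l' m' n' a b. homog k l m n a \<Longrightarrow> homog k' l' m' n' b \<Longrightarrow>
      F (a \<otimes> b) = (if P m n k' m' then a \<otimes> b else 0)" for F P z
  proof (rule homog_tensor_eqI[where z = z])
    fix k l m n k' l' m' n' a b assume a: "homog k l m n a" and b: "homog k' l' m' n' b"
    have "tlift (\<lambda>x y. x \<otimes> F (y \<otimes> b)) (comult_row p a)
        = tlift (\<lambda>x y. if P m n k' m' then x \<otimes> (y \<otimes> b) else 0) (comult_row p a)"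
      by (rule comult_row_cong[OF a p _ bil]) (intro clin clinear_compose[OF _ F], auto simp: P[OF _ b])
    then show "tmap (\<lambda>x. x) F (row_left p (a \<otimes> b)) = row_left p (F (a \<otimes> b))"
      unfolding tmap_row_left[OF p F] P[OF a b] by (simp add: tlift_if row_left_pure[OF p] clinear_0[OF lin])
  qed (rule tmap_lin[OF F], rule clinear_compose[OF F lin])
  note E = graded[OF clinear_partial_E1 partial_maps_homog(2)] and G = graded[OF clinear_partial_G1 partial_maps_homog(1)]
  show "tmap (\<lambda>x. x) (T1 D) (tmap (\<lambda>x. x) R1 (row_left p y)) = row_left p (T1 D (R1 y))" for y
    by (subst tmap_id_comp[OF clinear_T1 clinear_R1 T1_R1]) (simp add: E T1_R1)
  show "tmap (\<lambda>x. x) R1 (tmap (\<lambda>x. x) (T1 D) (row_left p x)) = row_left p (R1 (T1 D x))" for x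
    by (subst tmap_id_comp[OF clinear_R1 clinear_T1 R1_T1]) (simp add: G R1_T1)
qed

text \<open>
  If \<open>R1 (a \<otimes> b)\<close> is to be \<open>a(1) \<otimes> S(a(2)) b\<close>, then this is \<open>S(a) b\<close>.
\<close>

definition counit_R1 :: "'a \<Rightarrow> 'a \<Rightarrow> 'a" where
  "counit_R1 a b = tlift (\<lambda>x y. \<epsilon> x *\<^sub>C y) (R1 (a \<otimes> b))"

lemma bilinear_counit: "cbilinear (\<lambda>x y. \<epsilon> x *\<^sub>C (y::'a))"
  by (intro clin)

lemma clinear_counit_R1 [clin]:
  "clinear f \<Longrightarrow> clinear (\<lambda>x. counit_R1 (f x) b)" "clinear f \<Longrightarrow> clinear (\<lambda>x. counit_R1 a (f x))"
  unfolding counit_R1_def by (intro clin; assumption)+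

lemma counit_R1_mult: "homog k l m n c \<Longrightarrow> counit_R1 a (b * c) = counit_R1 a b * c"
proof -
  assume c: "homog k l m n c"
  have "tlift (\<lambda>x y. \<epsilon> x *\<^sub>C y) (w \<lhd> (1 \<otimes>\<^sub>M \<iota> c)) = tlift (\<lambda>x y. \<epsilon> x *\<^sub>C y) w * c" for w
    by (rule clinear_tensor_eqI[where x = w])
      (intro clin | simp add: tlift_pure bilinear_counit mtensor_act_pure multiplier_act mult_of_act mult_scaleC_left)+
  with R1_right_mult[OF c, of "a \<otimes> b"] show ?thesis
    by (simp add: counit_R1_def mtensor_act_pure multiplier_act mult_of_act)
qed

text \<open>
  Applying the counit to the middle leg of the compatibility of \<open>R1\<close> with the coaction recovers \<open>R1\<close>
  from the slices \<open>counit_R1\<close>.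
\<close>

lemma counit_R1_row:
  assumes p: "p \<in> I"
  shows "tlift (\<lambda>x y. x \<otimes> counit_R1 y b) (comult_row p a) = (rho p \<otimes>\<^sub>M 1) \<rhd> R1 (a \<otimes> b)"
proof -
  define c where "c = tlift (\<lambda>x y. \<epsilon> x *\<^sub>C (y::'a))"
  have c: "clinear c" unfolding c_def by (rule clinear_tlift[OF bilinear_counit])
  have c_pure: "c (x \<otimes> y) = \<epsilon> x *\<^sub>C y" for x y unfolding c_def by (rule tlift_pure[OF bilinear_counit])
  have "tlift (\<lambda>x y. x \<otimes> counit_R1 y b) (comult_row p a) = tmap (\<lambda>x. x) c (tmap (\<lambda>x. x) R1 (row_left p (a \<otimes> b)))"
    by (subst tmap_id_comp[OF c clinear_R1 refl], subst tmap_row_left[OF p clinear_compose[OF clinear_R1 c]])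
      (simp add: counit_R1_def c_def)
  also have "\<dots> = tmap (\<lambda>x. x) c (row_left p (R1 (a \<otimes> b)))"
    by (simp add: R1_row_left[OF p])
  also have "\<dots> = (rho p \<otimes>\<^sub>M 1) \<rhd> R1 (a \<otimes> b)"
  proof (rule homog_tensor_eqI[where z = "R1 (a \<otimes> b)"])
    fix k l m n k' l' m' n' x y assume x: "homog k l m n x" and y: "homog k' l' m' n' y"
    have "tmap (\<lambda>x. x) c (row_left p (x \<otimes> y)) = tlift (\<lambda>x1 x2. \<epsilon> x2 *\<^sub>C (x1 \<otimes> y)) (comult_row p x)"
      by (simp add: tmap_row_left[OF p c] c_pure tensor_scale_right)
    also have "\<dots> = (if p = m then x \<otimes> y else 0)"
      by (rule counit_comult_row(2)[OF x p]) (intro clin)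
    also have "\<dots> = (rho p \<otimes>\<^sub>M 1) \<rhd> (x \<otimes> y)"
      by (simp add: mtensor_act_pure multiplier_act lam_rho_homog[OF x p])
    finally show "tmap (\<lambda>x. x) c (row_left p (x \<otimes> y)) = (rho p \<otimes>\<^sub>M 1) \<rhd> (x \<otimes> y)" .
  qed (rule clinear_compose[OF clinear_row_left[OF p] clinear_tmap[OF clinear_id c]], intro clin)
  finally show ?thesis .
qed

lemma R1_partial_E1: "R1 (partial_E1 I u z) = R1 z"
  by (metis T1_R1 R1_T1_R1)

lemma partial_G1_R1: "partial_G1 I u (R1 z) = R1 z"
  by (metis R1_T1 R1_T1_R1)

lemma R1_homog:
  assumes a: "homog k l m n a" and b: "homog k' l' m' n' b"
  shows "R1 (a \<otimes> b) = deg_in k l m' n (partial_G1 I u (R1 (a \<otimes> b)))"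
  using R1_deg[of k l m' n "a \<otimes> b"] homog_index[OF a] homog_index[OF b]
  by (simp add: deg_homog[OF a b] partial_G1_R1)

text \<open>
  The degrees of \<open>a\<close> and \<open>b\<close> determine those of \<open>R1 (a \<otimes> b)\<close> up to the lower right index of the first
  leg, which \<open>partial_G1\<close> ties to the lower left index of the second leg. Applying the counit to the
  first leg forces its upper and lower indices to agree.
\<close>

lemma counit_R1_homog:
  assumes a: "homog k l m n a" and b: "homog k' l' m' n' b"
  shows "counit_R1 a b = (if m = k' \<and> k = m' then u n l * counit_R1 a b else 0)"
proof -
  note I = homog_index[OF a] homog_index[OF b]
  define w where "w = R1 (a \<otimes> b)"
  define c where "c = tlift (\<lambda>x y. \<epsilon> x *\<^sub>C (y::'a))"
  have c: "clinear c" unfolding c_def by (rule clinear_tlift[OF bilinear_counit])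
  have c_pure: "c (x \<otimes> y) = \<epsilon> x *\<^sub>C y" for x y unfolding c_def by (rule tlift_pure[OF bilinear_counit])
  have lin: "clinear (\<lambda>w. c (deg_in k l m' n (partial_G1 I u w)))"
    by (intro clinear_compose[OF _ c] clinear_compose[OF _ clinear_deg(1)] clinear_partial_G1)
  have "c (deg_in k l m' n (partial_G1 I u w)) = (if k = m' then u n l * c (deg_in k l m' n (partial_G1 I u w)) else 0)"
  proof (rule homog_tensor_eqI[where z = w, OF lin])
    show "clinear (\<lambda>w. if k = m' then u n l * c (deg_in k l m' n (partial_G1 I u w)) else 0)"
    proof (cases "k = m'")
      case True
      then show ?thesis unfolding if_P[OF True] by (intro clin lin)
    next
      case False
      then show ?thesis unfolding if_not_P[OF False] by (intro clin)
    qed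
    fix k1 l1 m1 n1 k2 l2 m2 n2 x y assume x: "homog k1 l1 m1 n1 x" and y: "homog k2 l2 m2 n2 y"
    show "c (deg_in k l m' n (partial_G1 I u (x \<otimes> y)))
        = (if k = m' then u n l * c (deg_in k l m' n (partial_G1 I u (x \<otimes> y))) else 0)"
      using homog_counit_0[OF x] homog_index[OF y] homog_index[OF x]
      by (cases "l1 = m2")
        (auto simp: partial_maps_homog(1)[OF x y] deg_homog(1)[OF x y] I c_pure mult_scaleC_right
          unit_times_homog[OF y] clinear_0[OF clinear_deg(1)] clinear_0[OF c])
  qed
  moreover have "deg_in k l m' n (partial_G1 I u w) = w"
    unfolding w_def by (rule R1_homog[OF a b, symmetric])
  ultimately have "c w = (if k = m' then u n l * c w else 0)" by (simp only:)
  then have "counit_R1 a b = (if k = m' then u n l * counit_R1 a b else 0)"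
    by (simp only: counit_R1_def c_def w_def)
  moreover have "counit_R1 a b = 0" if "m \<noteq> k'"
    using that R1_partial_E1[of "a \<otimes> b"]
    by (simp add: counit_R1_def partial_maps_homog(2)[OF a b] clinear_0[OF clinear_R1]
        clinear_0[OF clinear_tlift[OF bilinear_counit]])
  ultimately show ?thesis by auto
qed

text \<open>
  An element \<open>S a\<close> of degree \<open>(n, m, l, k)\<close> is recovered from the products \<open>S a * b\<close> by taking
  \<open>b = u m k\<close>; the sum extends this rule from homogeneous \<open>a\<close> to all of the algebra.
\<close>

definition antipode_of_R1 :: "'a \<Rightarrow> 'a" where
  "antipode_of_R1 a = supp_sum (\<lambda>(k, m). counit_R1 (u k m * a) (u m k)) (I \<times> I)"

lemma clinear_antipode_of_R1: "clinear antipode_of_R1"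
proof -
  have lin: "clinear (\<lambda>a. case j of (k, m) \<Rightarrow> counit_R1 (u k m * a) (u m k))" for j
    by (cases j; simp; intro clin)
  have "finite {j \<in> I \<times> I. (case j of (k, m) \<Rightarrow> counit_R1 (u k m * a) (u m k)) \<noteq> 0}" for a
  proof (rule finite_support_homog[OF lin])
    fix k l m n a assume a: "homog k l m n a"
    have "{j \<in> I \<times> I. (case j of (k, m) \<Rightarrow> counit_R1 (u k m * a) (u m k)) \<noteq> 0} \<subseteq> {(k, m)}"
      by (auto simp: unit_times_homog[OF a] clinear_0[OF clinear_counit_R1(1)[OF clinear_id]] split: if_splits)
    then show "finite {j \<in> I \<times> I. (case j of (k, m) \<Rightarrow> counit_R1 (u k m * a) (u m k)) \<noteq> 0}"
      by (rule finite_subset) simp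
  qed
  then show ?thesis
    unfolding antipode_of_R1_def[abs_def] by (rule clinear_supp_sum[OF lin])
qed

lemma antipode_of_R1_homog:
  assumes a: "homog k l m n a"
  shows "antipode_of_R1 a = counit_R1 a (u m k)"
  unfolding antipode_of_R1_def using homog_index[OF a]
  by (subst supp_sum_single[where i = "(k, m)"])
    (auto simp: unit_times_homog[OF a] clinear_0[OF clinear_counit_R1(1)[OF clinear_id]] split: if_splits)

lemma homog_antipode_of_R1:
  assumes a: "homog k l m n a"
  shows "homog n m l k (antipode_of_R1 a)"
proof -
  note I = homog_index[OF a]
  note U = homog_unit[OF I(3,1)]
  have "counit_R1 a (u m k) = u n l * counit_R1 a (u m k)"
    using counit_R1_homog[OF a U] by simp
  moreover have "counit_R1 a (u m k) = counit_R1 a (u m k) * u m k"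
    using counit_R1_mult[OF U, of a "u m k"] by (simp add: unit_times_homog[OF U] I)
  ultimately have "counit_R1 a (u m k) = u n l * counit_R1 a (u m k) * u m k"
    by simp
  then show ?thesis using homog_sandwich[of n m l k "counit_R1 a (u m k)"] I
    by (simp add: antipode_of_R1_homog[OF a])
qed

lemma antipode_of_R1_times:
  assumes a: "homog k l m n a" and b: "homog k' l' m' n' b"
  shows "antipode_of_R1 a * b = counit_R1 a b"
proof (cases "m = k' \<and> k = m'")
  case True
  then have "u m k * b = b" using homog_index[OF a] by (simp add: unit_times_homog[OF b])
  then show ?thesis using counit_R1_mult[OF b, of a "u m k"] by (simp add: antipode_of_R1_homog[OF a])
next
  case False
  then show ?thesis using homog_mult_0[OF homog_antipode_of_R1[OF a] b] counit_R1_homog[OF a b] by auto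
qed

lemma R1_eq_antipode:
  assumes a: "homog k l m n a" and b: "homog k' l' m' n' b"
  shows "R1 (a \<otimes> b) = tlift (\<lambda>x y. x \<otimes> (antipode_of_R1 y * b)) (comult_row m' a)"
proof -
  note I = homog_index[OF a] homog_index[OF b]
  have S [clin]: "clinear f \<Longrightarrow> clinear (\<lambda>x. antipode_of_R1 (f x))" for f :: "'a \<Rightarrow> 'a"
    by (rule clinear_compose[OF _ clinear_antipode_of_R1])
  have lin: "clinear (\<lambda>w. deg_in k l m' n w)" by (rule clinear_deg)
  have "(rho m' \<otimes>\<^sub>M 1) \<rhd> deg_in k l m' n w = deg_in k l m' n w" for w
  proof (rule homog_tensor_eqI[where z = w])
    fix k1 l1 m1 n1 k2 l2 m2 n2 x y assume x: "homog k1 l1 m1 n1 x" and y: "homog k2 l2 m2 n2 y"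
    show "(rho m' \<otimes>\<^sub>M 1) \<rhd> deg_in k l m' n (x \<otimes> y) = deg_in k l m' n (x \<otimes> y)"
      by (auto simp: deg_homog(1)[OF x y] I homog_index[OF x] mtensor_act_pure multiplier_act lam_rho_homog[OF x] clinear_0[OF clinear_lact])
  qed (intro clin lin)+
  then have "R1 (a \<otimes> b) = (rho m' \<otimes>\<^sub>M 1) \<rhd> R1 (a \<otimes> b)"
    using R1_homog[OF a b] by metis
  also have "\<dots> = tlift (\<lambda>x y. x \<otimes> counit_R1 y b) (comult_row m' a)"
    by (rule counit_R1_row[OF I(7), symmetric])
  also have "\<dots> = tlift (\<lambda>x y. x \<otimes> (antipode_of_R1 y * b)) (comult_row m' a)"
    by (rule comult_row_cong[OF a I(7)]) (intro clin | simp add: antipode_of_R1_times[OF _ b])+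
  finally show ?thesis .
qed

text \<open>
  By \<open>counit_T1\<close>, multiplying the two legs is the same as applying the counit to the first leg after
  \<open>T1\<close>. Hence the first identity is \<open>T1 R1 = E1\<close>, sliced by the counit, at \<open>a \<otimes> u m r\<close>, and the second
  one is \<open>R1 T1 = G1\<close>, sliced by the counit, at \<open>a \<otimes> u s n\<close>.
\<close>

lemma partial_antipode_of_R1: "partial_antipode I A u \<Delta> \<epsilon> antipode_of_R1"
proof -
  have S [clin]: "clinear f \<Longrightarrow> clinear (\<lambda>x. antipode_of_R1 (f x))" for f :: "'a \<Rightarrow> 'a"
    by (rule clinear_compose[OF _ clinear_antipode_of_R1])
  define c where "c = tlift (\<lambda>x y. \<epsilon> x *\<^sub>C (y::'a))"
  have c: "clinear c" unfolding c_def by (rule clinear_tlift[OF bilinear_counit])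
  have c_pure: "c (x \<otimes> y) = \<epsilon> x *\<^sub>C y" for x y unfolding c_def by (rule tlift_pure[OF bilinear_counit])
  have row: "supp_sum (\<lambda>s. tlift (\<lambda>x y. x * antipode_of_R1 y) (\<Delta> r s a)) I = (if k = m then \<epsilon> a *\<^sub>C u k r else 0)"
    if I: "k \<in> I" "l \<in> I" "m \<in> I" "r \<in> I" and "a \<in> A k l m l" for k l m r a
  proof -
    have a: "homog k l m l a" using that by (simp add: homog_def)
    have U: "homog m m r r (u m r)" using I by (intro homog_unit)
    have b: "cbilinear (\<lambda>x y. x * antipode_of_R1 y)" "cbilinear (\<lambda>x y. x * antipode_of_R1 y * u m r)"
      "cbilinear (\<lambda>x y. x \<otimes> (antipode_of_R1 y * u m r))" "cbilinear (\<lambda>x y. x * (y::'a))" by (intro clin)+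
    have "supp_sum (\<lambda>s. tlift (\<lambda>x y. x * antipode_of_R1 y) (\<Delta> r s a)) I = tlift (\<lambda>x y. x * antipode_of_R1 y) (comult_row r a)"
      by (rule linear_comult_row[OF I(4) clinear_tlift[OF b(1)], symmetric])
    \<comment> \<open>every \<open>S y\<close> ends in the unit \<open>u m r\<close>, which provides the second argument of \<open>R1\<close>\<close>
    also have "\<dots> = tlift (\<lambda>x y. x * antipode_of_R1 y * u m r) (comult_row r a)"
    proof (rule comult_row_cong[OF a I(4) b(1,2)])
      fix s x y assume x: "homog k l r s x" and y: "homog r s m l y"
      show "x * antipode_of_R1 y = x * antipode_of_R1 y * u m r"
        by (simp add: mult.assoc homog_times_unit[OF homog_antipode_of_R1[OF y]] I)
    qed
    also have "\<dots> = tlift (*) (tlift (\<lambda>x y. x \<otimes> (antipode_of_R1 y * u m r)) (comult_row r a))"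
      by (subst tlift_linear[OF clinear_tlift[OF b(4)] b(3)]) (simp add: tlift_pure[OF b(4)] mult.assoc)
    also have "\<dots> = c (T1 D (R1 (a \<otimes> u m r)))"
      by (simp only: R1_eq_antipode[OF a U, symmetric] counit_T1 c_def)
    also have "\<dots> = \<epsilon> a *\<^sub>C u m r"
      by (simp add: T1_R1 partial_maps_homog(2)[OF a U] c_pure)
    also have "\<dots> = (if k = m then \<epsilon> a *\<^sub>C u k r else 0)"
      using homog_counit_0[OF a] by auto
    finally show ?thesis .
  qed
  have col: "supp_sum (\<lambda>r. tlift (\<lambda>x y. antipode_of_R1 x * y) (\<Delta> r s a)) I = (if l = n then \<epsilon> a *\<^sub>C u s n else 0)"
    if I: "k \<in> I" "l \<in> I" "n \<in> I" "s \<in> I" and "a \<in> A k l k n" for k l n s a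
  proof -
    have a: "homog k l k n a" using that by (simp add: homog_def)
    have U: "homog s s n n (u s n)" using I by (intro homog_unit)
    have b: "cbilinear (\<lambda>x y. antipode_of_R1 x * y)" "cbilinear (\<lambda>x y. c (R1 (x \<otimes> (y * u s n))))"
      "cbilinear (\<lambda>x y. x \<otimes> (y * u s n))" by (intro clin clinear_compose[OF _ c])+
    have "supp_sum (\<lambda>r. tlift (\<lambda>x y. antipode_of_R1 x * y) (\<Delta> r s a)) I = tlift (\<lambda>x y. antipode_of_R1 x * y) (comult_col s a)"
      by (rule linear_comult_col[OF I(4) clinear_tlift[OF b(1)], symmetric])
    also have "\<dots> = tlift (\<lambda>x y. c (R1 (x \<otimes> (y * u s n)))) (comult_col s a)"
    proof (rule comult_col_cong[OF a I(4) b(1,2)])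
      fix r x y assume x: "homog k l r s x" and y: "homog r s k n y"
      show "antipode_of_R1 x * y = c (R1 (x \<otimes> (y * u s n)))"
        by (simp add: homog_times_unit[OF y] I antipode_of_R1_times[OF x y] counit_R1_def c_def)
    qed
    also have "\<dots> = c (R1 (T1 D (a \<otimes> u s n)))"
      unfolding T1_homog[OF U] by (rule tlift_linear[OF clinear_compose[OF clinear_R1 c] b(3), symmetric])
    also have "\<dots> = \<epsilon> a *\<^sub>C u s n"
      by (simp add: R1_T1 partial_maps_homog(1)[OF a U] c_pure)
    also have "\<dots> = (if l = n then \<epsilon> a *\<^sub>C u s n else 0)"
      using homog_counit_0[OF a] by auto
    finally show ?thesis .
  qed
  have closed: "antipode_of_R1 ` A k l m n \<subseteq> A n m l k" if "k \<in> I" "l \<in> I" "m \<in> I" "n \<in> I" for k l m n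
    using homog_antipode_of_R1[of k l m n] that by (auto simp: homog_def)
  show ?thesis
    unfolding partial_antipode_def by (intro conjI ballI clinear_antipode_of_R1 closed row col; assumption)
qed

end

declare clinear_R1_comp [clin del]

section \<open>The weak multiplier Hopf structure\<close>

lemma idempotent: "idempotent_algebra TYPE('a)"
  unfolding idempotent_algebra_def
proof (intro set_eqI iffI)
  fix a :: 'a
  obtain e where "e * a = a" using local_units(2) by blast
  then show "a \<in> cspan {a * b | a b :: 'a. True}"
    by (intro complex_vector.span_base) (metis (mono_tags, lifting) mem_Collect_eq)
qed simp

lemma nondegenerate: "nondegenerate_algebra TYPE('a)"
  unfolding nondegenerate_algebra_def by (metis local_units(1,2))

lemma total_comult_act:
  assumes y: "homog k' l' m' n' y"
  shows "D a \<rhd> (x \<otimes> y) = tlift (\<lambda>x0 y0. (x0 * x) \<otimes> (y0 * y)) (comult_col k' a)"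
proof -
  have k': "k' \<in> I" using homog_index[OF y] by simp
  have "D a \<rhd> (x \<otimes> y) = (D a * (1 \<otimes>\<^sub>M lam k')) \<rhd> (x \<otimes> y)"
    by (simp add: multiplier_act mtensor_act_pure lam_rho_homog[OF y k'])
  then show ?thesis by (simp add: total_comult_times k' mult_of_act times_tensor_pure_right)
qed

lemma T1_times: "T1 D (a \<otimes> b) * (x \<otimes> y) = D a \<rhd> (x \<otimes> (b * y))"
proof -
  have "\<iota> (T1 D (a \<otimes> b)) \<rhd> (x \<otimes> y) = (D a * (1 \<otimes>\<^sub>M \<iota> b)) \<rhd> (x \<otimes> y)" by (simp only: T1_mult_of)
  then show ?thesis by (simp add: multiplier_act mult_of_act mtensor_act_pure)
qed

lemma times_T2: "(x \<otimes> y) * T2 D (a \<otimes> b) = ((x * a) \<otimes> y) \<lhd> D b"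
proof -
  have "(x \<otimes> y) \<lhd> \<iota> (T2 D (a \<otimes> b)) = (x \<otimes> y) \<lhd> ((\<iota> a \<otimes>\<^sub>M 1) * D b)" by (simp only: T2_mult_of)
  then show ?thesis by (simp add: multiplier_act mult_of_act mtensor_act_pure)
qed

text \<open>
  Locally \<open>E0\<close> is one of the multipliers \<open>D (u k m')\<close>. This is the form in which \<open>E0 = D(1)\<close> is used.
\<close>

lemma total_comult_unit_act:
  assumes x: "homog k l m n x" and y: "homog k' l' m' n' y"
  shows "D (u k m') \<rhd> (x \<otimes> y) = E0 \<rhd> (x \<otimes> y)"
proof -
  note I = homog_index[OF x] homog_index[OF y]
  have bil: "cbilinear (\<lambda>x0 y0. (x0 * x) \<otimes> (y0 * y))" by (intro clin)
  have "comult_col k' (u k m') = u k k' \<otimes> u k' m'"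
    unfolding comult_col_def by (subst supp_sum_single[where i = k']) (auto simp: comult_unit I)
  then show ?thesis
    by (simp add: total_comult_act[OF y] tlift_pure[OF bil] canonical_idempotent_homog(1)[OF x y]
        unit_times_homog[OF x] unit_times_homog[OF y] I)
qed

lemma idempotent_E0: "E0 * E0 = E0"
  by (rule homog_multiplier_tensor_eqI) (simp add: multiplier_act canonical_idempotent_homog clinear_0[OF clinear_lact])

text \<open>
  The second legs of the column \<open>n\<close> of \<open>a\<close> have \<open>u n n\<close> as right unit, so multiplication by this unit
  changes nothing and the counit axiom applies.
\<close>

lemma counit_T1_unit:
  assumes a: "homog k l m n a" and F: "clinear F"
  shows "tlift (\<lambda>x y. \<epsilon> y *\<^sub>C F x) (T1 D (a \<otimes> u n n)) = F a"
proof -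
  note I = homog_index[OF a]
  have U: "homog n n n n (u n n)" by (rule homog_unit[OF I(4,4)])
  have b: "cbilinear (\<lambda>x y. \<epsilon> y *\<^sub>C F x)" "cbilinear (\<lambda>x y. \<epsilon> (y * u n n) *\<^sub>C F x)" "cbilinear (\<lambda>x y. x \<otimes> (y * u n n))"
    by (intro clin F clinear_compose[OF _ F])+
  have "tlift (\<lambda>x y. \<epsilon> y *\<^sub>C F x) (T1 D (a \<otimes> u n n)) = tlift (\<lambda>x y. \<epsilon> (y * u n n) *\<^sub>C F x) (comult_col n a)"
    unfolding T1_homog[OF U] by (simp add: tlift_linear[OF clinear_tlift[OF b(1)] b(3)] tlift_pure[OF b(1)])
  also have "\<dots> = tlift (\<lambda>x y. \<epsilon> y *\<^sub>C F x) (comult_col n a)"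
    by (rule comult_col_cong[OF a I(4) b(2,1)]) (simp add: homog_times_unit I)
  also have "\<dots> = F a" using counit_comult_col(2)[OF a I(4) F] by simp
  finally show ?thesis .
qed

lemma counit_T2_unit:
  assumes b: "homog k l m n b" and F: "clinear F"
  shows "tlift (\<lambda>x y. \<epsilon> x *\<^sub>C F y) (T2 D (u k k \<otimes> b)) = F b"
proof -
  note I = homog_index[OF b]
  have U: "homog k k k k (u k k)" by (rule homog_unit[OF I(1,1)])
  have bil: "cbilinear (\<lambda>x y. \<epsilon> x *\<^sub>C F y)" "cbilinear (\<lambda>x y. \<epsilon> (u k k * x) *\<^sub>C F y)" "cbilinear (\<lambda>x y. (u k k * x) \<otimes> y)"
    by (intro clin F clinear_compose[OF _ F])+
  have "tlift (\<lambda>x y. \<epsilon> x *\<^sub>C F y) (T2 D (u k k \<otimes> b)) = tlift (\<lambda>x y. \<epsilon> (u k k * x) *\<^sub>C F y) (comult_row k b)"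
    unfolding T2_homog[OF U] by (simp add: tlift_linear[OF clinear_tlift[OF bil(1)] bil(3)] tlift_pure[OF bil(1)])
  also have "\<dots> = tlift (\<lambda>x y. \<epsilon> x *\<^sub>C F y) (comult_row k b)"
    by (rule comult_row_cong[OF b I(1) bil(2,1)]) (simp add: unit_times_homog I)
  also have "\<dots> = F b" using counit_comult_row(1)[OF b I(1) F] by simp
  finally show ?thesis .
qed

lemma total_comult_is_counit: "is_counit D \<epsilon>"
proof -
  have "cbilinear (\<lambda>x y. x * (y::'a))" by (intro clin)
  then show ?thesis by (simp add: is_counit_def counit_linear counit_T1 counit_T2 tlift_pure)
qed

text \<open>
  Every \<open>a\<close> is a slice of \<open>T1 (a \<otimes> u n n)\<close> by the counit, so it lies in any space that contains the
  first legs.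
\<close>

lemma total_comult_full: "full_coproduct D"
  unfolding full_coproduct_def
proof (intro allI impI)
  fix V W
  assume VW: "csubspace V \<and> csubspace W \<and> (\<forall>a b. T1 D (a \<otimes> b) \<in> tensor_subspace V UNIV) \<and>
    (\<forall>a b. T2 D (a \<otimes> b) \<in> tensor_subspace UNIV W)"
  have b: "cbilinear (\<lambda>x y. \<epsilon> y *\<^sub>C (x::'a))" "cbilinear (\<lambda>x y. \<epsilon> x *\<^sub>C (y::'a))" by (intro clin)+
  have slice: "F z \<in> U" if "z \<in> cspan B" "clinear F" "csubspace U" "\<And>z. z \<in> B \<Longrightarrow> F z \<in> U"
    for F :: "'a \<otimes> 'a \<Rightarrow> 'a" and z U B
  proof -
    have "csubspace {z. F z \<in> U}"
      using that by (intro complex_vector.subspaceI)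
        (simp_all add: clinear_0 clinear_add clinear_scale complex_vector.subspace_0 complex_vector.subspace_add
          complex_vector.subspace_scale)
    then show ?thesis using complex_vector.span_minimal[of B "{z. F z \<in> U}"] that(1,4) by blast
  qed
  have "a \<in> V" for a
  proof (rule subspace_homogI)
    fix k l m n a assume a: "homog k l m n a"
    have "tlift (\<lambda>x y. \<epsilon> y *\<^sub>C x) (T1 D (a \<otimes> u n n)) \<in> V"
      by (rule slice[where B = "{v \<otimes> w | v w. v \<in> V \<and> w \<in> UNIV}"])
        (use VW in \<open>auto simp: tensor_subspace_def clinear_tlift b tlift_pure complex_vector.subspace_scale\<close>)
    then show "a \<in> V" using counit_T1_unit[OF a clinear_id] by simp
  qed (use VW in blast)
  moreover have "b \<in> W" for b
  proof (rule subspace_homogI)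
    fix k l m n b assume a: "homog k l m n b"
    have "tlift (\<lambda>x y. \<epsilon> x *\<^sub>C y) (T2 D (u k k \<otimes> b)) \<in> W"
      by (rule slice[where B = "{v \<otimes> w | v w. v \<in> UNIV \<and> w \<in> W}"])
        (use VW in \<open>auto simp: tensor_subspace_def clinear_tlift b tlift_pure complex_vector.subspace_scale\<close>)
    then show "b \<in> W" using counit_T2_unit[OF a clinear_id] by simp
  qed (use VW in blast)
  ultimately show "V = UNIV \<and> W = UNIV" by blast
qed

lemma
  shows clinear_comult_id: "clinear (comult_id D)" and comult_id_pure: "comult_id D (p \<otimes> q) = D p \<otimes>\<^sub>M \<iota> q"
    and clinear_id_comult: "clinear (id_comult D)"
    and id_comult_pure: "id_comult D (p \<otimes> q) = mtransport tassoc (\<iota> p \<otimes>\<^sub>M D q)"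
proof -
  have b1: "cbilinear (\<lambda>p q. D p \<otimes>\<^sub>M \<iota> q)" by (intro clin)
  have transport: "clinear (\<lambda>x. mtransport tassoc (f x))" if "clinear f"
    for f :: "'a \<Rightarrow> ('a \<otimes> ('a \<otimes> 'a)) multiplier"
  proof (rule clinearI; rule multiplier_eqI)
    fix x y :: 'a and c and w :: "'a \<otimes> 'a \<otimes> 'a"
    show "mtransport tassoc (f (x + y)) \<rhd> w = (mtransport tassoc (f x) + mtransport tassoc (f y)) \<rhd> w"
      "w \<lhd> mtransport tassoc (f (x + y)) = w \<lhd> (mtransport tassoc (f x) + mtransport tassoc (f y))"
      "mtransport tassoc (f (c *\<^sub>C x)) \<rhd> w = (c *\<^sub>C mtransport tassoc (f x)) \<rhd> w"
      "w \<lhd> mtransport tassoc (f (c *\<^sub>C x)) = w \<lhd> (c *\<^sub>C mtransport tassoc (f x))"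
      using mtransport_tassoc[where x = "inv tassoc w"]
      by (simp_all add: tassoc_inv_tassoc multiplier_act clinear_add[OF that] clinear_scale[OF that]
          clinear_add[OF clinear_tassoc] clinear_scale[OF clinear_tassoc])
  qed
  have b2: "cbilinear (\<lambda>(p::'a) q. mtransport tassoc (\<iota> p \<otimes>\<^sub>M D q))" by (intro cbilinearI transport) (intro clin)+
  show "clinear (comult_id D)" "comult_id D (p \<otimes> q) = D p \<otimes>\<^sub>M \<iota> q"
    unfolding comult_id_def by (rule clinear_tlift[OF b1], rule tlift_pure[OF b1])
  show "clinear (id_comult D)" "id_comult D (p \<otimes> q) = mtransport tassoc (\<iota> p \<otimes>\<^sub>M D q)"
    unfolding id_comult_def by (rule clinear_tlift[OF b2], rule tlift_pure[OF b2])
qed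

lemma id_comult_act: "id_comult D (p \<otimes> q) \<rhd> tassoc (x \<otimes> w) = tassoc ((p * x) \<otimes> (D q \<rhd> w))"
  by (simp add: id_comult_pure mtransport_tassoc mtensor_act_pure mult_of_act)

lemma comult_id_act: "comult_id D (p \<otimes> q) \<rhd> (w \<otimes> z) = (D p \<rhd> w) \<otimes> (q * z)"
  by (simp add: comult_id_pure mtensor_act_pure mult_of_act)

lemma id_comult_times: "id_comult D (p \<otimes> q) * (1 \<otimes>\<^sub>M 1 \<otimes>\<^sub>M \<iota> c) = \<iota> (tassoc (p \<otimes> T1 D (q \<otimes> c)))"
proof (rule homog_multiplier_tensor3_eqI)
  fix x y z
  have "(id_comult D (p \<otimes> q) * (1 \<otimes>\<^sub>M 1 \<otimes>\<^sub>M \<iota> c)) \<rhd> (x \<otimes> y \<otimes> z) = id_comult D (p \<otimes> q) \<rhd> tassoc (x \<otimes> (y \<otimes> (c * z)))"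
    by (simp add: multiplier_act mtensor_act_pure mult_of_act tassoc_pure)
  also have "\<dots> = tassoc ((p \<otimes> T1 D (q \<otimes> c)) * (x \<otimes> (y \<otimes> z)))"
    by (simp only: id_comult_act times_pure T1_times)
  also have "\<dots> = \<iota> (tassoc (p \<otimes> T1 D (q \<otimes> c))) \<rhd> (x \<otimes> y \<otimes> z)"
    by (simp add: mult_of_act tassoc_times tassoc_pure)
  finally show "(id_comult D (p \<otimes> q) * (1 \<otimes>\<^sub>M 1 \<otimes>\<^sub>M \<iota> c)) \<rhd> (x \<otimes> y \<otimes> z)
      = \<iota> (tassoc (p \<otimes> T1 D (q \<otimes> c))) \<rhd> (x \<otimes> y \<otimes> z)" .
qed

lemma times_comult_id: "(\<iota> a \<otimes>\<^sub>M 1 \<otimes>\<^sub>M 1) * comult_id D (p \<otimes> q) = \<iota> (T2 D (a \<otimes> p) \<otimes> q)"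
  by (simp add: comult_id_pure mtensor_times T2_mult_of mult_of_mtensor)

text \<open>
  Both sides are \<open>a b(1) \<otimes> b(2) \<otimes> b(3) c\<close>: a homogeneous \<open>a\<close> selects a row for one coproduct, and a
  homogeneous \<open>c\<close> selects a column for the other.
\<close>

lemma total_comult_coassoc:
  "(\<iota> a \<otimes>\<^sub>M 1 \<otimes>\<^sub>M 1) * comult_id D (T1 D (b \<otimes> c)) = id_comult D (T2 D (a \<otimes> b)) * (1 \<otimes>\<^sub>M 1 \<otimes>\<^sub>M \<iota> c)"
proof -
  note lin = clinear_comult_id clinear_id_comult
  have homog: "(\<iota> a \<otimes>\<^sub>M 1 \<otimes>\<^sub>M 1) * comult_id D (T1 D (b \<otimes> c)) = id_comult D (T2 D (a \<otimes> b)) * (1 \<otimes>\<^sub>M 1 \<otimes>\<^sub>M \<iota> c)"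
    if a: "homog k l m n a" and c: "homog k' l' m' n' c" for k l m n k' l' m' n' a c
  proof -
    note I = homog_index[OF a] homog_index[OF c]
    have b: "cbilinear (\<lambda>x y. x \<otimes> (y * c))" "cbilinear (\<lambda>x y. (a * x) \<otimes> y)"
      "cbilinear (\<lambda>x y. T2 D (a \<otimes> x) \<otimes> (y * c))" "cbilinear (\<lambda>x y. tassoc ((a * x) \<otimes> T1 D (y \<otimes> c)))"
      by (intro clin)+
    have L: "clinear (\<lambda>w. (\<iota> a \<otimes>\<^sub>M 1 \<otimes>\<^sub>M 1) * comult_id D w)" "clinear (\<lambda>w. id_comult D w * (1 \<otimes>\<^sub>M 1 \<otimes>\<^sub>M \<iota> c))"
      by (intro clin lin)+
    have iota: "tlift (\<lambda>x y. \<iota> (B x y)) z = \<iota> (tlift B z)" if "cbilinear B"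
      for B :: "'a \<Rightarrow> 'a \<Rightarrow> 'a \<otimes> 'a \<otimes> 'a" and z
      by (rule tlift_linear[OF clinear_mult_of[OF clinear_id] that, symmetric])
    have "(\<iota> a \<otimes>\<^sub>M 1 \<otimes>\<^sub>M 1) * comult_id D (T1 D (b \<otimes> c)) = \<iota> (tlift (\<lambda>x y. T2 D (a \<otimes> x) \<otimes> (y * c)) (comult_col k' b))"
      unfolding T1_homog[OF c] tlift_linear[OF L(1) b(1)] times_comult_id by (rule iota[OF b(3)])
    also have "tlift (\<lambda>x y. T2 D (a \<otimes> x) \<otimes> (y * c)) (comult_col k' b)
        = tlift (\<lambda>x y. tlift (\<lambda>x1 x2. (a * x1) \<otimes> x2 \<otimes> (y * c)) (comult_row n x)) (comult_col k' b)"
      unfolding T2_homog[OF a] by (subst tlift_linear[where F = "\<lambda>w. w \<otimes> z" for z]) ((intro clin)+, simp)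
    also have "\<dots> = tlift (\<lambda>x y. tlift (\<lambda>y1 y2. (a * x) \<otimes> y1 \<otimes> (y2 * c)) (comult_col k' y)) (comult_row n b)"
      by (rule coassoc_row_col[OF I(4,5)]) (intro clin)+
    also have "\<dots> = tlift (\<lambda>x y. tassoc ((a * x) \<otimes> T1 D (y \<otimes> c))) (comult_row n b)"
      unfolding T1_homog[OF c]
      by (subst tlift_linear[where F = "\<lambda>w. tassoc (z \<otimes> w)" for z]) ((intro clin)+, simp add: tassoc_pure)
    also have "\<iota> \<dots> = id_comult D (T2 D (a \<otimes> b)) * (1 \<otimes>\<^sub>M 1 \<otimes>\<^sub>M \<iota> c)"
      unfolding T2_homog[OF a] tlift_linear[OF L(2) b(2)] id_comult_times by (rule iota[OF b(4), symmetric])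
    finally show ?thesis .
  qed
  have homog_a: "(\<iota> a \<otimes>\<^sub>M 1 \<otimes>\<^sub>M 1) * comult_id D (T1 D (b \<otimes> c)) = id_comult D (T2 D (a \<otimes> b)) * (1 \<otimes>\<^sub>M 1 \<otimes>\<^sub>M \<iota> c)"
    if "homog k l m n a" for k l m n a
    by (rule homog_eqI[where a = c]) (intro clin clinear_compose[OF _ lin(1)] | rule homog[OF that])+
  show ?thesis
    by (rule homog_eqI[where a = a]) (intro clin clinear_compose[OF _ lin(2)] | erule homog_a)+
qed

lemma total_comult_coproduct: "coproduct D"
  unfolding coproduct_def
  using clinear_total_comult total_comult_mult total_comult_in_range total_comult_coassoc by blast

section \<open>The legs of the canonical idempotent\<close>

lemma leg_E0_homog:
  assumes x: "homog k l m n x" and y: "homog k' l' m' n' y" and z: "homog k'' l'' m'' n'' z"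
  shows "leg12 E0 \<rhd> (x \<otimes> y \<otimes> z) = (if m = k' then x \<otimes> y \<otimes> z else 0)"
    and "leg23 E0 \<rhd> (x \<otimes> y \<otimes> z) = (if m' = k'' then x \<otimes> y \<otimes> z else 0)"
  using leg23_act(1)[of E0 x "y \<otimes> z"]
  by (simp_all add: leg12_act canonical_idempotent_homog[OF x y] canonical_idempotent_homog[OF y z] tassoc_pure
      clinear_0[OF clinear_tassoc])

lemma leg_E0_mult:
  "leg12 E0 * leg23 E0 = leg23 E0 * leg12 E0"
  "leg12 E0 * (leg12 E0 * leg23 E0) = leg12 E0 * leg23 E0" "leg12 E0 * leg23 E0 * leg12 E0 = leg12 E0 * leg23 E0"
  "leg23 E0 * (leg12 E0 * leg23 E0) = leg12 E0 * leg23 E0" "leg12 E0 * leg23 E0 * leg23 E0 = leg12 E0 * leg23 E0"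
  by (rule homog_multiplier_tensor3_eqI; simp add: multiplier_act leg_E0_homog clinear_0[OF clinear_lact])+

text \<open>
  For uniqueness, \<open>e\<close> acts on a homogeneous tensor as some \<open>\<phi> b\<close>, and \<open>X * \<phi> b\<close> is prescribed.
\<close>

lemma extend_hom_eqI:
  fixes \<phi> :: "'a \<otimes> 'a \<Rightarrow> ('a \<otimes> 'a \<otimes> 'a) multiplier"
  assumes X: "e * X = X" "X * e = X" "\<And>b. X * \<phi> b = \<phi> (m \<rhd> b)" "\<And>b. \<phi> b * X = \<phi> (b \<lhd> m)"
    and unit: "\<And>k l m n k' l' m' n' k'' l'' m'' n'' x y z. homog k l m n x \<Longrightarrow> homog k' l' m' n' y \<Longrightarrow>
      homog k'' l'' m'' n'' z \<Longrightarrow> \<exists>b. e \<rhd> (x \<otimes> y \<otimes> z) = \<phi> b \<rhd> (x \<otimes> y \<otimes> z)"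
  shows "extend_hom \<phi> e m = X"
  unfolding extend_hom_def
proof (rule the_equality)
  fix Y assume Y: "e * Y = Y \<and> Y * e = Y \<and> (\<forall>b. Y * \<phi> b = \<phi> (m \<rhd> b) \<and> \<phi> b * Y = \<phi> (b \<lhd> m))"
  show "Y = X"
  proof (rule homog_multiplier_tensor3_eqI)
    fix k l m n k' l' m' n' k'' l'' m'' n'' x y z
    assume "homog k l m n x" "homog k' l' m' n' y" "homog k'' l'' m'' n'' z"
    then obtain b where b: "e \<rhd> (x \<otimes> y \<otimes> z) = \<phi> b \<rhd> (x \<otimes> y \<otimes> z)" using unit by blast
    have "Y \<rhd> (x \<otimes> y \<otimes> z) = Y \<rhd> (e \<rhd> (x \<otimes> y \<otimes> z))" using Y by (metis multiplier_act(13))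
    also have "\<dots> = (Y * \<phi> b) \<rhd> (x \<otimes> y \<otimes> z)" by (simp add: b multiplier_act)
    also have "\<dots> = (X * \<phi> b) \<rhd> (x \<otimes> y \<otimes> z)" using Y X by simp
    also have "\<dots> = X \<rhd> (e \<rhd> (x \<otimes> y \<otimes> z))" by (simp add: b multiplier_act)
    also have "\<dots> = X \<rhd> (x \<otimes> y \<otimes> z)" using X(2) by (metis multiplier_act(13))
    finally show "Y \<rhd> (x \<otimes> y \<otimes> z) = X \<rhd> (x \<otimes> y \<otimes> z)" .
  qed
qed (use X in blast)

text \<open>
  In \<open>D p \<otimes> q\<close> the leg \<open>leg12 E0\<close> is absorbed by \<open>D p\<close>, whose second legs have the lower left index \<open>m\<close>
  and the lower right index \<open>n\<close> of \<open>p\<close>. So \<open>leg23 E0\<close> tests from the left \<open>m = k'\<close> and from the right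
  \<open>n = l'\<close>, as \<open>E0\<close> does on \<open>p \<otimes> q\<close>.
\<close>

lemma extend_comult_id: "extend_hom (comult_id D) (leg12 E0) E0 = leg12 E0 * leg23 E0"
proof (rule extend_hom_eqI)
  note lin = clinear_comult_id
  let ?X = "leg12 E0 * leg23 E0"
  have X_homog: "?X \<rhd> (x \<otimes> y \<otimes> z) = (if m = k' \<and> m' = k'' then x \<otimes> y \<otimes> z else 0)"
    if "homog k l m n x" "homog k' l' m' n' y" "homog k'' l'' m'' n'' z" for k l m n k' l' m' n' k'' l'' m'' n'' x y z
    using that by (simp add: multiplier_act leg_E0_homog clinear_0[OF clinear_lact])
  have act: "comult_id D (p \<otimes> q) \<rhd> (x \<otimes> y \<otimes> z)
      = tlift (\<lambda>p1 p2. (p1 * x) \<otimes> (p2 * y) \<otimes> (q * z)) (comult_col k' p)"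
    if "homog k' l' m' n' y" for p q x y z k' l' m' n'
    unfolding comult_id_act total_comult_act[OF that]
    by (subst tlift_linear[where F = "\<lambda>w. w \<otimes> (q * z)"]) ((intro clin)+, simp)
  show "?X * comult_id D b = comult_id D (E0 \<rhd> b)" for b
  proof (rule homog_tensor_eqI[where z = b])
    fix k l m n k' l' m' n' p q assume p: "homog k l m n p" and q: "homog k' l' m' n' q"
    show "?X * comult_id D (p \<otimes> q) = comult_id D (E0 \<rhd> (p \<otimes> q))"
    proof (rule homog_multiplier_tensor3_eqI)
      fix k1 l1 m1 n1 k2 l2 m2 n2 k3 l3 m3 n3 x y z
      assume x: "homog k1 l1 m1 n1 x" and y: "homog k2 l2 m2 n2 y" and z: "homog k3 l3 m3 n3 z"
      have b: "cbilinear (\<lambda>p1 p2. (p1 * x) \<otimes> (p2 * y) \<otimes> (q * z))"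
        "cbilinear (\<lambda>p1 p2. ?X \<rhd> ((p1 * x) \<otimes> (p2 * y) \<otimes> (q * z)))"
        by (intro clin)+
      have b': "cbilinear (\<lambda>p1 p2. if m = k' then (p1 * x) \<otimes> (p2 * y) \<otimes> (q * z) else 0)"
        by (cases "m = k'"; simp; intro clin)
      have "(?X * comult_id D (p \<otimes> q)) \<rhd> (x \<otimes> y \<otimes> z)
          = tlift (\<lambda>p1 p2. ?X \<rhd> ((p1 * x) \<otimes> (p2 * y) \<otimes> (q * z))) (comult_col k2 p)"
        unfolding multiplier_act(13)[of ?X "comult_id D (p \<otimes> q)"] act[OF y] by (rule tlift_linear[OF clinear_lact b(1)])
      also have "\<dots> = tlift (\<lambda>p1 p2. if m = k' then (p1 * x) \<otimes> (p2 * y) \<otimes> (q * z) else 0) (comult_col k2 p)"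
        by (rule comult_col_cong[OF p homog_index(1)[OF y] b(2) b'])
          (simp add: X_homog[OF homog_mult[OF _ x] homog_mult[OF _ y] homog_mult[OF q z]])
      also have "\<dots> = comult_id D (E0 \<rhd> (p \<otimes> q)) \<rhd> (x \<otimes> y \<otimes> z)"
        by (simp add: canonical_idempotent_homog[OF p q] act[OF y] tlift_zero clinear_0[OF lin] multiplier_act)
      finally show "(?X * comult_id D (p \<otimes> q)) \<rhd> (x \<otimes> y \<otimes> z) = comult_id D (E0 \<rhd> (p \<otimes> q)) \<rhd> (x \<otimes> y \<otimes> z)" .
    qed
  qed (intro clin lin clinear_compose[OF _ lin])+
  show "comult_id D b * ?X = comult_id D (b \<lhd> E0)" for b
  proof (rule homog_tensor_eqI[where z = b])
    fix k l m n k' l' m' n' p q assume p: "homog k l m n p" and q: "homog k' l' m' n' q"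
    show "comult_id D (p \<otimes> q) * ?X = comult_id D ((p \<otimes> q) \<lhd> E0)"
    proof (rule homog_multiplier_tensor3_eqI)
      fix k1 l1 m1 n1 k2 l2 m2 n2 k3 l3 m3 n3 x y z
      assume x: "homog k1 l1 m1 n1 x" and y: "homog k2 l2 m2 n2 y" and z: "homog k3 l3 m3 n3 z"
      have b: "cbilinear (\<lambda>p1 p2. if P then (p1 * x) \<otimes> (p2 * y) \<otimes> (q * z) else 0)" for P
        by (cases P; simp; intro clin)
      have "(comult_id D (p \<otimes> q) * ?X) \<rhd> (x \<otimes> y \<otimes> z)
          = tlift (\<lambda>p1 p2. if m1 = k2 \<and> m2 = k3 then (p1 * x) \<otimes> (p2 * y) \<otimes> (q * z) else 0) (comult_col k2 p)"
        unfolding multiplier_act(13)[of "comult_id D (p \<otimes> q)" ?X] X_homog[OF x y z]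
        by (simp add: act[OF y] tlift_if clinear_0[OF clinear_lact])
      also have "\<dots> = tlift (\<lambda>p1 p2. if n = l' then (p1 * x) \<otimes> (p2 * y) \<otimes> (q * z) else 0) (comult_col k2 p)"
      proof (rule comult_col_cong[OF p homog_index(1)[OF y] b b])
        fix r p1 p2 assume p1: "homog k l r k2 p1" and p2: "homog r k2 m n p2"
        show "(if m1 = k2 \<and> m2 = k3 then (p1 * x) \<otimes> (p2 * y) \<otimes> (q * z) else 0)
            = (if n = l' then (p1 * x) \<otimes> (p2 * y) \<otimes> (q * z) else 0)"
          using homog_mult_0[OF p1 x] homog_mult_0[OF p2 y] homog_mult_0[OF q z]
          by (cases "p1 * x = 0 \<or> p2 * y = 0 \<or> q * z = 0") auto
      qed
      also have "\<dots> = comult_id D ((p \<otimes> q) \<lhd> E0) \<rhd> (x \<otimes> y \<otimes> z)"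
        by (simp add: canonical_idempotent_homog[OF p q] act[OF y] tlift_zero clinear_0[OF lin] multiplier_act)
      finally show "(comult_id D (p \<otimes> q) * ?X) \<rhd> (x \<otimes> y \<otimes> z) = comult_id D ((p \<otimes> q) \<lhd> E0) \<rhd> (x \<otimes> y \<otimes> z)" .
    qed
  qed (intro clin lin clinear_compose[OF _ lin])+
  fix k l m n k' l' m' n' k'' l'' m'' n'' x y z
  assume x: "homog k l m n x" and y: "homog k' l' m' n' y" and z: "homog k'' l'' m'' n'' z"
  have "leg12 E0 \<rhd> (x \<otimes> y \<otimes> z) = comult_id D (u k m' \<otimes> u k'' m'') \<rhd> (x \<otimes> y \<otimes> z)"
    by (simp add: leg12_act comult_id_act total_comult_unit_act[OF x y] unit_times_homog[OF z] homog_index[OF z])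
  then show "\<exists>b. leg12 E0 \<rhd> (x \<otimes> y \<otimes> z) = comult_id D b \<rhd> (x \<otimes> y \<otimes> z)" by blast
qed (rule leg_E0_mult)+

text \<open>
  Here \<open>leg23 E0\<close> is absorbed by \<open>D q\<close>, whose first legs have the upper indices of \<open>q\<close>, and \<open>leg12 E0\<close>
  compares these with the lower indices of \<open>p\<close>.
\<close>

lemma extend_id_comult: "extend_hom (id_comult D) (leg23 E0) E0 = leg12 E0 * leg23 E0"
proof (rule extend_hom_eqI)
  note lin = clinear_id_comult
  let ?X = "leg12 E0 * leg23 E0"
  have X_homog: "?X \<rhd> (x \<otimes> y \<otimes> z) = (if m = k' \<and> m' = k'' then x \<otimes> y \<otimes> z else 0)"
    if "homog k l m n x" "homog k' l' m' n' y" "homog k'' l'' m'' n'' z" for k l m n k' l' m' n' k'' l'' m'' n'' x y z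
    using that by (simp add: multiplier_act leg_E0_homog clinear_0[OF clinear_lact])
  have act: "id_comult D (p \<otimes> q) \<rhd> (x \<otimes> y \<otimes> z)
      = tlift (\<lambda>q1 q2. (p * x) \<otimes> (q1 * y) \<otimes> (q2 * z)) (comult_col k' q)"
    if "homog k' l' m' n' z" for p q x y z k' l' m' n'
    unfolding id_comult_act[of p q x "y \<otimes> z", unfolded tassoc_pure] total_comult_act[OF that]
    by (subst tlift_linear[where F = "\<lambda>w. tassoc ((p * x) \<otimes> w)"]) ((intro clin)+, simp add: tassoc_pure)
  show "?X * id_comult D b = id_comult D (E0 \<rhd> b)" for b
  proof (rule homog_tensor_eqI[where z = b])
    fix k l m n k' l' m' n' p q assume p: "homog k l m n p" and q: "homog k' l' m' n' q"
    show "?X * id_comult D (p \<otimes> q) = id_comult D (E0 \<rhd> (p \<otimes> q))"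
    proof (rule homog_multiplier_tensor3_eqI)
      fix k1 l1 m1 n1 k2 l2 m2 n2 k3 l3 m3 n3 x y z
      assume x: "homog k1 l1 m1 n1 x" and y: "homog k2 l2 m2 n2 y" and z: "homog k3 l3 m3 n3 z"
      have b: "cbilinear (\<lambda>q1 q2. (p * x) \<otimes> (q1 * y) \<otimes> (q2 * z))"
        "cbilinear (\<lambda>q1 q2. ?X \<rhd> ((p * x) \<otimes> (q1 * y) \<otimes> (q2 * z)))"
        by (intro clin)+
      have b': "cbilinear (\<lambda>q1 q2. if m = k' then (p * x) \<otimes> (q1 * y) \<otimes> (q2 * z) else 0)"
        by (cases "m = k'"; simp; intro clin)
      have "(?X * id_comult D (p \<otimes> q)) \<rhd> (x \<otimes> y \<otimes> z)
          = tlift (\<lambda>q1 q2. ?X \<rhd> ((p * x) \<otimes> (q1 * y) \<otimes> (q2 * z))) (comult_col k3 q)"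
        unfolding multiplier_act(13)[of ?X "id_comult D (p \<otimes> q)"] act[OF z] by (rule tlift_linear[OF clinear_lact b(1)])
      also have "\<dots> = tlift (\<lambda>q1 q2. if m = k' then (p * x) \<otimes> (q1 * y) \<otimes> (q2 * z) else 0) (comult_col k3 q)"
        by (rule comult_col_cong[OF q homog_index(1)[OF z] b(2) b'])
          (simp add: X_homog[OF homog_mult[OF p x] homog_mult[OF _ y] homog_mult[OF _ z]])
      also have "\<dots> = id_comult D (E0 \<rhd> (p \<otimes> q)) \<rhd> (x \<otimes> y \<otimes> z)"
        by (simp add: canonical_idempotent_homog[OF p q] act[OF z] tlift_zero clinear_0[OF lin] multiplier_act)
      finally show "(?X * id_comult D (p \<otimes> q)) \<rhd> (x \<otimes> y \<otimes> z) = id_comult D (E0 \<rhd> (p \<otimes> q)) \<rhd> (x \<otimes> y \<otimes> z)" .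
    qed
  qed (intro clin lin clinear_compose[OF _ lin])+
  show "id_comult D b * ?X = id_comult D (b \<lhd> E0)" for b
  proof (rule homog_tensor_eqI[where z = b])
    fix k l m n k' l' m' n' p q assume p: "homog k l m n p" and q: "homog k' l' m' n' q"
    show "id_comult D (p \<otimes> q) * ?X = id_comult D ((p \<otimes> q) \<lhd> E0)"
    proof (rule homog_multiplier_tensor3_eqI)
      fix k1 l1 m1 n1 k2 l2 m2 n2 k3 l3 m3 n3 x y z
      assume x: "homog k1 l1 m1 n1 x" and y: "homog k2 l2 m2 n2 y" and z: "homog k3 l3 m3 n3 z"
      have b: "cbilinear (\<lambda>q1 q2. if P then (p * x) \<otimes> (q1 * y) \<otimes> (q2 * z) else 0)" for P
        by (cases P; simp; intro clin)
      have "(id_comult D (p \<otimes> q) * ?X) \<rhd> (x \<otimes> y \<otimes> z)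
          = tlift (\<lambda>q1 q2. if m1 = k2 \<and> m2 = k3 then (p * x) \<otimes> (q1 * y) \<otimes> (q2 * z) else 0) (comult_col k3 q)"
        unfolding multiplier_act(13)[of "id_comult D (p \<otimes> q)" ?X] X_homog[OF x y z]
        by (simp add: act[OF z] tlift_if clinear_0[OF clinear_lact])
      also have "\<dots> = tlift (\<lambda>q1 q2. if n = l' then (p * x) \<otimes> (q1 * y) \<otimes> (q2 * z) else 0) (comult_col k3 q)"
      proof (rule comult_col_cong[OF q homog_index(1)[OF z] b b])
        fix r q1 q2 assume q1: "homog k' l' r k3 q1" and q2: "homog r k3 m' n' q2"
        show "(if m1 = k2 \<and> m2 = k3 then (p * x) \<otimes> (q1 * y) \<otimes> (q2 * z) else 0)
            = (if n = l' then (p * x) \<otimes> (q1 * y) \<otimes> (q2 * z) else 0)"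
          using homog_mult_0[OF p x] homog_mult_0[OF q1 y] homog_mult_0[OF q2 z]
          by (cases "p * x = 0 \<or> q1 * y = 0 \<or> q2 * z = 0") auto
      qed
      also have "\<dots> = id_comult D ((p \<otimes> q) \<lhd> E0) \<rhd> (x \<otimes> y \<otimes> z)"
        by (simp add: canonical_idempotent_homog[OF p q] act[OF z] tlift_zero clinear_0[OF lin] multiplier_act)
      finally show "(id_comult D (p \<otimes> q) * ?X) \<rhd> (x \<otimes> y \<otimes> z) = id_comult D ((p \<otimes> q) \<lhd> E0) \<rhd> (x \<otimes> y \<otimes> z)" .
    qed
  qed (intro clin lin clinear_compose[OF _ lin])+
  fix k l m n k' l' m' n' k'' l'' m'' n'' x y z
  assume x: "homog k l m n x" and y: "homog k' l' m' n' y" and z: "homog k'' l'' m'' n'' z"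
  have "leg23 E0 \<rhd> (x \<otimes> y \<otimes> z) = id_comult D (u k m \<otimes> u k' m'') \<rhd> (x \<otimes> y \<otimes> z)"
    using leg23_act(1)[of E0 x "y \<otimes> z"] id_comult_act[of "u k m" "u k' m''" x "y \<otimes> z"]
    by (simp add: tassoc_pure total_comult_unit_act[OF y z] unit_times_homog[OF x] homog_index[OF x])
  then show "\<exists>b. leg23 E0 \<rhd> (x \<otimes> y \<otimes> z) = id_comult D b \<rhd> (x \<otimes> y \<otimes> z)" by blast
qed (rule leg_E0_mult | subst leg_E0_mult(1)[symmetric])+

section \<open>The projections onto complements of the kernels\<close>

text \<open>
  The element \<open>leg13 (D a) * (1 \<otimes> b \<otimes> c)\<close> of the tensor cube as a linear function of \<open>b \<otimes> c\<close>.
\<close>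

definition T1_leg13 :: "'a \<Rightarrow> 'a \<otimes> 'a \<Rightarrow> 'a \<otimes> 'a \<otimes> 'a" where
  "T1_leg13 a = tlift (\<lambda>b c. tswap23 (T1 D (a \<otimes> c) \<otimes> b))"

text \<open>
  The element \<open>(a \<otimes> b \<otimes> 1) * leg13 (D c)\<close> as a linear function of \<open>a \<otimes> b\<close>.
\<close>

definition T2_leg13 :: "'a \<Rightarrow> 'a \<otimes> 'a \<Rightarrow> 'a \<otimes> 'a \<otimes> 'a" where
  "T2_leg13 c = tlift (\<lambda>a b. tswap23 (T2 D (a \<otimes> c) \<otimes> b))"

lemma
  shows clinear_T1_leg13: "clinear (T1_leg13 a)" and T1_leg13_pure: "T1_leg13 a (b \<otimes> c) = tswap23 (T1 D (a \<otimes> c) \<otimes> b)"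
    and clinear_T2_leg13: "clinear (T2_leg13 a)" and T2_leg13_pure: "T2_leg13 a (b \<otimes> c) = tswap23 (T2 D (b \<otimes> a) \<otimes> c)"
proof -
  have b: "cbilinear (\<lambda>b c. tswap23 (T1 D (a \<otimes> c) \<otimes> b))" "cbilinear (\<lambda>b c. tswap23 (T2 D (b \<otimes> a) \<otimes> c))"
    by (intro clin)+
  show "clinear (T1_leg13 a)" "T1_leg13 a (b \<otimes> c) = tswap23 (T1 D (a \<otimes> c) \<otimes> b)"
    "clinear (T2_leg13 a)" "T2_leg13 a (b \<otimes> c) = tswap23 (T2 D (b \<otimes> a) \<otimes> c)"
    unfolding T1_leg13_def T2_leg13_def by (simp_all add: clinear_tlift tlift_pure b)
qed

lemma clinear_T_leg13_comp [clin]: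
  "clinear f \<Longrightarrow> clinear (\<lambda>x. T1_leg13 a (f x))" "clinear f \<Longrightarrow> clinear (\<lambda>x. T2_leg13 a (f x))"
  by (rule clinear_compose[OF _ clinear_T1_leg13] clinear_compose[OF _ clinear_T2_leg13]; assumption)+

lemma leg13_total_comult:
  "leg13 (D a) * leg23 (\<iota> w) = \<iota> (T1_leg13 a w)"
  "leg12 (\<iota> w) * leg13 (D c) = \<iota> (T2_leg13 c w)"
proof -
  show "leg13 (D a) * leg23 (\<iota> w) = \<iota> (T1_leg13 a w)"
  proof (rule homog_multiplier_tensor3_eqI)
    fix x y z
    show "(leg13 (D a) * leg23 (\<iota> w)) \<rhd> (x \<otimes> y \<otimes> z) = \<iota> (T1_leg13 a w) \<rhd> (x \<otimes> y \<otimes> z)"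
    proof (rule clinear_tensor_eqI[where x = w])
      show "clinear (\<lambda>w. (leg13 (D a) * leg23 (\<iota> w)) \<rhd> (x \<otimes> y \<otimes> z))"
        unfolding multiplier_act(13) tassoc_pure[symmetric] leg23_act mult_of_act by (intro clin)
      show "(leg13 (D a) * leg23 (\<iota> (b \<otimes> c))) \<rhd> (x \<otimes> y \<otimes> z) = \<iota> (T1_leg13 a (b \<otimes> c)) \<rhd> (x \<otimes> y \<otimes> z)" for b c
      proof -
        have "(leg13 (D a) * leg23 (\<iota> (b \<otimes> c))) \<rhd> (x \<otimes> y \<otimes> z) = leg13 (D a) \<rhd> tswap23 (x \<otimes> (c * z) \<otimes> (b * y))"
          by (simp only: multiplier_act(13) tassoc_pure[symmetric] leg23_act mult_of_act times_pure)
            (simp only: tassoc_pure tswap23_pure)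
        also have "\<dots> = tswap23 ((T1 D (a \<otimes> c) \<otimes> b) * (x \<otimes> z \<otimes> y))"
          by (simp only: leg13_act times_pure T1_times)
        also have "\<dots> = \<iota> (T1_leg13 a (b \<otimes> c)) \<rhd> (x \<otimes> y \<otimes> z)"
          by (simp only: mult_of_act T1_leg13_pure tswap23_times tswap23_pure)
        finally show ?thesis .
      qed
    qed (intro clin)
  qed
  show "leg12 (\<iota> w) * leg13 (D c) = \<iota> (T2_leg13 c w)"
  proof (rule multiplier_eqI_right[OF local_units(6)])
    fix v
    show "v \<lhd> (leg12 (\<iota> w) * leg13 (D c)) = v \<lhd> \<iota> (T2_leg13 c w)"
    proof (rule clinear_tensor3_eqI[where x = v])
    fix x y z
    show "(x \<otimes> y \<otimes> z) \<lhd> (leg12 (\<iota> w) * leg13 (D c)) = (x \<otimes> y \<otimes> z) \<lhd> \<iota> (T2_leg13 c w)"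
    proof (rule clinear_tensor_eqI[where x = w])
      show "clinear (\<lambda>w. (x \<otimes> y \<otimes> z) \<lhd> (leg12 (\<iota> w) * leg13 (D c)))"
        unfolding multiplier_act(14) leg12_act mult_of_act by (intro clin)
      show "(x \<otimes> y \<otimes> z) \<lhd> (leg12 (\<iota> (a \<otimes> b)) * leg13 (D c)) = (x \<otimes> y \<otimes> z) \<lhd> \<iota> (T2_leg13 c (a \<otimes> b))" for a b
      proof -
        have "(x \<otimes> y \<otimes> z) \<lhd> (leg12 (\<iota> (a \<otimes> b)) * leg13 (D c)) = tswap23 ((x * a) \<otimes> z \<otimes> (y * b)) \<lhd> leg13 (D c)"
          by (simp only: multiplier_act(14) leg12_act mult_of_act times_pure tswap23_pure)
        also have "\<dots> = tswap23 ((x \<otimes> z \<otimes> y) * (T2 D (a \<otimes> c) \<otimes> b))"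
          by (simp only: leg13_act times_pure times_T2)
        also have "\<dots> = (x \<otimes> y \<otimes> z) \<lhd> \<iota> (T2_leg13 c (a \<otimes> b))"
          by (simp only: mult_of_act T2_leg13_pure tswap23_times tswap23_pure)
        finally show ?thesis .
      qed
    qed (intro clin)
  qed (intro clin)+
  qed
qed

lemma leg_mult_of: "leg23 E * leg23 (\<iota> w) = leg23 (\<iota> (E \<rhd> w))" "leg12 (\<iota> w) * leg12 E = leg12 (\<iota> (w \<lhd> E))"
  "1 \<otimes>\<^sub>M \<iota> b \<otimes>\<^sub>M \<iota> c = leg23 (\<iota> (b \<otimes> c))" "\<iota> a \<otimes>\<^sub>M \<iota> b \<otimes>\<^sub>M 1 = leg12 (\<iota> (a \<otimes> b))"
  for E :: "('a \<otimes> 'a) multiplier" and a b c :: 'a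
proof -
  show "leg23 E * leg23 (\<iota> w) = leg23 (\<iota> (E \<rhd> w))"
    by (rule homog_multiplier_tensor3_eqI)
      (simp only: multiplier_act(13) tassoc_pure[symmetric] leg23_act mult_of_act lact_mult)
  show "leg12 (\<iota> w) * leg12 E = leg12 (\<iota> (w \<lhd> E))"
    by (simp add: leg12_def mtensor_times times_mult_of)
  show "1 \<otimes>\<^sub>M \<iota> b \<otimes>\<^sub>M \<iota> c = leg23 (\<iota> (b \<otimes> c))"
    by (rule homog_multiplier_tensor3_eqI)
      (simp add: mtensor_act_pure multiplier_act mult_of_act leg23_act_pure times_pure tassoc_pure)
  show "\<iota> a \<otimes>\<^sub>M \<iota> b \<otimes>\<^sub>M 1 = leg12 (\<iota> (a \<otimes> b))"
    by (simp add: leg12_def mult_of_mtensor)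
qed

lemma inv_mult_of_A3: "inv \<iota> (\<iota> w) = w" for w :: "'a \<otimes> 'a \<otimes> 'a"
  by (rule inv_f_f[OF inj_mult_of_A3])

lemma G1_condition_iff:
  "\<iota> (tmap G1 (\<lambda>x. x) (inv \<iota> (leg13 (D a) * (1 \<otimes>\<^sub>M \<iota> b \<otimes>\<^sub>M \<iota> c)))) = leg13 (D a) * leg23 E * (1 \<otimes>\<^sub>M \<iota> b \<otimes>\<^sub>M \<iota> c)
   \<longleftrightarrow> tmap G1 (\<lambda>x. x) (T1_leg13 a (b \<otimes> c)) = T1_leg13 a (E \<rhd> (b \<otimes> c))"
  by (simp only: leg_mult_of mult.assoc leg13_total_comult inv_mult_of_A3 inj_eq[OF inj_mult_of_A3])

lemma G2_condition_iff:
  "\<iota> ((tassoc \<circ> tmap (\<lambda>x. x) G2 \<circ> inv tassoc) (inv \<iota> ((\<iota> a \<otimes>\<^sub>M \<iota> b \<otimes>\<^sub>M 1) * leg13 (D c))))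
     = (\<iota> a \<otimes>\<^sub>M \<iota> b \<otimes>\<^sub>M 1) * leg12 E * leg13 (D c)
   \<longleftrightarrow> tassoc (tmap (\<lambda>x. x) G2 (inv tassoc (T2_leg13 c (a \<otimes> b)))) = T2_leg13 c ((a \<otimes> b) \<lhd> E)"
  by (simp only: leg_mult_of leg13_total_comult inv_mult_of_A3 inj_eq[OF inj_mult_of_A3] o_apply)

lemma T1_leg13_homog:
  assumes "homog k l m n c"
  shows "T1_leg13 a (b \<otimes> c) = tlift (\<lambda>x y. x \<otimes> b \<otimes> (y * c)) (comult_col k a)"
  unfolding T1_leg13_pure T1_homog[OF assms]
  by (subst tlift_linear[where F = "\<lambda>w. tswap23 (w \<otimes> b)"]) ((intro clin)+, simp add: tswap23_pure)

lemma T2_leg13_homog: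
  assumes "homog k l m n a"
  shows "T2_leg13 c (a \<otimes> b) = tlift (\<lambda>x y. (a * x) \<otimes> b \<otimes> y) (comult_row n c)"
  unfolding T2_leg13_pure T2_homog[OF assms]
  by (subst tlift_linear[where F = "\<lambda>w. tswap23 (w \<otimes> b)"]) ((intro clin)+, simp add: tswap23_pure)

text \<open>
  The first legs of \<open>T1 (a \<otimes> c)\<close> have lower right index \<open>k'\<close>, the upper left index of \<open>c\<close>. Hence
  \<open>partial_G1\<close> on these legs and \<open>b\<close>, and \<open>E0\<close> on \<open>b\<close> and \<open>c\<close>, test the same pair of indices.
\<close>

lemma partial_G1_condition: "tmap (partial_G1 I u) (\<lambda>x. x) (T1_leg13 a w) = T1_leg13 a (E0 \<rhd> w)"
proof (rule homog_tensor_eqI[where z = w])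
  fix k l m n k' l' m' n' b c assume b: "homog k l m n b" and c: "homog k' l' m' n' c"
  have G [clin]: "clinear f \<Longrightarrow> clinear (\<lambda>x. partial_G1 I u (f x))" for f :: "'a \<Rightarrow> 'a \<otimes> 'a"
    by (rule clinear_compose[OF _ clinear_partial_G1])
  have bil: "cbilinear (\<lambda>x y. x \<otimes> b \<otimes> (y * c))" by (intro clin)
  have bil': "cbilinear (\<lambda>x y. if P then x \<otimes> b \<otimes> (y * c) else 0)" for P by (cases P; simp; intro clin)
  show "tmap (partial_G1 I u) (\<lambda>x. x) (T1_leg13 a (b \<otimes> c)) = T1_leg13 a (E0 \<rhd> (b \<otimes> c))"
  proof (rule homog_eqI[where a = a])
    fix k1 l1 m1 n1 a assume a: "homog k1 l1 m1 n1 a"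
    have "tmap (partial_G1 I u) (\<lambda>x. x) (T1_leg13 a (b \<otimes> c))
        = tlift (\<lambda>x y. partial_G1 I u (x \<otimes> b) \<otimes> (y * c)) (comult_col k' a)"
      unfolding T1_leg13_homog[OF c] tlift_linear[OF clinear_tmap[OF clinear_partial_G1 clinear_id] bil]
      by (simp add: tmap_pure clinear_partial_G1 clinear_id)
    also have "\<dots> = tlift (\<lambda>x y. if m = k' then x \<otimes> b \<otimes> (y * c) else 0) (comult_col k' a)"
      by (rule comult_col_cong[OF a homog_index(1)[OF c] _ bil']) (intro clin, auto simp: partial_maps_homog(1)[OF _ b])
    also have "\<dots> = T1_leg13 a (E0 \<rhd> (b \<otimes> c))"
      by (simp add: canonical_idempotent_homog[OF b c] T1_leg13_homog[OF c] tlift_zero clinear_0[OF clinear_T1_leg13])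
    finally show "tmap (partial_G1 I u) (\<lambda>x. x) (T1_leg13 a (b \<otimes> c)) = T1_leg13 a (E0 \<rhd> (b \<otimes> c))" .
  next
    show "clinear (\<lambda>a. tmap (partial_G1 I u) (\<lambda>x. x) (T1_leg13 a (b \<otimes> c)))"
      unfolding T1_leg13_pure by (intro clin clinear_partial_G1)
    show "clinear (\<lambda>a. T1_leg13 a (E0 \<rhd> (b \<otimes> c)))"
      by (cases "m = k'") (simp_all add: canonical_idempotent_homog[OF b c] T1_leg13_pure clinear_0[OF clinear_T1_leg13], (intro clin)+)
  qed
qed (intro clin clinear_partial_G1)+

text \<open>
  The second legs of \<open>T2 (a \<otimes> c)\<close> have upper left index \<open>n\<close>, the lower right index of \<open>a\<close>.
\<close>

lemma partial_G2_condition: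
  "tassoc (tmap (\<lambda>x. x) (partial_G2 I u) (inv tassoc (T2_leg13 c w))) = T2_leg13 c (w \<lhd> E0)"
proof (rule homog_tensor_eqI[where z = w])
  fix k l m n k' l' m' n' a b assume a: "homog k l m n a" and b: "homog k' l' m' n' b"
  have G [clin]: "clinear f \<Longrightarrow> clinear (\<lambda>x. partial_G2 I u (f x))" for f :: "'a \<Rightarrow> 'a \<otimes> 'a"
    by (rule clinear_compose[OF _ clinear_partial_G2])
  have G': "clinear (\<lambda>w. tassoc (tmap (\<lambda>x. x) (partial_G2 I u) (inv tassoc w)))"
    by (intro clin clinear_partial_G2 clinear_inv_tassoc)
  have bil: "cbilinear (\<lambda>x y. (a * x) \<otimes> b \<otimes> y)" by (intro clin)
  have bil': "cbilinear (\<lambda>x y. if P then (a * x) \<otimes> b \<otimes> y else 0)" for P by (cases P; simp; intro clin)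
  show "tassoc (tmap (\<lambda>x. x) (partial_G2 I u) (inv tassoc (T2_leg13 c (a \<otimes> b)))) = T2_leg13 c ((a \<otimes> b) \<lhd> E0)"
  proof (rule homog_eqI[where a = c])
    fix k1 l1 m1 n1 c assume c: "homog k1 l1 m1 n1 c"
    have "tassoc (tmap (\<lambda>x. x) (partial_G2 I u) (inv tassoc (T2_leg13 c (a \<otimes> b))))
        = tlift (\<lambda>x y. tassoc ((a * x) \<otimes> partial_G2 I u (b \<otimes> y))) (comult_row n c)"
      unfolding T2_leg13_homog[OF a] tlift_linear[OF G' bil]
      by (simp add: tmap_pure clinear_partial_G2 clinear_id inv_tassoc_pure)
    also have "\<dots> = tlift (\<lambda>x y. if n = l' then (a * x) \<otimes> b \<otimes> y else 0) (comult_row n c)"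
      by (rule comult_row_cong[OF c homog_index(4)[OF a] _ bil'])
        (intro clin, auto simp: partial_maps_homog(3)[OF b] tassoc_pure clinear_0[OF clinear_tassoc])
    also have "\<dots> = T2_leg13 c ((a \<otimes> b) \<lhd> E0)"
      by (simp add: canonical_idempotent_homog[OF a b] T2_leg13_homog[OF a] tlift_zero clinear_0[OF clinear_T2_leg13])
    finally show "tassoc (tmap (\<lambda>x. x) (partial_G2 I u) (inv tassoc (T2_leg13 c (a \<otimes> b)))) = T2_leg13 c ((a \<otimes> b) \<lhd> E0)" .
  next
    show "clinear (\<lambda>c. tassoc (tmap (\<lambda>x. x) (partial_G2 I u) (inv tassoc (T2_leg13 c (a \<otimes> b)))))"
      unfolding T2_leg13_pure by (intro clinear_compose[OF _ G'] clin)
    show "clinear (\<lambda>c. T2_leg13 c ((a \<otimes> b) \<lhd> E0))"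
      by (cases "n = l'") (simp_all add: canonical_idempotent_homog[OF a b] T2_leg13_pure clinear_0[OF clinear_T2_leg13], (intro clin)+)
  qed
qed (intro clin clinear_partial_G2 clinear_compose[OF _ clinear_inv_tassoc])+

text \<open>
  The equations for \<open>R1\<close> and \<open>R2\<close> express the conditions on ranges and kernels; the remaining axioms
  hold for every partial bialgebra.
\<close>

lemma structure_of_generalized_inverses:
  assumes R1: "clinear R1" "T1 D \<circ> R1 = partial_E1 I u" "R1 \<circ> T1 D = partial_G1 I u"
      "T1 D \<circ> R1 \<circ> T1 D = T1 D" "R1 \<circ> T1 D \<circ> R1 = R1"
    and R2: "clinear R2" "T2 D \<circ> R2 = partial_E2 I u" "R2 \<circ> T2 D = partial_G2 I u"
      "T2 D \<circ> R2 \<circ> T2 D = T2 D" "R2 \<circ> T2 D \<circ> R2 = R2"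
  shows "weak_multiplier_hopf_structure D \<epsilon> E0 (partial_G1 I u) (partial_G2 I u)"
proof -
  have kernel: "{x. T x = 0} = range (\<lambda>x. x - G x)" if T: "clinear T" "clinear R" "R \<circ> T = G" "T \<circ> R \<circ> T = T"
    for T R G :: "'a \<otimes> 'a \<Rightarrow> 'a \<otimes> 'a"
  proof (intro set_eqI iffI)
    fix x assume "x \<in> {x. T x = 0}"
    then have "G x = 0" using T by (auto simp: clinear_0)
    then have "x = x - G x" by simp
    then show "x \<in> range (\<lambda>x. x - G x)" by (rule range_eqI)
  next
    fix x assume "x \<in> range (\<lambda>x. x - G x)"
    then obtain y where x: "x = y - R (T y)" using T(3) by auto
    have "T (R (T y)) = T y" using T(4) by (metis comp_apply)
    then show "x \<in> {x. T x = 0}" by (simp add: x clinear_diff[OF T(1)])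
  qed
  have range: "range T = range P" if "T \<circ> R = P" "\<And>x. P (T x) = T x" for T R P :: "'a \<otimes> 'a \<Rightarrow> 'a \<otimes> 'a"
    using that by (metis (no_types, opaque_lifting) comp_apply image_eqI image_subset_iff subset_antisym rangeI)
  have idem: "G \<circ> G = G" if "R \<circ> T = G" "T \<circ> R \<circ> T = T" for T R G :: "'a \<otimes> 'a \<Rightarrow> 'a \<otimes> 'a"
    using that by (metis comp_assoc)
  have "range (T1 D) = range (\<lambda>x. E0 \<rhd> x)"
    by (rule range[of _ R1]) (use R1(2) in \<open>auto simp: fun_eq_iff partial_E1_eq canonical_idempotent_T1\<close>)
  moreover have "range (T2 D) = range (\<lambda>x. x \<lhd> E0)"
    by (rule range[of _ R2]) (use R2(2) in \<open>auto simp: fun_eq_iff partial_E2_eq canonical_idempotent_T2\<close>)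
  ultimately show ?thesis
    unfolding weak_multiplier_hopf_structure_def G1_condition_iff G2_condition_iff
    using idempotent nondegenerate total_comult_coproduct total_comult_full total_comult_is_counit idempotent_E0
      extend_comult_id leg_E0_mult(1) extend_id_comult clinear_partial_G1 clinear_partial_G2
      idem[OF R1(3,4)] idem[OF R2(3,4)] partial_G1_condition partial_G2_condition
      kernel[OF clinear_T1 R1(1,3,4)] kernel[OF clinear_T2 R2(1,3,4)]
    by (intro conjI allI; assumption?) auto
qed

section \<open>Uniqueness of the structure and of the antipode\<close>

text \<open>
  \<open>E * E0 = E\<close> since \<open>E0\<close> fixes the range of \<open>T2\<close>, which is that of right multiplication by \<open>E\<close>. On the
  other hand \<open>E0\<close> agrees locally with elements in the range of \<open>T1\<close>, which \<open>E\<close> fixes, so that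
  \<open>E * E0 = E0\<close>.
\<close>

lemma structure_idempotent_unique:
  assumes W: "weak_multiplier_hopf_structure D \<epsilon> E G1 G2"
  shows "E = E0"
proof -
  have EE: "E * E = E" and r1: "range (T1 D) = range (\<lambda>x. E \<rhd> x)" and r2: "range (T2 D) = range (\<lambda>x. x \<lhd> E)"
    using W by (simp_all add: weak_multiplier_hopf_structure_def)
  have "E * E0 = E"
  proof (rule multiplier_eqI_right[OF local_units(4)])
    fix z
    have "z \<lhd> E \<in> range (T2 D)" unfolding r2 by blast
    then show "z \<lhd> (E * E0) = z \<lhd> E" by (auto simp: multiplier_act canonical_idempotent_T2)
  qed
  moreover have "E * E0 = E0"
  proof (rule homog_multiplier_tensor_eqI)
    fix k l m n k' l' m' n' x y assume x: "homog k l m n x" and y: "homog k' l' m' n' y"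
    have "E0 \<rhd> (x \<otimes> y) = T1 D (u k m' \<otimes> u k' m') * (x \<otimes> y)"
      by (simp add: T1_times unit_times_homog[OF y] homog_index[OF y] total_comult_unit_act[OF x y])
    moreover have "T1 D (u k m' \<otimes> u k' m') \<in> range (\<lambda>x. E \<rhd> x)" using r1 by blast
    then obtain w where "T1 D (u k m' \<otimes> u k' m') = E \<rhd> w" by blast
    ultimately have eq: "E0 \<rhd> (x \<otimes> y) = E \<rhd> (w * (x \<otimes> y))" by (simp add: lact_mult)
    have "(E * E0) \<rhd> (x \<otimes> y) = (E * E) \<rhd> (w * (x \<otimes> y))" by (simp only: multiplier_act(13) eq)
    then show "(E * E0) \<rhd> (x \<otimes> y) = E0 \<rhd> (x \<otimes> y)" by (simp only: EE eq)
  qed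
  ultimately show ?thesis by simp
qed

text \<open>
  Applying the counit to the third leg of the equation that defines \<open>G1\<close>, at \<open>c = u n n\<close>, isolates
  \<open>G1 (a \<otimes> b)\<close>.
\<close>

lemma structure_G1_unique:
  assumes W: "weak_multiplier_hopf_structure D \<epsilon> E G1 G2"
  shows "G1 = partial_G1 I u"
proof -
  have G1: "clinear G1" and cond: "tmap G1 (\<lambda>x. x) (T1_leg13 a (b \<otimes> c)) = T1_leg13 a (E0 \<rhd> (b \<otimes> c))" for a b c
    using W structure_idempotent_unique[OF W] unfolding weak_multiplier_hopf_structure_def G1_condition_iff by blast+
  define c where "c = tlift (\<lambda>(w :: 'a \<otimes> 'a) (y :: 'a). \<epsilon> y *\<^sub>C w)"
  have bil: "cbilinear (\<lambda>(w :: 'a \<otimes> 'a) (y :: 'a). \<epsilon> y *\<^sub>C w)" by (intro clin)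
  have c: "clinear c" and c_pure: "c (w \<otimes> y) = \<epsilon> y *\<^sub>C w" for w y
    unfolding c_def by (simp_all add: clinear_tlift tlift_pure bil)
  have c_G1: "c (tmap G1 (\<lambda>x. x) w) = G1 (c w)" for w
    by (rule clinear_tensor_eqI[where x = w])
      (intro clin c G1 clinear_compose[OF _ c] clinear_compose[OF c G1] | simp add: tmap_pure G1 clinear_id c_pure clinear_scale[OF G1])+
  have c_swap: "c (tswap23 (z \<otimes> b)) = tlift (\<lambda>x y. \<epsilon> y *\<^sub>C (x \<otimes> b)) z" for z b
  proof (rule clinear_tensor_eqI[where x = z])
    have "cbilinear (\<lambda>(x::'a) y. \<epsilon> y *\<^sub>C (x \<otimes> b))" by (intro clin)
    then show "c (tswap23 (x \<otimes> y \<otimes> b)) = tlift (\<lambda>x y. \<epsilon> y *\<^sub>C (x \<otimes> b)) (x \<otimes> y)" for x y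
      by (simp add: tlift_pure tswap23_pure c_pure)
  qed (intro clin clinear_compose[OF _ c])+
  show ?thesis
  proof
    show "G1 z = partial_G1 I u z" for z
    proof (rule homog_tensor_eqI[where z = z, OF G1 clinear_partial_G1])
      fix k l m n k' l' m' n' a b assume a: "homog k l m n a" and b: "homog k' l' m' n' b"
      have U: "homog n n n n (u n n)" using homog_index[OF a] by (intro homog_unit)
      have key: "c (T1_leg13 a (b \<otimes> u n n)) = a \<otimes> b"
        by (simp add: T1_leg13_pure c_swap counit_T1_unit[OF a clinear_pure_tensor(1)[OF clinear_id]])
      have "G1 (a \<otimes> b) = c (tmap G1 (\<lambda>x. x) (T1_leg13 a (b \<otimes> u n n)))"
        by (simp add: c_G1 key)
      also have "\<dots> = c (T1_leg13 a (E0 \<rhd> (b \<otimes> u n n)))" by (simp only: cond)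
      also have "\<dots> = partial_G1 I u (a \<otimes> b)"
        using key by (auto simp: canonical_idempotent_homog[OF b U] partial_maps_homog(1)[OF a b]
            clinear_0[OF c] clinear_0[OF clinear_T1_leg13])
      finally show "G1 (a \<otimes> b) = partial_G1 I u (a \<otimes> b)" .
    qed
  qed
qed

text \<open>Here the counit is applied to the first leg, at \<open>a = u k' k'\<close>.\<close>

lemma structure_G2_unique:
  assumes W: "weak_multiplier_hopf_structure D \<epsilon> E G1 G2"
  shows "G2 = partial_G2 I u"
proof -
  have G2: "clinear G2"
    and cond: "tassoc (tmap (\<lambda>x. x) G2 (inv tassoc (T2_leg13 c (a \<otimes> b)))) = T2_leg13 c ((a \<otimes> b) \<lhd> E0)" for a b c
    using W structure_idempotent_unique[OF W] unfolding weak_multiplier_hopf_structure_def G2_condition_iff by blast+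
  define c where "c = tlift (\<lambda>(x :: 'a) (w :: 'a \<otimes> 'a). \<epsilon> x *\<^sub>C w)"
  have bil: "cbilinear (\<lambda>(x :: 'a) (w :: 'a \<otimes> 'a). \<epsilon> x *\<^sub>C w)" by (intro clin)
  have c: "clinear c" and c_pure: "c (x \<otimes> w) = \<epsilon> x *\<^sub>C w" for w x
    unfolding c_def by (simp_all add: clinear_tlift tlift_pure bil)
  have c_G2: "c (tmap (\<lambda>x. x) G2 w) = G2 (c w)" for w
    by (rule clinear_tensor_eqI[where x = w])
      (intro clin c G2 clinear_compose[OF _ c] clinear_compose[OF c G2] | simp add: tmap_pure G2 clinear_id c_pure clinear_scale[OF G2])+
  have c_swap: "c (inv tassoc (tswap23 (z \<otimes> b))) = tlift (\<lambda>x y. \<epsilon> x *\<^sub>C (b \<otimes> y)) z" for z b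
  proof (rule clinear_tensor_eqI[where x = z])
    have "cbilinear (\<lambda>x (y::'a). \<epsilon> x *\<^sub>C (b \<otimes> y))" by (intro clin)
    then show "c (inv tassoc (tswap23 (x \<otimes> y \<otimes> b))) = tlift (\<lambda>x y. \<epsilon> x *\<^sub>C (b \<otimes> y)) (x \<otimes> y)" for x y
      by (simp add: tlift_pure tswap23_pure c_pure inv_tassoc_pure)
  qed (intro clin clinear_compose[OF _ c] clinear_compose[OF _ clinear_inv_tassoc])+
  show ?thesis
  proof
    show "G2 z = partial_G2 I u z" for z
    proof (rule homog_tensor_eqI[where z = z, OF G2 clinear_partial_G2])
      fix k l m n k' l' m' n' b a assume b: "homog k l m n b" and a: "homog k' l' m' n' a"
      have U: "homog k' k' k' k' (u k' k')" using homog_index[OF a] by (intro homog_unit)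
      have key: "c (inv tassoc (T2_leg13 a (u k' k' \<otimes> b))) = b \<otimes> a"
        by (simp add: T2_leg13_pure c_swap counit_T2_unit[OF a clinear_pure_tensor(2)[OF clinear_id]])
      have "G2 (b \<otimes> a) = c (inv tassoc (tassoc (tmap (\<lambda>x. x) G2 (inv tassoc (T2_leg13 a (u k' k' \<otimes> b))))))"
        by (simp add: inv_tassoc_tassoc c_G2 key)
      also have "\<dots> = c (inv tassoc (T2_leg13 a ((u k' k' \<otimes> b) \<lhd> E0)))" by (simp only: cond)
      also have "\<dots> = partial_G2 I u (b \<otimes> a)"
        by (simp add: canonical_idempotent_homog[OF U b] key partial_maps_homog(3)[OF b a]
            clinear_0[OF c] clinear_0[OF clinear_T2_leg13] clinear_0[OF clinear_inv_tassoc])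
      finally show "G2 (b \<otimes> a) = partial_G2 I u (b \<otimes> a)" .
    qed
  qed
qed

lemma generalized_inverses_of_structure:
  assumes "weak_multiplier_hopf_structure D \<epsilon> E G1 G2"
  shows "\<exists>R1 R2. clinear R1 \<and> clinear R2 \<and>
    T1 D \<circ> R1 = partial_E1 I u \<and> R1 \<circ> T1 D = partial_G1 I u \<and>
    T1 D \<circ> R1 \<circ> T1 D = T1 D \<and> R1 \<circ> T1 D \<circ> R1 = R1 \<and>
    T2 D \<circ> R2 = partial_E2 I u \<and> R2 \<circ> T2 D = partial_G2 I u \<and>
    T2 D \<circ> R2 \<circ> T2 D = T2 D \<and> R2 \<circ> T2 D \<circ> R2 = R2"
proof -
  note unique = structure_idempotent_unique[OF assms] structure_G1_unique[OF assms] structure_G2_unique[OF assms]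
  note W = assms[unfolded unique weak_multiplier_hopf_structure_def]
  have G1: "partial_G1 I u (partial_G1 I u z) = partial_G1 I u z" and G2: "partial_G2 I u (partial_G2 I u z) = partial_G2 I u z" for z
    using W by (metis comp_apply)+
  have k1: "{x. T1 D x = 0} = range (\<lambda>x. x - partial_G1 I u x)"
    and k2: "{x. T2 D x = 0} = range (\<lambda>x. x - partial_G2 I u x)"
    and r1: "range (T1 D) = range (partial_E1 I u)" and r2: "range (T2 D) = range (partial_E2 I u)"
    using W by (simp_all add: partial_E1_eq[abs_def] partial_E2_eq[abs_def])
  have E: "partial_E1 I u (T1 D z) = T1 D z" "partial_E2 I u (T2 D z) = T2 D z" for z
    by (simp_all add: partial_E1_eq partial_E2_eq canonical_idempotent_T1 canonical_idempotent_T2)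
  from generalized_inverse_exists[OF clinear_T1 clinear_partial_G1 G1 k1 clinear_partial_E1 r1 E(1)]
    generalized_inverse_exists[OF clinear_T2 clinear_partial_G2 G2 k2 clinear_partial_E2 r2 E(2)]
  show ?thesis by blast
qed

lemma generalized_inverses_of_antipode:
  assumes S: "partial_antipode I A u \<Delta> \<epsilon> S"
  shows "T1 D \<circ> antipode_R1 S = partial_E1 I u" "antipode_R1 S \<circ> T1 D = partial_G1 I u"
    "T1 D \<circ> antipode_R1 S \<circ> T1 D = T1 D" "antipode_R1 S \<circ> T1 D \<circ> antipode_R1 S = antipode_R1 S"
    "T2 D \<circ> antipode_R2 S = partial_E2 I u" "antipode_R2 S \<circ> T2 D = partial_G2 I u"
    "T2 D \<circ> antipode_R2 S \<circ> T2 D = T2 D" "antipode_R2 S \<circ> T2 D \<circ> antipode_R2 S = antipode_R2 S"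
proof -
  show "T1 D \<circ> antipode_R1 S = partial_E1 I u" "T1 D \<circ> antipode_R1 S \<circ> T1 D = T1 D"
    by (simp_all only: fun_eq_iff o_apply T1_antipode_R1[OF S] partial_E1_eq canonical_idempotent_T1 simp_thms)
  show "antipode_R1 S \<circ> T1 D = partial_G1 I u" "antipode_R1 S \<circ> T1 D \<circ> antipode_R1 S = antipode_R1 S"
    by (simp_all only: fun_eq_iff o_apply antipode_R1_T1[OF S] partial_G1_antipode_R1[OF S] simp_thms)
  show "T2 D \<circ> antipode_R2 S = partial_E2 I u" "T2 D \<circ> antipode_R2 S \<circ> T2 D = T2 D"
    by (simp_all only: fun_eq_iff o_apply T2_antipode_R2[OF S] partial_E2_eq canonical_idempotent_T2 simp_thms)
  show "antipode_R2 S \<circ> T2 D = partial_G2 I u" "antipode_R2 S \<circ> T2 D \<circ> antipode_R2 S = antipode_R2 S"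
    by (simp_all only: fun_eq_iff o_apply antipode_R2_T2[OF S] partial_G2_antipode_R2[OF S] simp_thms)
qed

text \<open>
  If \<open>c\<close> and \<open>b\<close> select different rows, both sides vanish: the left one because \<open>c * x = 0\<close>, the right
  one because \<open>S y * b = 0\<close>.
\<close>

lemma antipode_R1_formula:
  assumes S: "partial_antipode I A u \<Delta> \<epsilon> S"
  shows "(\<iota> c \<otimes>\<^sub>M 1) \<rhd> antipode_R1 S (a \<otimes> b) = tlift (\<lambda>p q. p \<otimes> (\<iota> (S q) \<rhd> b)) (T2 D (c \<otimes> a))"
proof -
  note lin [clin] = clinear_antipode[OF S] clinear_antipode_R_comp[OF S]
  have homog: "(\<iota> c \<otimes>\<^sub>M 1) \<rhd> antipode_R1 S (a \<otimes> b) = tlift (\<lambda>p q. p \<otimes> (\<iota> (S q) \<rhd> b)) (T2 D (c \<otimes> a))"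
    if c: "homog k1 l1 m1 n1 c" and a: "homog k l m n a" and b: "homog k' l' m' n' b"
    for k1 l1 m1 n1 k l m n k' l' m' n' a b c
  proof -
    note I = homog_index[OF c] homog_index[OF b]
    have bil: "cbilinear (\<lambda>x y. x \<otimes> (S y * b))" "cbilinear (\<lambda>x y. (c * x) \<otimes> y)" "cbilinear (\<lambda>x y. (c * x) \<otimes> (S y * b))"
      by (intro clin)+
    have "(\<iota> c \<otimes>\<^sub>M 1) \<rhd> antipode_R1 S (a \<otimes> b) = tlift (\<lambda>x y. (c * x) \<otimes> (S y * b)) (comult_row m' a)"
      unfolding antipode_R1_homog[OF S b] tlift_linear[OF clinear_lact bil(1)]
      by (simp add: mtensor_act_pure multiplier_act mult_of_act)
    also have "\<dots> = tlift (\<lambda>x y. (c * x) \<otimes> (S y * b)) (comult_row n1 a)"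
    proof (cases "m' = n1")
      case False
      have "tlift (\<lambda>x y. (c * x) \<otimes> (S y * b)) (comult_row m' a) = tlift (\<lambda>x y. 0) (comult_row m' a)"
      proof (rule comult_row_cong[OF a I(7) bil(3)])
        fix s x y assume x: "homog k l m' s x"
        show "(c * x) \<otimes> (S y * b) = 0" using homog_mult_0[OF c x] False by auto
      qed (intro clin)
      moreover have "tlift (\<lambda>x y. (c * x) \<otimes> (S y * b)) (comult_row n1 a) = tlift (\<lambda>x y. 0) (comult_row n1 a)"
      proof (rule comult_row_cong[OF a I(4) bil(3)])
        fix s x y assume y: "homog n1 s m n y"
        show "(c * x) \<otimes> (S y * b) = 0" using homog_mult_0[OF antipode_homog[OF S y] b] False by auto
      qed (intro clin)
      ultimately show ?thesis by (simp add: tlift_zero)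
    qed simp
    also have "\<dots> = tlift (\<lambda>p q. p \<otimes> (\<iota> (S q) \<rhd> b)) (T2 D (c \<otimes> a))"
      unfolding T2_homog[OF c] mult_of_act
      by (subst tlift_linear[OF clinear_tlift[OF bil(1)] bil(2)]) (simp add: tlift_pure[OF bil(1)])
    finally show ?thesis .
  qed
  have bil: "cbilinear (\<lambda>p q. p \<otimes> (\<iota> (S q) \<rhd> b))" for b by (intro clin)
  note lin' = clinear_tlift_comp[OF bil]
  have 1: "(\<iota> c \<otimes>\<^sub>M 1) \<rhd> antipode_R1 S z = tlift (\<lambda>a b. tlift (\<lambda>p q. p \<otimes> (\<iota> (S q) \<rhd> b)) (T2 D (c \<otimes> a))) z"
    if "homog k1 l1 m1 n1 c" for k1 l1 m1 n1 c z
  proof (rule homog_tensor_eqI[where z = z])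
    have b: "cbilinear (\<lambda>a b. tlift (\<lambda>p q. p \<otimes> (\<iota> (S q) \<rhd> b)) (T2 D (c \<otimes> a)))" by (intro clin)
    show "clinear (tlift (\<lambda>a b. tlift (\<lambda>p q. p \<otimes> (\<iota> (S q) \<rhd> b)) (T2 D (c \<otimes> a))))" by (rule clinear_tlift[OF b])
    show "(\<iota> c \<otimes>\<^sub>M 1) \<rhd> antipode_R1 S (a \<otimes> b) = tlift (\<lambda>a b. tlift (\<lambda>p q. p \<otimes> (\<iota> (S q) \<rhd> b)) (T2 D (c \<otimes> a))) (a \<otimes> b)"
      if "homog k l m n a" "homog k' l' m' n' b" for k l m n k' l' m' n' a b
      unfolding tlift_pure[OF b] by (rule homog[OF \<open>homog k1 l1 m1 n1 c\<close> that])
  qed (intro clin)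
  have b: "cbilinear (\<lambda>a b. tlift (\<lambda>p q. p \<otimes> (\<iota> (S q) \<rhd> b)) (T2 D (c \<otimes> a)))" for c by (intro clin)
  show ?thesis
  proof (rule homog_eqI[where a = c])
    show "(\<iota> c \<otimes>\<^sub>M 1) \<rhd> antipode_R1 S (a \<otimes> b) = tlift (\<lambda>p q. p \<otimes> (\<iota> (S q) \<rhd> b)) (T2 D (c \<otimes> a))"
      if "homog k l m n c" for k l m n c
      using 1[OF that, of "a \<otimes> b"] by (simp only: tlift_pure[OF b])
  qed (intro clin)+
qed

lemma antipode_R2_formula:
  assumes S: "partial_antipode I A u \<Delta> \<epsilon> S"
  shows "antipode_R2 S (a \<otimes> b) \<lhd> (1 \<otimes>\<^sub>M \<iota> c) = tlift (\<lambda>p q. (a \<lhd> \<iota> (S p)) \<otimes> q) (T1 D (b \<otimes> c))"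
proof -
  note lin [clin] = clinear_antipode[OF S] clinear_antipode_R_comp[OF S]
  have homog: "antipode_R2 S (a \<otimes> b) \<lhd> (1 \<otimes>\<^sub>M \<iota> c) = tlift (\<lambda>p q. (a \<lhd> \<iota> (S p)) \<otimes> q) (T1 D (b \<otimes> c))"
    if c: "homog k1 l1 m1 n1 c" and a: "homog k l m n a" and b: "homog k' l' m' n' b"
    for k1 l1 m1 n1 k l m n k' l' m' n' a b c
  proof -
    note I = homog_index[OF c] homog_index[OF a]
    have bil: "cbilinear (\<lambda>x y. (a * S x) \<otimes> y)" "cbilinear (\<lambda>x y. x \<otimes> (y * c))" "cbilinear (\<lambda>x y. (a * S x) \<otimes> (y * c))"
      by (intro clin)+
    have "antipode_R2 S (a \<otimes> b) \<lhd> (1 \<otimes>\<^sub>M \<iota> c) = tlift (\<lambda>x y. (a * S x) \<otimes> (y * c)) (comult_col l b)"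
      unfolding antipode_R2_homog[OF S a] tlift_linear[OF clinear_ract bil(1)]
      by (simp add: mtensor_act_pure multiplier_act mult_of_act)
    also have "\<dots> = tlift (\<lambda>x y. (a * S x) \<otimes> (y * c)) (comult_col k1 b)"
    proof (cases "l = k1")
      case False
      have "tlift (\<lambda>x y. (a * S x) \<otimes> (y * c)) (comult_col l b) = tlift (\<lambda>x y. 0) (comult_col l b)"
      proof (rule comult_col_cong[OF b I(6) bil(3)])
        fix r x y assume y: "homog r l m' n' y"
        show "(a * S x) \<otimes> (y * c) = 0" using homog_mult_0[OF y c] False by auto
      qed (intro clin)
      moreover have "tlift (\<lambda>x y. (a * S x) \<otimes> (y * c)) (comult_col k1 b) = tlift (\<lambda>x y. 0) (comult_col k1 b)"
      proof (rule comult_col_cong[OF b I(1) bil(3)])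
        fix r x y assume x: "homog k' l' r k1 x"
        show "(a * S x) \<otimes> (y * c) = 0" using homog_mult_0[OF a antipode_homog[OF S x]] False by auto
      qed (intro clin)
      ultimately show ?thesis by (simp add: tlift_zero)
    qed simp
    also have "\<dots> = tlift (\<lambda>p q. (a \<lhd> \<iota> (S p)) \<otimes> q) (T1 D (b \<otimes> c))"
      unfolding T1_homog[OF c] mult_of_act
      by (subst tlift_linear[OF clinear_tlift[OF bil(1)] bil(2)]) (simp add: tlift_pure[OF bil(1)])
    finally show ?thesis .
  qed
  have bil: "cbilinear (\<lambda>a b. tlift (\<lambda>p q. (a \<lhd> \<iota> (S p)) \<otimes> q) (T1 D (b \<otimes> c)))" for c by (intro clin)
  have 1: "antipode_R2 S z \<lhd> (1 \<otimes>\<^sub>M \<iota> c) = tlift (\<lambda>a b. tlift (\<lambda>p q. (a \<lhd> \<iota> (S p)) \<otimes> q) (T1 D (b \<otimes> c))) z"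
    if c: "homog k1 l1 m1 n1 c" for k1 l1 m1 n1 c z
    by (rule homog_tensor_eqI[where z = z, OF _ clinear_tlift[OF bil]])
      (intro clin, simp only: tlift_pure[OF bil] homog[OF c])
  show ?thesis
  proof (rule homog_eqI[where a = c])
    show "antipode_R2 S (a \<otimes> b) \<lhd> (1 \<otimes>\<^sub>M \<iota> c) = tlift (\<lambda>p q. (a \<lhd> \<iota> (S p)) \<otimes> q) (T1 D (b \<otimes> c))"
      if "homog k l m n c" for k l m n c
      using 1[OF that, of "a \<otimes> b"] by (simp only: tlift_pure[OF bil])
  qed (intro clin)+
qed

text \<open>
  The idempotent \<open>E\<close> and the projection \<open>G1\<close> are unique, hence so is the generalized inverse \<open>R1\<close>. Thus
  \<open>S\<close> and any other candidate satisfy the same formula for \<open>R1\<close>; taking \<open>c = u k k\<close> in it and applying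
  the counit to the first leg isolates the value of the candidate on \<open>a\<close>.
\<close>

lemma wmha_antipode_eq:
  assumes S: "partial_antipode I A u \<Delta> \<epsilon> S"
  shows "wmha_antipode D \<epsilon> = (\<lambda>a. \<iota> (S a))"
proof -
  note inverses = generalized_inverses_of_antipode[OF S]
  note lin = clinear_antipode_R1[OF S] clinear_antipode_R2[OF S]
  have W: "weak_multiplier_hopf_structure D \<epsilon> E0 (partial_G1 I u) (partial_G2 I u)"
    by (rule structure_of_generalized_inverses[OF lin(1) inverses(1-4) lin(2) inverses(5-8)])
  have E: "partial_E1 I u = (\<lambda>x. E0 \<rhd> x)" "partial_E2 I u = (\<lambda>x. x \<lhd> E0)"
    by (auto simp: partial_E1_eq partial_E2_eq)
  let ?P = "\<lambda>S'. clinear S' \<and> (\<exists>E G1 G2 R1 R2. weak_multiplier_hopf_structure D \<epsilon> E G1 G2 \<and> clinear R1 \<and> clinear R2 \<and>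
        (\<forall>a b c. (\<iota> c \<otimes>\<^sub>M 1) \<rhd> R1 (a \<otimes> b) = tlift (\<lambda>p q. p \<otimes> (S' q \<rhd> b)) (T2 D (c \<otimes> a))) \<and>
        (\<forall>a b c. R2 (a \<otimes> b) \<lhd> (1 \<otimes>\<^sub>M \<iota> c) = tlift (\<lambda>p q. (a \<lhd> S' p) \<otimes> q) (T1 D (b \<otimes> c))) \<and>
        T1 D \<circ> R1 = (\<lambda>x. E \<rhd> x) \<and> R1 \<circ> T1 D = G1 \<and> T1 D \<circ> R1 \<circ> T1 D = T1 D \<and> R1 \<circ> T1 D \<circ> R1 = R1 \<and>
        T2 D \<circ> R2 = (\<lambda>x. x \<lhd> E) \<and> R2 \<circ> T2 D = G2 \<and> T2 D \<circ> R2 \<circ> T2 D = T2 D \<and> R2 \<circ> T2 D \<circ> R2 = R2)"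
  show ?thesis
    unfolding wmha_antipode_def
  proof (rule the_equality)
    show "?P (\<lambda>a. \<iota> (S a))"
      by (rule conjI, rule clinear_mult_of[OF clinear_antipode[OF S clinear_id]],
          rule exI[of _ E0], rule exI[of _ "partial_G1 I u"], rule exI[of _ "partial_G2 I u"],
          rule exI[of _ "antipode_R1 S"], rule exI[of _ "antipode_R2 S"],
          intro conjI allI W lin antipode_R1_formula[OF S] antipode_R2_formula[OF S] inverses[unfolded E])
  next
    fix S' assume "?P S'"
    then obtain E G1 G2 R1 where S': "clinear S'" and W': "weak_multiplier_hopf_structure D \<epsilon> E G1 G2"
      and formula: "\<And>a b c. (\<iota> c \<otimes>\<^sub>M 1) \<rhd> R1 (a \<otimes> b) = tlift (\<lambda>p q. p \<otimes> (S' q \<rhd> b)) (T2 D (c \<otimes> a))"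
      and R1: "T1 D \<circ> R1 = (\<lambda>x. E \<rhd> x)" "R1 \<circ> T1 D = G1" "R1 \<circ> T1 D \<circ> R1 = R1"
      by blast
    have "R1 = antipode_R1 S"
    proof -
      have "R1 = R1 \<circ> (T1 D \<circ> R1)" using R1(3) by (simp add: comp_assoc)
      also have "T1 D \<circ> R1 = T1 D \<circ> antipode_R1 S"
        unfolding R1(1) inverses(1) E structure_idempotent_unique[OF W'] by (rule refl)
      also have "R1 \<circ> (T1 D \<circ> antipode_R1 S) = (R1 \<circ> T1 D) \<circ> antipode_R1 S" by (simp add: comp_assoc)
      also have "R1 \<circ> T1 D = antipode_R1 S \<circ> T1 D"
        unfolding R1(2) inverses(2) by (rule structure_G1_unique[OF W'])
      also have "\<dots> \<circ> antipode_R1 S = antipode_R1 S" by (rule inverses(4))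
      finally show ?thesis .
    qed
    then have eq: "tlift (\<lambda>p q. p \<otimes> (S' q \<rhd> b)) (T2 D (c \<otimes> a)) = tlift (\<lambda>p q. p \<otimes> (\<iota> (S q) \<rhd> b)) (T2 D (c \<otimes> a))" for a b c
      using formula antipode_R1_formula[OF S] by simp
    have slice: "F a \<rhd> b = tlift (\<lambda>x y. \<epsilon> x *\<^sub>C y) (tlift (\<lambda>p q. p \<otimes> (F q \<rhd> b)) (T2 D (u k k \<otimes> a)))"
      if a: "homog k l m n a" and F: "clinear F" for k l m n a b and F :: "'a \<Rightarrow> 'a multiplier"
    proof -
      have b: "cbilinear (\<lambda>x y. \<epsilon> x *\<^sub>C (y::'a))" "cbilinear (\<lambda>p q. p \<otimes> (F q \<rhd> b))" by (intro clin F)+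
      have "F a \<rhd> b = tlift (\<lambda>p q. \<epsilon> p *\<^sub>C (F q \<rhd> b)) (T2 D (u k k \<otimes> a))"
        by (rule counit_T2_unit[OF a, symmetric]) (intro clin F)
      then show ?thesis unfolding tlift_linear[OF clinear_tlift[OF b(1)] b(2)] tlift_pure[OF b(1)] .
    qed
    show "S' = (\<lambda>a. \<iota> (S a))"
    proof
      show "S' a = \<iota> (S a)" for a
      proof (rule homog_eqI[where a = a, OF S' clinear_mult_of[OF clinear_antipode[OF S clinear_id]]])
        fix k l m n a assume a: "homog k l m n a"
        show "S' a = \<iota> (S a)"
          by (rule multiplier_eqI_A)
            (simp only: slice[OF a S'] slice[OF a clinear_mult_of[OF clinear_antipode[OF S clinear_id]]] eq)
      qed
    qed
  qed
qed

end

theorem theorem1p31: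
  fixes I :: "'i set"
    and A :: "'i \<Rightarrow> 'i \<Rightarrow> 'i \<Rightarrow> 'i \<Rightarrow> 'a::complex_algebra set"
    and u :: "'i \<Rightarrow> 'i \<Rightarrow> 'a"
    and \<Delta> :: "'i \<Rightarrow> 'i \<Rightarrow> 'a \<Rightarrow> 'a \<otimes> 'a"
    and \<epsilon> :: "'a \<Rightarrow> complex"
  assumes "partial_bialgebra I A u \<Delta> \<epsilon>"
  shows
    "let D = total_comult I A u \<Delta>;
         cond1 = partial_hopf_algebra I A u \<Delta> \<epsilon>;
         cond2 = (\<exists>R1 R2. clinear R1 \<and> clinear R2 \<and>
           T1 D \<circ> R1 = partial_E1 I u \<and> R1 \<circ> T1 D = partial_G1 I u \<and>
           T1 D \<circ> R1 \<circ> T1 D = T1 D \<and> R1 \<circ> T1 D \<circ> R1 = R1 \<and>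
           T2 D \<circ> R2 = partial_E2 I u \<and> R2 \<circ> T2 D = partial_G2 I u \<and>
           T2 D \<circ> R2 \<circ> T2 D = T2 D \<and> R2 \<circ> T2 D \<circ> R2 = R2);
         cond3 = weak_multiplier_hopf_algebra D \<epsilon>
     in (cond1 \<longleftrightarrow> cond2) \<and> (cond2 \<longleftrightarrow> cond3) \<and>
        (cond1 \<longrightarrow> (\<forall>S. partial_antipode I A u \<Delta> \<epsilon> S \<longrightarrow> wmha_antipode D \<epsilon> = (\<lambda>a. \<iota> (S a))))"
proof -
  interpret partial_bialgebra I A u \<Delta> \<epsilon> by fact
  define cond2 where "cond2 \<longleftrightarrow> (\<exists>R1 R2. clinear R1 \<and> clinear R2 \<and>
           T1 D \<circ> R1 = partial_E1 I u \<and> R1 \<circ> T1 D = partial_G1 I u \<and>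
           T1 D \<circ> R1 \<circ> T1 D = T1 D \<and> R1 \<circ> T1 D \<circ> R1 = R1 \<and>
           T2 D \<circ> R2 = partial_E2 I u \<and> R2 \<circ> T2 D = partial_G2 I u \<and>
           T2 D \<circ> R2 \<circ> T2 D = T2 D \<and> R2 \<circ> T2 D \<circ> R2 = R2)"
  have "cond2" if "partial_hopf_algebra I A u \<Delta> \<epsilon>"
  proof -
    from that obtain S where S: "partial_antipode I A u \<Delta> \<epsilon> S" by (auto simp: partial_hopf_algebra_def)
    show ?thesis unfolding cond2_def
      using generalized_inverses_of_antipode[OF S] clinear_antipode_R1[OF S] clinear_antipode_R2[OF S] by blast
  qed
  moreover have "partial_hopf_algebra I A u \<Delta> \<epsilon>" if cond2
  proof -
    from that obtain R1 where R1: "clinear R1" "T1 D \<circ> R1 = partial_E1 I u" "R1 \<circ> T1 D = partial_G1 I u"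
      "R1 \<circ> T1 D \<circ> R1 = R1" unfolding cond2_def by blast
    have "partial_antipode I A u \<Delta> \<epsilon> (antipode_of_R1 R1)"
      by (rule partial_antipode_of_R1[OF R1(1)]) (use R1(2-4) in \<open>simp_all add: fun_eq_iff\<close>)
    with assms show ?thesis by (auto simp: partial_hopf_algebra_def)
  qed
  moreover have "weak_multiplier_hopf_algebra D \<epsilon>" if cond2
    using that structure_of_generalized_inverses unfolding cond2_def weak_multiplier_hopf_algebra_def by blast
  moreover have "cond2" if "weak_multiplier_hopf_algebra D \<epsilon>"
    using that generalized_inverses_of_structure unfolding cond2_def weak_multiplier_hopf_algebra_def by blast
  ultimately show ?thesis
    unfolding Let_def cond2_def[symmetric] using wmha_antipode_eq by blast
qed

end
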